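(* Let $d=2$ or $d=3$, $0<a<1/2$ and $x_0\in\mathbb{T}^d$. Then $$S_\lambda(u_{\beta,a})(x_0)-\sigma_\lambda(U_{\beta,a})(x_0)=o(1)\ \text{ as }\lambda\to\infty\ \text{ for all }\beta>-1$$ if and only if $$\Delta_0(s:x_0)=O\left(s^{\frac{d-1}4+\varepsilon}\right)\ \text{ as }s\to\infty\ \text{ for all }\varepsilon>0.$$
   Context: $\mathbb{T}^d$ is identified with $(-1/2,1/2]^d\subset\mathbb{R}^d$; $|\cdot|$ is the Euclidean norm, products such as $\xi x$ are inner products. For $\beta>-1$, $a>0$: $U_{\beta,a}(x)=(a^2-|x|^2)^{\beta}$ if $|x|<a$ and $U_{\beta,a}(x)=0$ if $|x|\ge a$ ($x\in\mathbb{R}^d$), and $u_{\beta,a}(x)=\sum_{m\in\mathbb{Z}^d}U_{\beta,a}(x+m)$, $x\in\mathbb{T}^d$. For integrable $F$ on $\mathbb{R}^d$: $\hat F(\xi)=\int_{\mathbb{R}^d}F(x)e^{-2\pi i\xi x}\,dx$, $\sigma_\lambda(F)(x)=\int_{|\xi|<\lambda}\hat F(\xi)e^{2\pi i\xi x}\,d\xi$. For integrable $f$ on $\mathbb{T}^d$: $\hat f(m)=\int_{\mathbb{T}^d}f(x)e^{-2\pi imx}\,dx$, $S_\lambda(f)(x)=\sum_{m\in\mathbb{Z}^d,\,|m|<\lambda}\hat f(m)e^{2\pi imx}$. For $s>0$, $x\in\mathbb{R}^d$: $\Delta_0(s:x)=\sum_{m\in\mathbb{Z}^d,\,|m|^2<s}e^{2\pi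 imx}-\int_{|\xi|^2<s}e^{2\pi i\xi x}\,d\xi$. *)

theory Defs
  imports "HOL-Analysis.Analysis" "HOL-Library.Landau_Symbols"
begin

text \<open>The dimension is \<^term>\<open>CARD('n)\<close>.  The torus is identified with its fundamental
  domain in \<open>real ^ 'n\<close>, and the integer lattice is regarded as a subset of \<open>real ^ 'n\<close>.\<close>

definition torus :: "(real ^ 'n) set" where
  "torus = {x. \<forall>i. - 1 / 2 < x $ i \<and> x $ i \<le> 1 / 2}"

definition lattice_pts :: "(real ^ 'n) set" where
  "lattice_pts = {m. \<forall>i. m $ i \<in> \<int>}"

definition U_fun :: "real \<Rightarrow> real \<Rightarrow> real ^ 'n \<Rightarrow> real" where
  "U_fun \<beta> a x = (if norm x < a then (a\<^sup>2 - (norm x)\<^sup>2) powr \<beta> else 0)"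

text \<open>For every point \<open>x\<close> only finitely many terms of the following sum are nonzero.\<close>

definition u_fun :: "real \<Rightarrow> real \<Rightarrow> real ^ 'n \<Rightarrow> real" where
  "u_fun \<beta> a x = (\<Sum>\<^sub>\<infinity>m\<in>lattice_pts. U_fun \<beta> a (x + m))"

definition fourier_transform :: "(real ^ 'n \<Rightarrow> complex) \<Rightarrow> real ^ 'n \<Rightarrow> complex" where
  "fourier_transform F \<xi> = (LINT x|lebesgue. F x * cis (- 2 * pi * (\<xi> \<bullet> x)))"

definition fourier_partial_integral ::
    "real \<Rightarrow> (real ^ 'n \<Rightarrow> complex) \<Rightarrow> real ^ 'n \<Rightarrow> complex" where
  "fourier_partial_integral r F x =
    (LINT \<xi>:{\<xi>. norm \<xi> < r}|lebesgue. fourier_transform F \<xi> * cis (2 * pi * (\<xi> \<bullet> x)))"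

definition fourier_coeff :: "(real ^ 'n \<Rightarrow> complex) \<Rightarrow> real ^ 'n \<Rightarrow> complex" where
  "fourier_coeff f m = (LINT x:torus|lebesgue. f x * cis (- 2 * pi * (m \<bullet> x)))"

definition fourier_partial_sum ::
    "real \<Rightarrow> (real ^ 'n \<Rightarrow> complex) \<Rightarrow> real ^ 'n \<Rightarrow> complex" where
  "fourier_partial_sum r f x =
    (\<Sum>m\<in>{m \<in> lattice_pts. norm m < r}. fourier_coeff f m * cis (2 * pi * (m \<bullet> x)))"

definition Delta0 :: "real \<Rightarrow> real ^ 'n \<Rightarrow> complex" where
  "Delta0 s x =
    (\<Sum>m\<in>{m \<in> lattice_pts. (norm m)\<^sup>2 < s}. cis (2 * pi * (m \<bullet> x)))
    - (LINT \<xi>:{\<xi>. (norm \<xi>)\<^sup>2 < s}|lebesgue. cis (2 * pi * (\<xi> \<bullet> x)))"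

text \<open>The index sets of the sums above are finite, so the convention that sums over infinite
  sets vanish plays no role.\<close>

lemma finite_lattice_pts_ball: "finite {m \<in> (lattice_pts :: (real ^ 'n) set). norm m < r}"
proof -
  define B where "B = {k :: real. k \<in> \<int> \<and> \<bar>k\<bar> \<le> r}"
  have "finite B"
    unfolding B_def by (rule finite_abs_int_segment)
  have "finite {m :: real ^ 'n. \<forall>i. m $ i \<in> B}"
  proof (rule rev_finite_subset)
    show "finite (vec_lambda ` (Pi\<^sub>E UNIV (\<lambda>_. B)) :: (real ^ 'n) set)"
      using \<open>finite B\<close> by (intro finite_imageI finite_PiE) auto
    show "{m :: real ^ 'n. \<forall>i. m $ i \<in> B} \<subseteq> vec_lambda ` (Pi\<^sub>E UNIV (\<lambda>_. B))"
    proof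
      fix m :: "real ^ 'n" assume "m \<in> {m. \<forall>i. m $ i \<in> B}"
      then have "vec_nth m \<in> Pi\<^sub>E UNIV (\<lambda>_. B)" by auto
      then have "vec_lambda (vec_nth m) \<in> (vec_lambda ` (Pi\<^sub>E UNIV (\<lambda>_. B)) :: (real ^ 'n) set)"
        by (rule imageI)
      then show "m \<in> vec_lambda ` (Pi\<^sub>E UNIV (\<lambda>_. B))" by simp
    qed
  qed
  moreover have "{m \<in> (lattice_pts :: (real ^ 'n) set). norm m < r} \<subseteq> {m. \<forall>i. m $ i \<in> B}"
    unfolding lattice_pts_def B_def
    by (auto intro: order_trans [OF component_le_norm_cart less_imp_le])
  ultimately show ?thesis by (rule rev_finite_subset)
qed

lemma finite_lattice_pts_ball_sq:
  "finite {m \<in> (lattice_pts :: (real ^ 'n) set). (norm m)\<^sup>2 < s}"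
proof -
  have "{m \<in> (lattice_pts :: (real ^ 'n) set). (norm m)\<^sup>2 < s}
      \<subseteq> {m \<in> lattice_pts. norm m < sqrt s}"
    by (auto intro: real_less_rsqrt)
  then show ?thesis
    using finite_lattice_pts_ball by (rule finite_subset)
qed

end

theory Submission
  imports Defs "HOL-Complex_Analysis.Complex_Analysis" "HOL-Real_Asymp.Real_Asymp"
    "HOL-Probability.Sinc_Integral"
begin

text \<open>
  The Fourier transform of \<open>U\<^sub>\<beta>\<^sub>,\<^sub>a\<close> is radial, decays like \<open>\<bar>\<xi>\<bar> powr - (\<beta> + (d + 1) / 2)\<close> and oscillates like a
  Bessel function. At the lattice points it gives the Fourier coefficients of \<open>u\<^sub>\<beta>\<^sub>,\<^sub>a\<close>, so both sides of
  the equivalence concern defects "sum over lattice points minus integral" of functions truncated at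
  \<open>\<bar>\<xi>\<bar> = \<lambda>\<close>. Replace the sharp truncation by a smooth cutoff whose Fourier transform lives in a
  tiny ball. A function whose Fourier transform is supported in a ball of radius less than 1/2 has
  defect zero by Poisson summation, since \<open>\<bar>x\<^sub>0 + m\<bar> \<ge> 1/2\<close> for \<open>m \<noteq> 0\<close>; this covers the cutoff and, as
  \<open>a < 1/2\<close>, its product with the transform of \<open>U\<^sub>\<beta>\<^sub>,\<^sub>a\<close>. Hence only the part of the truncation near
  \<open>\<bar>\<xi>\<bar> = \<lambda>\<close> matters, and summation by parts there loses nothing: a bound \<open>\<lambda> powr \<alpha>\<close> for the defect with
  radial weight \<open>\<phi>\<close> becomes \<open>\<lambda> powr (\<alpha> + \<kappa>)\<close> for \<open>\<phi> g\<close> whenever \<open>g\<close> and \<open>g'\<close> are of order \<open>r powr \<kappa>\<close>.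
  With \<open>\<phi> = 1\<close> and \<open>g\<close> the transform this gives one direction. For the other, two values of \<open>\<beta>\<close> close
  to \<open>-1\<close> yield transforms \<open>W\<^sub>1\<close>, \<open>W\<^sub>2\<close> that, relative to their amplitudes, are never both small, and
  \<open>1 = g\<^sub>1 W\<^sub>1 + g\<^sub>2 W\<^sub>2\<close> with \<open>g\<^sub>1\<close>, \<open>g\<^sub>2\<close> of the reciprocal order.
\<close>

section \<open>Oscillatory integrals of Bessel type\<close>

text \<open>Write d for the dimension. The transform of \<open>U_fun \<beta> a\<close> has size r
  powr -((d - 1) / 2 + (beta + 1)). At r = sqrt s the power r powr ((d - 1) / 2) is s powr ((d - 1)
  / 4), so the gap beta + 1 > 0 plays the part of epsilon. The lattice bound even yields a negative
  power of the radius for the difference, while the converse uses only that the difference stays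
  bounded. The obstacle in both directions is that the derivative of the transform is of the same
  order as the transform itself. Summation by parts over all radii up to lambda would therefore cost
  a full factor lambda. Subtracting a smooth cutoff with zero defect confines it to a window about
  lambda of essentially bounded width, where no power is lost. The converse has to divide by the
  transform, which has arbitrarily large zeros; a second exponent beta supplies a transform with
  shifted phase to use near those zeros.\<close>

definition powp :: "real \<Rightarrow> real \<Rightarrow> real" where
  "powp \<gamma> s = (if s > 0 then s powr \<gamma> else 0)"

lemma powp_nonneg [simp]: "powp \<gamma> s \<ge> 0"
  by (simp add: powp_def)

lemma borel_measurable_powp [measurable (raw)]:
  assumes [measurable]: "f \<in> borel_measurable M"
  shows "(\<lambda>x. powp \<gamma> (f x)) \<in> borel_measurable M"
  unfolding powp_def by measurable

lemma powp_mult: "c > 0 \<Longrightarrow> powp \<gamma> (c * s) = c powr \<gamma> * powp \<gamma> s"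
  by (auto simp: powp_def powr_mult zero_less_mult_iff)

lemma powp_eq_0_outside:
  assumes "a \<ge> 0" "t \<notin> {-a..a}"
  shows "powp \<mu> (a\<^sup>2 - t\<^sup>2) = 0"
proof -
  have "\<bar>a\<bar> \<le> \<bar>t\<bar>" using assms by auto
  then show ?thesis by (simp add: powp_def abs_le_square_iff)
qed

text \<open>With u = (1 + t) / 2 one has 1 - t^2 = 4 u (1 - u), so this is the Beta integral with
  both parameters mu + 1.\<close>

lemma integrable_powp_unit:
  assumes "\<mu> > -1"
  shows "integrable lborel (\<lambda>t. powp \<mu> (1 - t\<^sup>2))"
proof -
  have I: "((\<lambda>t::real. t powr \<mu> * (1 - t) powr \<mu>) has_integral Beta (\<mu>+1) (\<mu>+1)) {0..1}"
    using has_integral_Beta_real[of "\<mu>+1" "\<mu>+1"] assms by simp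
  have "((\<lambda>t. t powr \<mu> * (1 - t) powr \<mu>) has_integral Beta (\<mu>+1) (\<mu>+1)) {0<..<1::real}"
    using I by (simp add: has_integral_Icc_iff_Ioo)
  then have "((\<lambda>t. if t \<in> {0<..<1} then t powr \<mu> * (1 - t) powr \<mu> else 0) has_integral Beta (\<mu>+1) (\<mu>+1)) UNIV"
    by (simp only: has_integral_restrict_UNIV)
  moreover have "(\<lambda>t. if t \<in> {0<..<1} then t powr \<mu> * (1 - t) powr \<mu> else 0) = (\<lambda>t. powp \<mu> (t * (1 - t)))"
    by (auto simp: powp_def powr_mult zero_less_mult_iff fun_eq_iff)
  ultimately have "(\<lambda>t. powp \<mu> (t * (1 - t))) integrable_on UNIV"
    by (auto simp: integrable_on_def)
  then have "(\<lambda>t. powp \<mu> (t * (1 - t))) absolutely_integrable_on UNIV"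
    by (rule nonnegative_absolutely_integrable_1) simp
  then have "integrable lebesgue (\<lambda>t. powp \<mu> (t * (1 - t)))"
    by (simp add: set_integrable_def)
  then have "integrable lborel (\<lambda>t. powp \<mu> (t * (1 - t)))"
    by (subst (asm) integrable_completion) auto
  then have "integrable lborel (\<lambda>t. 4 powr \<mu> * powp \<mu> ((1/2 + (1/2) * t) * (1 - (1/2 + (1/2) * t))))"
    by (intro integrable_mult_right lborel_integrable_real_affine[where c="1/2" and t="1/2"]) auto
  moreover have "4 powr \<mu> * powp \<mu> ((1/2 + (1/2) * t) * (1 - (1/2 + (1/2) * t))) = powp \<mu> (1 - t\<^sup>2)" for t
    by (subst powp_mult[symmetric]) (auto simp: algebra_simps power2_eq_square)
  ultimately show ?thesis by (simp only:)
qed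

text \<open>In closed form this is \<open>Beta (1/2) (\<mu> + 1)\<close>; it enters only as a
  positive constant factor.\<close>

definition powp_const :: "real \<Rightarrow> real" where
  "powp_const \<mu> = (LINT t|lborel. powp \<mu> (1 - t\<^sup>2))"

lemma powp_scale:
  assumes "A > 0"
  shows "powp \<mu> (A - (sqrt A * t)\<^sup>2) = A powr \<mu> * powp \<mu> (1 - t\<^sup>2)"
  using assms powp_mult[of A \<mu> "1 - t\<^sup>2"] by (simp add: power_mult_distrib algebra_simps)

lemma integrable_powp:
  assumes "\<mu> > -1"
  shows "integrable lborel (\<lambda>t. powp \<mu> (A - t\<^sup>2))"
proof (cases "A > 0")
  case True
  have "integrable lborel (\<lambda>t. powp \<mu> (A - (0 + sqrt A * t)\<^sup>2))"
    using True integrable_powp_unit[OF assms] by (simp add: powp_scale)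
  then show ?thesis
    using True by (subst (asm) lborel_integrable_real_affine_iff[where f="\<lambda>t. powp \<mu> (A - t\<^sup>2)"]) auto
next
  case False
  then have "powp \<mu> (A - t\<^sup>2) = 0" for t
    using order_less_le_trans[of 0 A] zero_le_power2[of t] unfolding powp_def by (smt (verit))
  then show ?thesis by simp
qed

text \<open>One slice: integrating a coordinate out of a truncated power of A - |x|^2 leaves a
  truncated power in the other coordinates, with exponent raised by 1/2. Since \<open>powp\<close>
  vanishes at nonpositive arguments, the formula holds for every \<open>A\<close> and can be
  iterated.\<close>

lemma integral_powp:
  assumes "\<mu> > -1"
  shows "(LINT t|lborel. powp \<mu> (A - t\<^sup>2)) = powp_const \<mu> * powp (\<mu> + 1/2) A"
proof (cases "A > 0")
  case True
  have "(LINT t|lborel. powp \<mu> (A - t\<^sup>2)) = sqrt A * (LINT t|lborel. powp \<mu> (A - (0 + sqrt A * t)\<^sup>2))"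
    using True by (subst lborel_integral_real_affine[where c="sqrt A" and t=0]) auto
  also have "\<dots> = sqrt A * A powr \<mu> * powp_const \<mu>"
    using True by (simp add: powp_scale powp_const_def)
  also have "sqrt A * A powr \<mu> = A powr (\<mu> + 1/2)"
    using True by (simp add: powr_half_sqrt[symmetric] powr_add[symmetric] add.commute)
  finally show ?thesis using True by (simp add: powp_def)
next
  case False
  then have "powp \<mu> (A - t\<^sup>2) = 0" for t
    using order_less_le_trans[of 0 A] zero_le_power2[of t] unfolding powp_def by (smt (verit))
  then show ?thesis using False by (simp add: powp_def)
qed

lemma powp_const_pos:
  assumes "\<mu> > -1"
  shows "powp_const \<mu> > 0"
proof -
  have "powp_const \<mu> \<noteq> 0"
  proof
    assume "powp_const \<mu> = 0"
    then have "AE t in lborel. powp \<mu> (1 - t\<^sup>2) = 0"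
      unfolding powp_const_def
      by (subst (asm) integral_nonneg_eq_0_iff_AE[OF integrable_powp_unit[OF assms]]) auto
    then have "AE t in lborel. t \<notin> {-1<..<1::real}"
    proof (rule AE_mp, intro AE_I2 impI notI)
      fix t :: real assume "powp \<mu> (1 - t\<^sup>2) = 0" "t \<in> {-1<..<1}"
      then show False
        using abs_square_less_1[of t] by (auto simp: powp_def split: if_splits)
    qed
    then have "emeasure lborel {-1<..<1::real} = 0"
      by (subst (asm) AE_iff_measurable[of "{-1<..<1}"]) auto
    then show False by simp
  qed
  moreover have "powp_const \<mu> \<ge> 0" unfolding powp_const_def by simp
  ultimately show ?thesis by simp
qed

text \<open>Up to a constant factor, \<open>W \<mu> a r\<close> is \<open>(r / a) powr - (\<mu> + 1/2)\<close> times the Bessel function of order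
  \<open>\<mu> + 1/2\<close> at \<open>2 * pi * a * r\<close>; all asymptotics are obtained from the integral itself.\<close>

definition W :: "real \<Rightarrow> real \<Rightarrow> real \<Rightarrow> real" where
  "W \<mu> a r = (LINT t|lborel. powp \<mu> (a\<^sup>2 - t\<^sup>2) * cos (2 * pi * r * t))"

lemma integrable_powp_bounded:
  fixes h :: "real \<Rightarrow> 'b :: {banach, second_countable_topology, real_normed_field}"
  assumes "\<mu> > -1" "h \<in> borel_measurable borel" "\<And>t. norm (h t) \<le> B"
  shows "integrable lborel (\<lambda>t. of_real (powp \<mu> (A - t\<^sup>2)) * h t)"
proof (rule Bochner_Integration.integrable_bound)
  show "integrable lborel (\<lambda>t. powp \<mu> (A - t\<^sup>2) * B)"
    using integrable_powp[OF assms(1)] by simp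
  have "0 \<le> B" using assms(3)[of 0] norm_ge_zero order_trans by blast
  then show "AE x in lborel. norm (of_real (powp \<mu> (A - x\<^sup>2)) * h x) \<le> norm (powp \<mu> (A - x\<^sup>2) * B)"
    using assms(3) by (auto simp: norm_mult intro!: mult_left_mono)
qed (use assms in measurable)

lemma W_uminus: "W \<mu> a (- r) = W \<mu> a r"
  by (simp add: W_def)

text \<open>The sine part is odd in t and drops out. The complex form is the one that slicing and
  the contour argument produce.\<close>

lemma W_cis:
  assumes "\<mu> > -1"
  shows "(LINT t|lborel. complex_of_real (powp \<mu> (a\<^sup>2 - t\<^sup>2)) * cis (2 * pi * r * t)) = of_real (W \<mu> a r)"
proof -
  have i: "integrable lborel (\<lambda>t. powp \<mu> (a\<^sup>2 - t\<^sup>2) * cos (2 * pi * r * t))"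
          "integrable lborel (\<lambda>t. powp \<mu> (a\<^sup>2 - t\<^sup>2) * sin (2 * pi * r * t))"
    using integrable_powp_bounded[OF assms, where h="\<lambda>t. cos (2 * pi * r * t)" and B=1 and A="a\<^sup>2"]
      integrable_powp_bounded[OF assms, where h="\<lambda>t. sin (2 * pi * r * t)" and B=1 and A="a\<^sup>2"] by auto
  have "(LINT t|lborel. powp \<mu> (a\<^sup>2 - t\<^sup>2) * sin (2 * pi * r * t)) =
        (LINT t|lborel. powp \<mu> (a\<^sup>2 - (0 + (-1) * t)\<^sup>2) * sin (2 * pi * r * (0 + (-1) * t)))"
    by (subst lborel_integral_real_affine[where c="-1" and t=0]) auto
  then have z: "(LINT t|lborel. powp \<mu> (a\<^sup>2 - t\<^sup>2) * sin (2 * pi * r * t)) = 0"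
    by simp
  have "(LINT t|lborel. complex_of_real (powp \<mu> (a\<^sup>2 - t\<^sup>2)) * cis (2 * pi * r * t)) =
    (LINT t|lborel. of_real (powp \<mu> (a\<^sup>2 - t\<^sup>2) * cos (2 * pi * r * t)) + \<i> * of_real (powp \<mu> (a\<^sup>2 - t\<^sup>2) * sin (2 * pi * r * t)))"
    by (intro Bochner_Integration.integral_cong) (auto simp: complex_eq_iff)
  also have "\<dots> = of_real (W \<mu> a r) + \<i> * of_real 0"
    unfolding W_def z[symmetric] using i
    by (subst Bochner_Integration.integral_add) (auto intro!: integrable_of_real simp del: of_real_mult)
  finally show ?thesis by simp
qed

text \<open>Reduces to frequency 1, so that the contour argument has a single parameter, the
  half-length a * r of the interval.\<close>

lemma W_scale:
  assumes "a > 0" "r > 0"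
  shows "W \<mu> a r = r powr (- 2 * \<mu> - 1) * W \<mu> (a * r) 1"
proof -
  have "W \<mu> a r = inverse r * (LINT t|lborel. powp \<mu> (a\<^sup>2 - (0 + inverse r * t)\<^sup>2) * cos (2 * pi * r * (0 + inverse r * t)))"
    unfolding W_def using assms by (subst lborel_integral_real_affine[where c="inverse r" and t=0]) auto
  also have "(\<lambda>t. powp \<mu> (a\<^sup>2 - (0 + inverse r * t)\<^sup>2) * cos (2 * pi * r * (0 + inverse r * t)))
     = (\<lambda>t. r powr (-2 * \<mu>) * (powp \<mu> ((a * r)\<^sup>2 - t\<^sup>2) * cos (2 * pi * 1 * t)))"
  proof
    fix t
    have 1: "a\<^sup>2 - (0 + inverse r * t)\<^sup>2 = inverse (r^2) * ((a * r)\<^sup>2 - t\<^sup>2)"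
      using assms by (simp add: field_simps)
    have "inverse (r^2) = r powr (-2)" using assms by (simp add: powr_minus powr_numeral)
    then have 2: "inverse (r^2) powr \<mu> = r powr (- 2 * \<mu>)" by (simp add: powr_powr)
    have "powp \<mu> (a\<^sup>2 - (0 + inverse r * t)\<^sup>2) = r powr (- 2 * \<mu>) * powp \<mu> ((a * r)\<^sup>2 - t\<^sup>2)"
      unfolding 1 using assms by (subst powp_mult) (auto simp: 2)
    moreover have "2 * pi * r * (0 + inverse r * t) = 2 * pi * 1 * t"
      using assms by simp
    ultimately show "powp \<mu> (a\<^sup>2 - (0 + inverse r * t)\<^sup>2) * cos (2 * pi * r * (0 + inverse r * t)) = r powr (-2 * \<mu>) * (powp \<mu> ((a * r)\<^sup>2 - t\<^sup>2) * cos (2 * pi * 1 * t))"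
      by (simp only: mult.assoc)
  qed
  also have "inverse r * (LINT t|lborel. r powr (-2 * \<mu>) * (powp \<mu> ((a * r)\<^sup>2 - t\<^sup>2) * cos (2 * pi * 1 * t)))
     = inverse r * r powr (-2 * \<mu>) * W \<mu> (a * r) 1"
    by (simp add: W_def)
  also have "inverse r * r powr (-2 * \<mu>) = r powr (- 2 * \<mu> - 1)"
    using assms by (simp add: powr_diff field_simps)
  finally show ?thesis .
qed

section \<open>Contour integrals in the upper half-plane\<close>

lemma contour_integral_linepath_same_Im:
  assumes "a < b"
  shows "contour_integral (linepath (Complex a c) (Complex b c)) f = integral {a..b} (\<lambda>x. f (Complex x c))"
proof -
  let ?z = "Complex a c" and ?z' = "Complex b c"
  have "contour_integral (linepath ?z ?z') f = (?z' - ?z) * integral {0..1} (\<lambda>x. f (linepath ?z ?z' x))"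
    by (simp add: contour_integral_integral)
  also have "?z' - ?z = of_real (b - a)"
    by (simp add: complex_eq_iff)
  also have "integral {0..1} (\<lambda>x. f (linepath ?z ?z' x)) = integral {0..1} (\<lambda>x. f (Complex (linepath a b x) c))"
    by (intro integral_cong arg_cong[of _ _ f]) (simp add: linepath_def complex_eq_iff algebra_simps)
  also have "\<dots> = integral {0..(b - a) / (b - a)} (\<lambda>x. f (Complex (a + (b - a) * x) c))"
    using \<open>a < b\<close> by (simp add: algebra_simps linepath_def)
  also have "{0..(b - a) / (b - a)} = (\<lambda>x. x / (b - a)) ` {0..b - a}"
    using \<open>a < b\<close> by simp
  also have "integral \<dots> (\<lambda>x. f (Complex (a + (b - a) * x) c)) =
             integral {a-a..b-a} (\<lambda>x. f (Complex (x + a) c)) / of_real (b - a)"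
    using \<open>a < b\<close> by (subst integral_stretch_real) (auto simp: scaleR_conv_of_real add_ac)
  also have "\<dots> = integral {a..b} (\<lambda>x. f (Complex x c)) / of_real (b - a)"
    by (subst integral_shift_real_ivl) (rule refl)
  finally show ?thesis
    using \<open>a < b\<close> by simp
qed

text \<open>The integrand in \<open>W_contour\<close> has branch points at -A and A, so the lower
  side of the rectangle runs at a positive height, which later tends to 0.\<close>

lemma rectangle_integral:
  assumes f: "f holomorphic_on {z. Im z > 0}" and "a < b" "0 < \<eta>" "\<eta> < Y"
  shows "integral {a..b} (\<lambda>x. f (Complex x \<eta>)) + \<i> * integral {\<eta>..Y} (\<lambda>y. f (Complex b y))
       = integral {a..b} (\<lambda>x. f (Complex x Y)) + \<i> * integral {\<eta>..Y} (\<lambda>y. f (Complex a y))"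
proof -
  let ?S = "{z. Im z > 0}"
  let ?g = "rectpath (Complex a \<eta>) (Complex b Y)"
  have conv: "convex ?S" by (rule convex_halfspace_Im_gt)
  have sub: "closed_segment z w \<subseteq> ?S" if "Im z > 0" "Im w > 0" for z w
    using that by (intro closed_segment_subset conv) auto
  have c: "continuous_on (closed_segment z w) f" if "Im z > 0" "Im w > 0" for z w
    using f sub[OF that] holomorphic_on_imp_continuous_on continuous_on_subset by blast
  have ci: "f contour_integrable_on linepath z w" if "Im z > 0" "Im w > 0" for z w
    using c[OF that] by (rule contour_integrable_continuous_linepath)
  have pos: "Im (Complex u v) > 0" if "v \<in> {\<eta>, Y}" for u v using that assms by auto
  have "(f has_contour_integral 0) ?g"
    by (rule Cauchy_theorem_convex_simple[OF f conv])
       (use assms sub in \<open>auto simp: rectpath_def Let_def path_image_join\<close>)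
  then have "contour_integral ?g f = 0"
    by (rule contour_integral_unique)
  also have "contour_integral ?g f = contour_integral (linepath (Complex a \<eta>) (Complex b \<eta>)) f
     + (contour_integral (linepath (Complex b \<eta>) (Complex b Y)) f
     + (contour_integral (linepath (Complex b Y) (Complex a Y)) f
     + contour_integral (linepath (Complex a Y) (Complex a \<eta>)) f))"
    unfolding rectpath_def Let_def using assms
    by (simp add: contour_integral_join ci contour_integrable_joinI)
  also have "contour_integral (linepath (Complex b Y) (Complex a Y)) f = - contour_integral (linepath (Complex a Y) (Complex b Y)) f"
    using assms by (intro contour_integral_reverse_linepath c) auto
  also have "contour_integral (linepath (Complex a Y) (Complex a \<eta>)) f = - contour_integral (linepath (Complex a \<eta>) (Complex a Y)) f"
    using assms by (intro contour_integral_reverse_linepath c) auto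
  finally show ?thesis
    using assms
    by (simp add: contour_integral_linepath_same_Im contour_integral_linepath_same_Re[where a=\<eta> and b=Y and c=a]
       contour_integral_linepath_same_Re[where a=\<eta> and b=Y and c=b] algebra_simps)
qed

text \<open>On the ray z = A + i y the product (A - z) (A + z) equals -i y (2 A + i y). With b = 2 A
  this is its power of exponent mu times the decaying part of exp (2 pi i z), after the constant
  phase coming from -i and the factor exp (2 pi i A) have been split off.\<close>

definition K_integrand :: "real \<Rightarrow> real \<Rightarrow> real \<Rightarrow> complex" where
  "K_integrand \<mu> b y = (if y > 0 then of_real (y powr \<mu> * exp (- 2 * pi * y)) * Complex b y powr of_real \<mu> else 0)"

text \<open>A majorant valid for all x in [b, b + y] at once. Half of the decay exp (-2 pi y) is
  kept for integrability, the other half absorbs the growth of x powr mu when mu >= 0. The sum of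
  two powers covers both signs of mu.\<close>

definition K_dom :: "real \<Rightarrow> real \<Rightarrow> real \<Rightarrow> real" where
  "K_dom \<mu> b y = (if y > 0 then ((b + \<bar>\<mu>\<bar> / pi) powr \<mu> + b powr \<mu>) * (y powr \<mu> * exp (- pi * y)) else 0)"

lemma integrable_K_dom:
  assumes "\<mu> > -1"
  shows "integrable lborel (K_dom \<mu> b)"
proof -
  have "(\<lambda>t. complex_of_real t powr (of_real (\<mu> + 1) - 1) / of_real (exp (pi * t))) absolutely_integrable_on {0<..}"
    using assms by (intro absolutely_integrable_Gamma_integral) auto
  then have "integrable lebesgue (\<lambda>t. indicator {0<..} t *\<^sub>R (complex_of_real t powr (of_real (\<mu> + 1) - 1) / of_real (exp (pi * t))))"
    by (simp add: set_integrable_def)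
  then have "integrable lebesgue (\<lambda>t. norm (indicator {0<..} t *\<^sub>R (complex_of_real t powr (of_real (\<mu> + 1) - 1) / of_real (exp (pi * t)))))"
    by (rule integrable_norm)
  also have "(\<lambda>t. norm (indicator {0<..} t *\<^sub>R (complex_of_real t powr (of_real (\<mu> + 1) - 1) / of_real (exp (pi * t)))))
    = (\<lambda>y. if y > 0 then y powr \<mu> * exp (- pi * y) else 0)"
    by (auto simp: fun_eq_iff norm_divide norm_powr_real_powr exp_minus field_simps)
  finally have "integrable lborel (\<lambda>y. if y > 0 then y powr \<mu> * exp (- pi * y) else 0)"
    by (subst (asm) integrable_completion) auto
  then have "integrable lborel (\<lambda>y. ((b + \<bar>\<mu>\<bar> / pi) powr \<mu> + b powr \<mu>) * (if y > 0 then y powr \<mu> * exp (- pi * y) else 0))"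
    by (rule integrable_mult_right)
  also have "(\<lambda>y. ((b + \<bar>\<mu>\<bar> / pi) powr \<mu> + b powr \<mu>) * (if y > 0 then y powr \<mu> * exp (- pi * y) else 0)) = K_dom \<mu> b"
    by (auto simp: K_dom_def fun_eq_iff)
  finally show ?thesis .
qed

lemma K_dom_nonneg [simp]: "K_dom \<mu> b y \<ge> 0"
  by (simp add: K_dom_def)

lemma K_dom_bound:
  assumes "b > 0" "y > 0" "b \<le> x" "x \<le> b + y"
  shows "y powr \<mu> * exp (- 2 * pi * y) * x powr \<mu> \<le> K_dom \<mu> b y"
proof -
  have "x powr \<mu> * exp (- pi * y) \<le> (b + \<bar>\<mu>\<bar> / pi) powr \<mu> + b powr \<mu>"
  proof (cases "\<mu> \<ge> 0")
    case True
    \<comment> \<open>After 1 + y / A <= exp (y / A), the inequality A >= mu / pi is what makes the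
      exponent mu * y / A at most pi * y.\<close>
    define A where "A = b + \<bar>\<mu>\<bar> / pi"
    have A: "A > 0" "A \<ge> b" unfolding A_def using assms pi_gt_zero by (auto intro: add_pos_nonneg)
    have "b + y \<le> A * (1 + y / A)" using A by (simp add: field_simps)
    also have "\<dots> \<le> A * exp (y / A)" using A exp_ge_add_one_self[of "y/A"] by (intro mult_left_mono) auto
    finally have "x powr \<mu> \<le> (A * exp (y / A)) powr \<mu>"
      using assms True A by (intro powr_mono2) auto
    also have "\<dots> = A powr \<mu> * exp (\<mu> * (y / A))"
      using A by (simp add: powr_mult exp_powr_real mult.commute)
    also have "\<mu> * (y / A) \<le> pi * y"
    proof -
      have "\<mu> / pi \<le> A" unfolding A_def using assms True by auto
      then have "\<mu> \<le> pi * A" using pi_gt_zero by (simp add: field_simps)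
      then have "\<mu> * y \<le> pi * A * y" using assms by (intro mult_right_mono) auto
      then show ?thesis using A by (simp add: field_simps)
    qed
    finally have "x powr \<mu> \<le> A powr \<mu> * exp (pi * y)" using A by simp
    then have "x powr \<mu> * exp (- pi * y) \<le> A powr \<mu>"
      by (simp add: exp_minus field_simps)
    then show ?thesis unfolding A_def by (smt (verit) powr_ge_zero)
  next
    case False
    then have "x powr \<mu> \<le> b powr \<mu>" using assms by (intro powr_mono2') auto
    moreover have "exp (- pi * y) \<le> 1" using assms by simp
    ultimately have "x powr \<mu> * exp (- pi * y) \<le> b powr \<mu> * 1" by (intro mult_mono) auto
    then show ?thesis by (smt (verit) powr_ge_zero)
  qed
  then have "(x powr \<mu> * exp (- pi * y)) * (y powr \<mu> * exp (- pi * y)) \<le> K_dom \<mu> b y"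
    unfolding K_dom_def using assms by (auto intro!: mult_right_mono)
  moreover have "exp (- 2 * pi * y) = exp (- pi * y) * exp (- pi * y)"
    by (simp flip: exp_add)
  ultimately show ?thesis by (simp add: mult_ac)
qed

lemma norm_Complex_bounds:
  assumes "b \<ge> 0" "y \<ge> 0"
  shows "b \<le> norm (Complex b y)" "norm (Complex b y) \<le> b + y"
  using abs_Re_le_cmod[of "Complex b y"] cmod_le[of "Complex b y"] assms by auto

lemma norm_powr_of_real: "z \<noteq> 0 \<Longrightarrow> norm (z powr complex_of_real \<mu>) = norm z powr \<mu>"
  by (simp add: powr_def)

lemma K_integrand_bound:
  assumes "b > 0"
  shows "norm (K_integrand \<mu> b y) \<le> K_dom \<mu> b y"
proof (cases "y > 0")
  case True
  have "norm (K_integrand \<mu> b y) = y powr \<mu> * exp (- 2 * pi * y) * norm (Complex b y) powr \<mu>"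
    using True assms by (simp add: K_integrand_def norm_mult norm_powr_of_real complex_eq_iff)
  also have "\<dots> \<le> K_dom \<mu> b y"
    using True assms norm_Complex_bounds[of b y] by (intro K_dom_bound) auto
  finally show ?thesis .
qed (simp add: K_integrand_def K_dom_def)

lemma borel_measurable_K [measurable]: "K_integrand \<mu> b \<in> borel_measurable borel"
proof -
  have "(\<lambda>y. if y \<in> {0<..} then complex_of_real (y powr \<mu> * exp (- 2 * pi * y)) * Complex b y powr of_real \<mu> else 0)
     \<in> borel_measurable borel"
    by (intro borel_measurable_continuous_on_if continuous_intros) (auto simp: complex_nonpos_Reals_iff complex_eq_iff Complex_eq intro!: continuous_intros)
  also have "(\<lambda>y. if y \<in> {0<..} then complex_of_real (y powr \<mu> * exp (- 2 * pi * y)) * Complex b y powr of_real \<mu> else 0) = K_integrand \<mu> b"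
    by (auto simp: K_integrand_def fun_eq_iff)
  finally show ?thesis .
qed

definition K_integral :: "real \<Rightarrow> real \<Rightarrow> complex" where
  "K_integral \<mu> b = (LINT y|lborel. K_integrand \<mu> b y)"

lemma integral_eq_LINT:
  fixes g :: "real \<Rightarrow> complex"
  assumes "continuous_on {u..v} g"
  shows "integral {u..v} g = (LINT x|lborel. indicator {u..v} x *\<^sub>R g x)"
proof -
  have "set_integrable lborel {u..v} g"
    using assms by (rule borel_integrable_atLeastAtMost')
  from set_borel_integral_eq_integral(2)[OF this] show ?thesis
    by (simp add: set_lebesgue_integral_def)
qed

text \<open>The segment from \<open>-A\<close> to \<open>A\<close> is moved up to \<open>\<i>\<infinity>\<close>, leaving two vertical half-lines; by symmetry
  they contribute complex conjugate values.\<close>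

lemma W_contour:
  assumes "\<mu> > -1" "A > 0"
  shows "W \<mu> A 1 = 2 * Im (cis (2 * pi * A - pi * \<mu> / 2) * K_integral \<mu> (2 * A))"
proof -
  \<comment> \<open>In the upper half-plane Im (A - z) < 0 < Im (A + z), so both logarithms are
    holomorphic. Keeping them separate lets each be evaluated on the vertical sides and
    conjugated.\<close>
  define f where "f z = exp (of_real \<mu> * (Ln (of_real A - z) + Ln (of_real A + z)) + 2 * pi * \<i> * z)" for z :: complex
  define c where "c = cis (2 * pi * A - pi * \<mu> / 2)"
  define \<eta> where "\<eta> n = 1 / (real n + 2)" for n
  define Y where "Y n = real n + 2" for n
  have \<eta>: "0 < \<eta> n" "\<eta> n \<le> 1" "\<eta> n < Y n" "1 \<le> Y n" for n
    unfolding \<eta>_def Y_def by (auto simp: field_simps add_pos_nonneg)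
  have holf: "f holomorphic_on {z. Im z > 0}"
    unfolding f_def by (intro holomorphic_intros) (auto simp: complex_nonpos_Reals_iff)
  have contf: "continuous_on {z. Im z > 0} f"
    using holf by (rule holomorphic_on_imp_continuous_on)
  have nf: "norm (f z) = (norm (of_real A - z) * norm (of_real A + z)) powr \<mu> * exp (- 2 * pi * Im z)" if "Im z > 0" for z
  proof -
    have "of_real A - z \<noteq> 0" "of_real A + z \<noteq> 0" using that by (auto simp: complex_eq_iff)
    then show ?thesis
      unfolding f_def by (simp add: exp_add norm_mult powr_def ln_mult algebra_simps)
  qed
  have fA: "f (Complex A y) = c * K_integrand \<mu> (2 * A) y" if "y > 0" for y
  proof -
    have 1: "of_real A - Complex A y = of_real y * (- \<i>)" by (simp add: complex_eq_iff)
    have 2: "of_real A + Complex A y = Complex (2 * A) y" by (simp add: complex_eq_iff)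
    have 3: "Complex (2 * A) y \<noteq> 0" using assms by (simp add: complex_eq_iff)
    have "Ln (of_real y * (- \<i>)) = of_real (ln y) + Ln (- \<i>)"
      using that by (subst Ln_times_of_real) (auto simp: Ln_of_real)
    also have "\<dots> = of_real (ln y) - \<i> * pi / 2" by simp
    finally have L: "Ln (of_real y * (- \<i>)) = of_real (ln y) - \<i> * pi / 2" .
    have "f (Complex A y) = exp (of_real (\<mu> * ln y)) * exp (\<i> * of_real (2 * pi * A - pi * \<mu> / 2)) * exp (of_real \<mu> * Ln (Complex (2 * A) y)) * exp (of_real (- 2 * pi * y))"
      unfolding f_def 1 2 L exp_add[symmetric] by (rule arg_cong[where f=exp]) (simp add: complex_eq_iff algebra_simps)
    also have "\<dots> = c * K_integrand \<mu> (2 * A) y"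
      using that 3 by (simp add: c_def K_integrand_def cis_conv_exp powr_def mult_ac flip: exp_of_real)
    finally show ?thesis .
  qed
  \<comment> \<open>Reflection in the imaginary axis exchanges A - z and A + z up to
    conjugation.\<close>
  have fmA: "f (Complex (-A) y) = cnj (f (Complex A y))" if "y > 0" for y
  proof -
    have "of_real A - Complex (-A) y = cnj (of_real A + Complex A y)" "of_real A + Complex (-A) y = cnj (of_real A - Complex A y)"
      by (auto simp: complex_eq_iff)
    moreover have "of_real A + Complex A y \<notin> \<real>\<^sub>\<le>\<^sub>0" "of_real A - Complex A y \<notin> \<real>\<^sub>\<le>\<^sub>0"
      using that by (auto simp: complex_nonpos_Reals_iff)
    ultimately show ?thesis
      unfolding f_def by (simp add: exp_cnj cnj_Ln) (rule arg_cong[where f=exp], simp add: complex_eq_iff)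
  qed
  have ch: "continuous_on {u..v} (\<lambda>x. f (Complex x y))" if "y > 0" for u v y
    by (rule continuous_on_compose2[OF contf]) (use that in \<open>auto simp: Complex_eq intro!: continuous_intros\<close>)
  have cv: "continuous_on {u..v} (\<lambda>y. f (Complex x y))" if "u > 0" for u v x
    by (rule continuous_on_compose2[OF contf]) (use that in \<open>auto simp: Complex_eq intro!: continuous_intros\<close>)
  define H where "H y = (LINT x|lborel. indicator {-A..A} x *\<^sub>R f (Complex x y))" for y
  define V where "V n = (LINT y|lborel. indicator {\<eta> n..Y n} y *\<^sub>R K_integrand \<mu> (2 * A) y)" for n
  have vA: "integral {\<eta> n..Y n} (\<lambda>y. f (Complex A y)) = c * V n" for n
  proof -
    have "integral {\<eta> n..Y n} (\<lambda>y. f (Complex A y)) = (LINT y|lborel. c * (indicator {\<eta> n..Y n} y *\<^sub>R K_integrand \<mu> (2 * A) y))"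
      using \<eta>(1)[of n] by (subst integral_eq_LINT) (auto intro!: cv Bochner_Integration.integral_cong simp: fA indicator_def)
    also have "\<dots> = c * V n" unfolding V_def by (rule integral_mult_right_zero)
    finally show ?thesis .
  qed
  have vmA: "integral {\<eta> n..Y n} (\<lambda>y. f (Complex (-A) y)) = cnj (c * V n)" for n
  proof -
    have "integral {\<eta> n..Y n} (\<lambda>y. f (Complex (-A) y)) = integral {\<eta> n..Y n} (\<lambda>y. cnj (f (Complex A y)))"
      using \<eta>(1)[of n] by (intro Henstock_Kurzweil_Integration.integral_cong) (auto simp: fmA)
    also have "\<dots> = cnj (c * V n)" by (simp add: integral_cnj[symmetric] vA)
    finally show ?thesis .
  qed
  have eq: "H (\<eta> n) + \<i> * (c * V n) = H (Y n) + \<i> * cnj (c * V n)" for n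
    using rectangle_integral[OF holf, of "-A" A "\<eta> n" "Y n"] \<eta>[of n] assms
    by (simp add: H_def integral_eq_LINT[OF ch] vA vmA)
  have lim_\<eta>: "\<eta> \<longlonglongrightarrow> 0" unfolding \<eta>_def by real_asymp
  have intK: "integrable lborel (K_dom \<mu> (2 * A))" by (rule integrable_K_dom) fact
  have limV: "V \<longlonglongrightarrow> K_integral \<mu> (2 * A)"
    unfolding V_def K_integral_def
  proof (rule integral_dominated_convergence[OF _ _ intK])
    show "AE x in lborel. norm (indicator {\<eta> n..Y n} x *\<^sub>R K_integrand \<mu> (2 * A) x) \<le> K_dom \<mu> (2 * A) x" for n
      using K_integrand_bound[of "2 * A" \<mu>] assms by (auto simp: indicator_def intro!: AE_I2)
    show "AE x in lborel. (\<lambda>i. indicator {\<eta> i..Y i} x *\<^sub>R K_integrand \<mu> (2 * A) x) \<longlonglongrightarrow> K_integrand \<mu> (2 * A) x"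
    proof (rule AE_I2)
      fix x
      show "(\<lambda>i. indicator {\<eta> i..Y i} x *\<^sub>R K_integrand \<mu> (2 * A) x) \<longlonglongrightarrow> K_integrand \<mu> (2 * A) x"
      proof (cases "x > 0")
        case True
        have "eventually (\<lambda>n. \<eta> n < x) sequentially" using lim_\<eta> True by (rule order_tendstoD)
        moreover have "eventually (\<lambda>n. Y n > x) sequentially" unfolding Y_def by real_asymp
        ultimately have "eventually (\<lambda>i. indicator {\<eta> i..Y i} x *\<^sub>R K_integrand \<mu> (2 * A) x = K_integrand \<mu> (2 * A) x) sequentially"
          by eventually_elim auto
        then show ?thesis by (rule tendsto_eventually)
      qed (simp add: K_integrand_def)
    qed
  qed (use assms in measurable)
  \<comment> \<open>The top side has fixed length 2 A, and on it a power of Y is beaten by exp (-2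
    pi Y).\<close>
  have limT: "(\<lambda>n. H (Y n)) \<longlonglongrightarrow> 0"
  proof (rule tendsto_norm_zero_cancel, rule tendsto_sandwich[OF _ _ tendsto_const])
    show "\<forall>\<^sub>F n in sequentially. norm (H (Y n)) \<le> 2 * A * (((2 * A + Y n)^2) powr \<bar>\<mu>\<bar> * exp (- 2 * pi * Y n))"
    proof (rule always_eventually, rule allI)
      fix n
      let ?B = "((2 * A + Y n)^2) powr \<bar>\<mu>\<bar> * exp (- 2 * pi * Y n)"
      have B: "norm (f (Complex x (Y n))) \<le> ?B" if x: "x \<in> {-A..A}" for x
      proof -
        have l: "1 \<le> norm (of_real A - Complex x (Y n))" "1 \<le> norm (of_real A + Complex x (Y n))"
          using abs_Im_le_cmod[of "of_real A - Complex x (Y n)"] abs_Im_le_cmod[of "of_real A + Complex x (Y n)"] \<eta>(4)[of n] by auto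
        have u: "norm (of_real A - Complex x (Y n)) \<le> 2 * A + Y n" "norm (of_real A + Complex x (Y n)) \<le> 2 * A + Y n"
          using cmod_le[of "of_real A - Complex x (Y n)"] cmod_le[of "of_real A + Complex x (Y n)"] \<eta>(4)[of n] x by auto
        let ?p = "norm (of_real A - Complex x (Y n)) * norm (of_real A + Complex x (Y n))"
        have "1 * 1 \<le> ?p" using l by (intro mult_mono) auto
        have "?p \<le> (2 * A + Y n)\<^sup>2" unfolding power2_eq_square using u l by (intro mult_mono) auto
        have "?p powr \<mu> \<le> ?p powr \<bar>\<mu>\<bar>" using \<open>1 * 1 \<le> ?p\<close> by (intro powr_mono) auto
        also have "\<dots> \<le> ((2 * A + Y n)^2) powr \<bar>\<mu>\<bar>" using \<open>1 * 1 \<le> ?p\<close> \<open>?p \<le> _\<close> by (intro powr_mono2) auto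
        finally show ?thesis using nf[of "Complex x (Y n)"] \<eta>(4)[of n] by (simp add: mult_right_mono)
      qed
      have "H (Y n) = integral {-A..A} (\<lambda>x. f (Complex x (Y n)))"
        unfolding H_def using \<eta>(4)[of n] by (subst integral_eq_LINT[OF ch]) auto
      also have "norm \<dots> \<le> ?B * (A - (-A))"
        using assms \<eta>(4)[of n] by (intro integral_bound ch B) auto
      finally show "norm (H (Y n)) \<le> 2 * A * ?B" by (simp add: mult_ac)
    qed
    show "(\<lambda>n. 2 * A * (((2 * A + Y n)^2) powr \<bar>\<mu>\<bar> * exp (- 2 * pi * Y n))) \<longlonglongrightarrow> 0"
    proof -
      have "(\<lambda>n. ((2 * A + (real n + 2))^2) powr \<bar>\<mu>\<bar> * exp (- 2 * pi * (real n + 2))) \<longlonglongrightarrow> 0"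
        using pi_gt_zero by real_asymp
      from tendsto_mult_left[OF this, of "2 * A"] show ?thesis by (simp add: Y_def)
    qed
  qed auto
  \<comment> \<open>Moving up from the real axis only increases the moduli of A - z and A + z. So
    for mu < 0 the limit function \<open>powp\<close> is itself a majorant, and for mu >= 0 the
    integrand is bounded. The points -A and A are discarded as a null set.\<close>
  have limH: "(\<lambda>n. H (\<eta> n)) \<longlonglongrightarrow> (LINT t|lborel. complex_of_real (powp \<mu> (A\<^sup>2 - t\<^sup>2)) * cis (2 * pi * 1 * t))"
    unfolding H_def
  proof (rule integral_dominated_convergence[where w="\<lambda>x. powp \<mu> (A\<^sup>2 - x\<^sup>2) + indicator {-A..A} x * ((2 * A + 1)^2) powr \<bar>\<mu>\<bar>"])
    show "integrable lborel (\<lambda>x. powp \<mu> (A\<^sup>2 - x\<^sup>2) + indicator {-A..A} x * ((2 * A + 1)^2) powr \<bar>\<mu>\<bar>)"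
      using integrable_powp[OF assms(1)] by (intro Bochner_Integration.integrable_add integrable_mult_left) (auto intro!: integrable_real_indicator simp: emeasure_lborel_Icc_eq)
    have out: "AE x in lborel. x \<noteq> A \<and> x \<noteq> -A"
      using AE_lborel_singleton[of A] AE_lborel_singleton[of "-A"] by auto
    have cases: "x \<in> {-A<..<A} \<or> x \<notin> {-A..A}" if "x \<noteq> A \<and> x \<noteq> -A" for x using that by auto
    have pos: "A\<^sup>2 - x\<^sup>2 = (A - x) * (A + x)" for x by (simp add: power2_eq_square algebra_simps)
    have posx: "A\<^sup>2 - x\<^sup>2 > 0" if "x \<in> {-A<..<A}" for x using that unfolding pos by (auto intro: mult_pos_pos)
    have negx: "powp \<mu> (A\<^sup>2 - x\<^sup>2) = 0" if "x \<notin> {-A..A}" for x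
    proof -
      have "\<not> A\<^sup>2 - x\<^sup>2 > 0" using that assms unfolding pos by (auto simp: zero_less_mult_iff)
      then show ?thesis by (simp add: powp_def)
    qed
    show "AE x in lborel. norm (indicator {-A..A} x *\<^sub>R f (Complex x (\<eta> n))) \<le> powp \<mu> (A\<^sup>2 - x\<^sup>2) + indicator {-A..A} x * ((2 * A + 1)^2) powr \<bar>\<mu>\<bar>" for n
      using out
    proof eventually_elim
      fix x assume x: "x \<noteq> A \<and> x \<noteq> -A"
      show "norm (indicator {-A..A} x *\<^sub>R f (Complex x (\<eta> n))) \<le> powp \<mu> (A\<^sup>2 - x\<^sup>2) + indicator {-A..A} x * ((2 * A + 1)^2) powr \<bar>\<mu>\<bar>"
      proof (cases "x \<in> {-A<..<A}")
        case True
        have l: "A - x \<le> norm (of_real A - Complex x (\<eta> n))" "A + x \<le> norm (of_real A + Complex x (\<eta> n))"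
          using abs_Re_le_cmod[of "of_real A - Complex x (\<eta> n)"] abs_Re_le_cmod[of "of_real A + Complex x (\<eta> n)"] by auto
        have u: "norm (of_real A - Complex x (\<eta> n)) \<le> 2 * A + 1" "norm (of_real A + Complex x (\<eta> n)) \<le> 2 * A + 1"
          using cmod_le[of "of_real A - Complex x (\<eta> n)"] cmod_le[of "of_real A + Complex x (\<eta> n)"] \<eta>[of n] True by auto
        let ?p = "norm (of_real A - Complex x (\<eta> n)) * norm (of_real A + Complex x (\<eta> n))"
        have p1: "(A - x) * (A + x) \<le> ?p" using l True by (intro mult_mono) auto
        have p2: "?p \<le> (2 * A + 1)\<^sup>2" unfolding power2_eq_square using u assms by (intro mult_mono) auto
        have p0: "(A - x) * (A + x) > 0" using posx[OF True] pos by simp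
        have "?p powr \<mu> \<le> powp \<mu> (A\<^sup>2 - x\<^sup>2) + ((2 * A + 1)^2) powr \<bar>\<mu>\<bar>"
        proof (cases "\<mu> \<ge> 0")
          case True
          then have "?p powr \<mu> \<le> ((2 * A + 1)^2) powr \<mu>" using p1 p2 p0 by (intro powr_mono2) auto
          then show ?thesis using True by (simp add: add_increasing)
        next
          case False
          then have "?p powr \<mu> \<le> ((A - x) * (A + x)) powr \<mu>" using p1 p2 p0 by (intro powr_mono2') auto
          also have "\<dots> = powp \<mu> (A\<^sup>2 - x\<^sup>2)" using p0 by (simp add: powp_def pos)
          finally show ?thesis by (simp add: add_increasing2)
        qed
        moreover have "norm (f (Complex x (\<eta> n))) \<le> ?p powr \<mu>"
          using nf[of "Complex x (\<eta> n)"] \<eta>(1)[of n] by (simp add: mult_left_le)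
        ultimately show ?thesis using True by (auto simp: indicator_def)
      next
        case False
        then show ?thesis using cases[OF x] by (auto simp: indicator_def)
      qed
    qed
    show "AE x in lborel. (\<lambda>i. indicator {-A..A} x *\<^sub>R f (Complex x (\<eta> i))) \<longlonglongrightarrow> complex_of_real (powp \<mu> (A\<^sup>2 - x\<^sup>2)) * cis (2 * pi * 1 * x)"
      using out
    proof eventually_elim
      fix x assume x: "x \<noteq> A \<and> x \<noteq> -A"
      show "(\<lambda>i. indicator {-A..A} x *\<^sub>R f (Complex x (\<eta> i))) \<longlonglongrightarrow> complex_of_real (powp \<mu> (A\<^sup>2 - x\<^sup>2)) * cis (2 * pi * 1 * x)"
      proof (cases "x \<in> {-A<..<A}")
        case True
        have nr: "of_real A - complex_of_real x \<notin> \<real>\<^sub>\<le>\<^sub>0" "of_real A + complex_of_real x \<notin> \<real>\<^sub>\<le>\<^sub>0"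
          using True by (auto simp: complex_nonpos_Reals_iff)
        have "isCont f (of_real x)"
          unfolding f_def using nr by (intro continuous_intros) auto
        moreover have "(\<lambda>i. Complex x (\<eta> i)) \<longlonglongrightarrow> of_real x"
          unfolding Complex_eq using lim_\<eta> by (auto intro!: tendsto_eq_intros)
        ultimately have "(\<lambda>i. f (Complex x (\<eta> i))) \<longlonglongrightarrow> f (of_real x)"
          by (rule isCont_tendsto_compose)
        moreover have "f (of_real x) = complex_of_real (powp \<mu> (A\<^sup>2 - x\<^sup>2)) * cis (2 * pi * 1 * x)"
        proof -
          have "Ln (of_real A - of_real x) = complex_of_real (ln (A - x))" "Ln (of_real A + of_real x) = complex_of_real (ln (A + x))"
            using True by (auto simp: Ln_of_real simp flip: of_real_diff of_real_add)
          then have "f (of_real x) = exp (of_real (\<mu> * (ln (A - x) + ln (A + x)))) * cis (2 * pi * x)"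
            unfolding f_def by (simp add: exp_add cis_conv_exp mult_ac)
          also have "\<mu> * (ln (A - x) + ln (A + x)) = \<mu> * ln (A\<^sup>2 - x\<^sup>2)"
            using True by (simp add: pos ln_mult)
          finally show ?thesis using posx[OF True] by (simp add: powp_def powr_def flip: exp_of_real)
        qed
        ultimately show ?thesis using True by (simp add: indicator_def)
      next
        case False
        then show ?thesis using cases[OF x] negx[of x] by (auto simp: indicator_def)
      qed
    qed
    show "(\<lambda>x. indicator {-A..A} x *\<^sub>R f (Complex x (\<eta> n))) \<in> borel_measurable lborel" for n
    proof -
      have "continuous_on UNIV (\<lambda>x. f (Complex x (\<eta> n)))"
        by (rule continuous_on_compose2[OF contf]) (use \<eta>(1)[of n] in \<open>auto simp: Complex_eq intro!: continuous_intros\<close>)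
      then have [measurable]: "(\<lambda>x. f (Complex x (\<eta> n))) \<in> borel_measurable borel" by (rule borel_measurable_continuous_onI)
      show ?thesis by measurable
    qed
    show "(\<lambda>t. complex_of_real (powp \<mu> (A\<^sup>2 - t\<^sup>2)) * cis (2 * pi * 1 * t)) \<in> borel_measurable lborel"
      unfolding cis_conv_exp by measurable
  qed
  have "(\<lambda>n. H (\<eta> n) + \<i> * (c * V n)) \<longlonglongrightarrow> of_real (W \<mu> A 1) + \<i> * (c * K_integral \<mu> (2 * A))"
    using limH unfolding W_cis[OF assms(1)] by (intro tendsto_intros limV)
  moreover have "(\<lambda>n. H (Y n) + \<i> * cnj (c * V n)) \<longlonglongrightarrow> 0 + \<i> * cnj (c * K_integral \<mu> (2 * A))"
    by (intro tendsto_intros limV limT)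
  ultimately have "of_real (W \<mu> A 1) + \<i> * (c * K_integral \<mu> (2 * A)) = 0 + \<i> * cnj (c * K_integral \<mu> (2 * A))"
    unfolding eq by (rule LIMSEQ_unique)
  \<comment> \<open>With w = \<open>c * K_integral \<mu> (2 * A)\<close> the real parts read W - Im
    w = Im w.\<close>
  then have "Re (of_real (W \<mu> A 1) + \<i> * (c * K_integral \<mu> (2 * A))) = Re (0 + \<i> * cnj (c * K_integral \<mu> (2 * A)))" by (rule arg_cong)
  then show ?thesis by (simp add: c_def)
qed

section \<open>Derivatives in the frequency variable\<close>

lemma has_vector_derivative_iff_tendsto:
  "(f has_vector_derivative D) (at r) \<longleftrightarrow> ((\<lambda>y. (1 / (y - r)) *\<^sub>R (f y - f r)) \<longlongrightarrow> D) (at r)"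
proof -
  have "((\<lambda>y. (1 / (y - r)) *\<^sub>R (f y - f r)) \<longlongrightarrow> D) (at r) \<longleftrightarrow> ((\<lambda>y. norm ((1 / (y - r)) *\<^sub>R (f y - f r) - D)) \<longlongrightarrow> 0) (at r)"
    by (subst LIM_zero_iff[symmetric]) (simp add: tendsto_norm_zero_iff)
  also have "\<dots> \<longleftrightarrow> ((\<lambda>y. norm (f y - f r - (y - r) *\<^sub>R D) / norm (y - r)) \<longlongrightarrow> 0) (at r)"
  proof (rule Lim_cong_within[OF refl refl refl])
    fix y :: real assume "y \<noteq> r"
    then have "(1 / (y - r)) *\<^sub>R (f y - f r) - D = (1 / (y - r)) *\<^sub>R (f y - f r - (y - r) *\<^sub>R D)"
      by (simp add: scaleR_diff_right)
    then show "norm ((1 / (y - r)) *\<^sub>R (f y - f r) - D) = norm (f y - f r - (y - r) *\<^sub>R D) / norm (y - r)"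
      by (simp add: divide_inverse mult.commute)
  qed
  finally show ?thesis
    unfolding has_vector_derivative_def has_derivative_iff_norm by (simp add: bounded_linear_scaleR_left)
qed

text \<open>The mean value inequality bounds all difference quotients by \<open>g\<close>, so
  dominated convergence applies along every sequence tending to r.\<close>

lemma has_vector_derivative_LINT:
  fixes f :: "real \<Rightarrow> 'a \<Rightarrow> 'b :: {banach, second_countable_topology}"
  assumes f: "\<And>r. integrable M (f r)"
    and f': "\<And>r x. x \<in> space M \<Longrightarrow> ((\<lambda>r. f r x) has_vector_derivative f' r x) (at r)"
    and bound: "\<And>r x. x \<in> space M \<Longrightarrow> norm (f' r x) \<le> g x"
    and g: "integrable M g"
    and meas: "f' r \<in> borel_measurable M"
  shows "((\<lambda>r. LINT x|M. f r x) has_vector_derivative (LINT x|M. f' r x)) (at r)"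
proof -
  have "((\<lambda>y. (1 / (y - r)) *\<^sub>R ((LINT x|M. f y x) - (LINT x|M. f r x))) \<longlongrightarrow> (LINT x|M. f' r x)) (at r)"
    unfolding tendsto_at_iff_sequentially comp_def
  proof (intro allI impI)
    fix X :: "nat \<Rightarrow> real" assume X: "\<forall>i. X i \<in> UNIV - {r}" "X \<longlonglongrightarrow> r"
    have "(\<lambda>i. LINT x|M. (1 / (X i - r)) *\<^sub>R (f (X i) x - f r x)) \<longlonglongrightarrow> (LINT x|M. f' r x)"
    proof (rule integral_dominated_convergence[OF meas _ g])
      show "(\<lambda>x. (1 / (X i - r)) *\<^sub>R (f (X i) x - f r x)) \<in> borel_measurable M" for i
        using f by (intro borel_measurable_scaleR borel_measurable_const borel_measurable_diff) auto
      show "AE x in M. (\<lambda>i. (1 / (X i - r)) *\<^sub>R (f (X i) x - f r x)) \<longlonglongrightarrow> f' r x"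
      proof (rule AE_I2)
        fix x assume "x \<in> space M"
        then have "((\<lambda>y. (1 / (y - r)) *\<^sub>R (f y x - f r x)) \<longlongrightarrow> f' r x) (at r)"
          using f'[of x r] by (simp add: has_vector_derivative_iff_tendsto)
            
        then show "(\<lambda>i. (1 / (X i - r)) *\<^sub>R (f (X i) x - f r x)) \<longlonglongrightarrow> f' r x"
          using X unfolding tendsto_at_iff_sequentially comp_def by blast
      qed
      show "AE x in M. norm ((1 / (X i - r)) *\<^sub>R (f (X i) x - f r x)) \<le> g x" for i
      proof (rule AE_I2)
        fix x assume x: "x \<in> space M"
        have "norm (f (X i) x - f r x) \<le> g x * norm (X i - r)"
        proof (rule differentiable_bound[of UNIV "\<lambda>y. f y x" "\<lambda>y h. h *\<^sub>R f' y x"])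
          show "((\<lambda>y. f y x) has_derivative (\<lambda>h. h *\<^sub>R f' y x)) (at y within UNIV)" for y
            using f'[OF x] by (simp add: has_vector_derivative_def)
          show "onorm (\<lambda>h. h *\<^sub>R f' y x) \<le> g x" for y
            using bound[OF x, of y] by (intro onorm_bound) (auto simp: mult.commute intro!: mult_left_mono intro: order_trans[OF norm_ge_zero])
        qed auto
        then show "norm ((1 / (X i - r)) *\<^sub>R (f (X i) x - f r x)) \<le> g x"
          using X(1) by (simp add: divide_simps)
      qed
    qed
    also have "(\<lambda>i. LINT x|M. (1 / (X i - r)) *\<^sub>R (f (X i) x - f r x)) = (\<lambda>i. (1 / (X i - r)) *\<^sub>R ((LINT x|M. f (X i) x) - (LINT x|M. f r x)))"
      using f by (simp add: Bochner_Integration.integral_diff)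
    finally show "(\<lambda>i. (1 / (X i - r)) *\<^sub>R ((LINT x|M. f (X i) x) - (LINT x|M. f r x))) \<longlonglongrightarrow> (LINT x|M. f' r x)" .
  qed
  then show ?thesis
    by (simp add: has_vector_derivative_iff_tendsto)
qed


text \<open>Integration by parts: the derivative of (a^2 - t^2) powr (mu + 1) * sin (2 pi r t)
  integrates to 0 over [-a, a], because mu + 1 > 0 makes the boundary values vanish.\<close>

lemma W_deriv_aux:
  assumes "\<mu> > -1" "a > 0"
  shows "(LINT t|lborel. powp \<mu> (a\<^sup>2 - t\<^sup>2) * (- (2 * pi * t) * sin (2 * pi * r * t))) = - (2 * pi\<^sup>2 * r / (\<mu> + 1)) * W (\<mu> + 1) a r"
proof -
  define f where "f t = powp (\<mu> + 1) (a\<^sup>2 - t\<^sup>2) * (2 * pi * r * cos (2 * pi * r * t))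
       - 2 * (\<mu> + 1) * (powp \<mu> (a\<^sup>2 - t\<^sup>2) * (t * sin (2 * pi * r * t)))" for t
  have out: "powp \<nu> (a\<^sup>2 - t\<^sup>2) = 0" if "t \<notin> {-a..a}" for t \<nu>
    using that assms by (intro powp_eq_0_outside) auto
  have i1: "integrable lborel (\<lambda>t. powp (\<mu> + 1) (a\<^sup>2 - t\<^sup>2) * (2 * pi * r * cos (2 * pi * r * t)))"
    using integrable_powp_bounded[where \<mu>="\<mu> + 1" and h="\<lambda>t. 2 * pi * r * cos (2 * pi * r * t)" and B="2 * pi * \<bar>r\<bar>" and A="a\<^sup>2"] assms
    by (auto simp: abs_mult mult_left_le)
  have i2: "integrable lborel (\<lambda>t. powp \<mu> (a\<^sup>2 - t\<^sup>2) * (t * sin (2 * pi * r * t)))"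
  proof -
    \<comment> \<open>The indicator makes the factor t bounded and does not change the integrand,
      since \<open>powp\<close> vanishes outside the interval.\<close>
    have "norm (indicator {-a..a} t * (t * sin (2 * pi * r * t))) \<le> a" for t
    proof (cases "t \<in> {-a..a}")
      case True
      then have "\<bar>t\<bar> * \<bar>sin (2 * pi * r * t)\<bar> \<le> a * 1" by (intro mult_mono) auto
      then show ?thesis using True by (simp add: abs_mult)
    qed (use assms in auto)
    then have "integrable lborel (\<lambda>t. powp \<mu> (a\<^sup>2 - t\<^sup>2) * (indicator {-a..a} t * (t * sin (2 * pi * r * t))))"
      using integrable_powp_bounded[where \<mu>=\<mu> and h="\<lambda>t. indicator {-a..a} t * (t * sin (2 * pi * r * t))" and B="a" and A="a\<^sup>2"] assms
      by auto
    also have "(\<lambda>t. powp \<mu> (a\<^sup>2 - t\<^sup>2) * (indicator {-a..a} t * (t * sin (2 * pi * r * t)))) = (\<lambda>t. powp \<mu> (a\<^sup>2 - t\<^sup>2) * (t * sin (2 * pi * r * t)))"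
      using out[of _ \<mu>] by (auto simp: indicator_def fun_eq_iff)
    finally show ?thesis .
  qed
  define F where "F t = (a\<^sup>2 - t\<^sup>2) powr (\<mu> + 1) * sin (2 * pi * r * t)" for t
  have "(f has_integral F a - F (-a)) {-a..a}"
  proof (rule fundamental_theorem_of_calculus_interior)
    have nn: "0 \<le> a\<^sup>2 - x\<^sup>2" if "x \<in> {-a..a}" for x
    proof -
      have "\<bar>x\<bar> \<le> \<bar>a\<bar>" using that by auto
      then show ?thesis by (simp add: abs_le_square_iff)
    qed
    then show "continuous_on {-a..a} F" unfolding F_def
      by (intro continuous_on_mult continuous_on_powr' ballI conjI impI continuous_on_diff continuous_on_const continuous_on_power continuous_on_id continuous_on_sin)
         (use assms in auto)
    fix t assume t: "t \<in> {-a<..<a}"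
    have "(a - t) * (a + t) > 0" using t by (intro mult_pos_pos) auto
    then have p: "a\<^sup>2 - t\<^sup>2 > 0" by (simp add: power2_eq_square algebra_simps)
    have d0: "((\<lambda>t. a\<^sup>2 - t\<^sup>2) has_real_derivative (- 2 * t)) (at t)"
      by (auto intro!: derivative_eq_intros)
    have d1: "((\<lambda>t. (a\<^sup>2 - t\<^sup>2) powr (\<mu> + 1)) has_real_derivative (\<mu> + 1) * (a\<^sup>2 - t\<^sup>2) powr (\<mu> + 1 - of_nat 1) * (- 2 * t)) (at t)"
      using DERIV_fun_powr[OF d0 p] .
    have d2: "((\<lambda>t. sin (2 * pi * r * t)) has_real_derivative 2 * pi * r * cos (2 * pi * r * t)) (at t)"
      by (auto intro!: derivative_eq_intros)
    have "(F has_real_derivative f t) (at t)"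
      using DERIV_mult[OF d1 d2] p unfolding F_def f_def by (simp add: powp_def algebra_simps)
    then show "(F has_vector_derivative f t) (at t)"
      by (simp add: has_real_derivative_iff_has_vector_derivative)
  qed (use assms in auto)
  then have "(f has_integral 0) {-a..a}" using assms by (simp add: F_def)
  then have "(f has_integral 0) UNIV"
    by (rule has_integral_on_superset) (auto simp: f_def out)
  moreover have "(f has_integral (LINT t|lborel. f t)) UNIV"
    unfolding f_def using i1 i2 by (intro has_integral_integral_lborel Bochner_Integration.integrable_diff integrable_mult_right)
  ultimately have "(LINT t|lborel. f t) = 0" using has_integral_unique by blast
  moreover have "(LINT t|lborel. f t) = (LINT t|lborel. powp (\<mu> + 1) (a\<^sup>2 - t\<^sup>2) * (2 * pi * r * cos (2 * pi * r * t)))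
      - (LINT t|lborel. 2 * (\<mu> + 1) * (powp \<mu> (a\<^sup>2 - t\<^sup>2) * (t * sin (2 * pi * r * t))))"
    unfolding f_def by (rule Bochner_Integration.integral_diff[OF i1 integrable_mult_right[OF i2]])
  moreover have "(LINT t|lborel. powp (\<mu> + 1) (a\<^sup>2 - t\<^sup>2) * (2 * pi * r * cos (2 * pi * r * t)))
      = (LINT t|lborel. 2 * pi * r * (powp (\<mu> + 1) (a\<^sup>2 - t\<^sup>2) * cos (2 * pi * r * t)))"
    by (simp only: mult_ac)
  ultimately have "0 = 2 * pi * r * W (\<mu> + 1) a r - 2 * (\<mu> + 1) * (LINT t|lborel. powp \<mu> (a\<^sup>2 - t\<^sup>2) * (t * sin (2 * pi * r * t)))"
    unfolding W_def by (simp only: integral_mult_right_zero)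
  then have "(LINT t|lborel. powp \<mu> (a\<^sup>2 - t\<^sup>2) * (t * sin (2 * pi * r * t))) = pi * r / (\<mu> + 1) * W (\<mu> + 1) a r"
    using assms by (simp add: field_simps)
  moreover have "(LINT t|lborel. powp \<mu> (a\<^sup>2 - t\<^sup>2) * (- (2 * pi * t) * sin (2 * pi * r * t)))
      = (LINT t|lborel. (- 2 * pi) * (powp \<mu> (a\<^sup>2 - t\<^sup>2) * (t * sin (2 * pi * r * t))))"
    by (intro Bochner_Integration.integral_cong) auto
  ultimately show ?thesis by (simp add: power2_eq_square)
qed

text \<open>The Bessel recurrence for z powr -nu times the function of order nu: differentiation
  stays within the family and raises mu by 1. It holds at every real r, including 0.\<close>

lemma W_deriv:
  assumes "\<mu> > -1" "a > 0"
  shows "(W \<mu> a has_real_derivative - (2 * pi\<^sup>2 * r / (\<mu> + 1)) * W (\<mu> + 1) a r) (at r)"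
proof -
  have out: "powp \<mu> (a\<^sup>2 - t\<^sup>2) = 0" if "t \<notin> {-a..a}" for t
    using that assms by (intro powp_eq_0_outside) auto
  have "((\<lambda>r. LINT t|lborel. powp \<mu> (a\<^sup>2 - t\<^sup>2) * cos (2 * pi * r * t)) has_vector_derivative
        (LINT t|lborel. powp \<mu> (a\<^sup>2 - t\<^sup>2) * (- (2 * pi * t) * sin (2 * pi * r * t)))) (at r)"
  proof (rule has_vector_derivative_LINT[where g="\<lambda>t. powp \<mu> (a\<^sup>2 - t\<^sup>2) * (2 * pi * a)"])
    show "integrable lborel (\<lambda>t. powp \<mu> (a\<^sup>2 - t\<^sup>2) * cos (2 * pi * r * t))" for r
      using integrable_powp_bounded[OF assms(1), where h="\<lambda>t. cos (2 * pi * r * t)" and B=1 and A="a\<^sup>2"] by auto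
    show "integrable lborel (\<lambda>t. powp \<mu> (a\<^sup>2 - t\<^sup>2) * (2 * pi * a))"
      using integrable_powp[OF assms(1)] by simp
    show "((\<lambda>r. powp \<mu> (a\<^sup>2 - t\<^sup>2) * cos (2 * pi * r * t)) has_vector_derivative powp \<mu> (a\<^sup>2 - t\<^sup>2) * (- (2 * pi * t) * sin (2 * pi * r * t))) (at r)" for r t
      unfolding has_real_derivative_iff_has_vector_derivative[symmetric]
      by (auto intro!: derivative_eq_intros)
    show "norm (powp \<mu> (a\<^sup>2 - t\<^sup>2) * (- (2 * pi * t) * sin (2 * pi * r * t))) \<le> powp \<mu> (a\<^sup>2 - t\<^sup>2) * (2 * pi * a)" for r t
    proof (cases "t \<in> {-a..a}")
      case True
      then have "\<bar>t\<bar> * \<bar>sin (2 * pi * r * t)\<bar> \<le> a * 1" by (intro mult_mono) auto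
      then show ?thesis by (simp add: abs_mult mult_left_mono)
    qed (simp add: out)
  qed auto
  then show ?thesis
    unfolding W_deriv_aux[OF assms] W_def[symmetric] has_real_derivative_iff_has_vector_derivative by simp
qed

lemma continuous_on_W [continuous_intros]:
  assumes "\<mu> > -1" "a > 0" "continuous_on S f"
  shows "continuous_on S (\<lambda>x. W \<mu> a (f x))"
proof -
  have "continuous_on UNIV (W \<mu> a)"
    using W_deriv[OF assms(1,2)] by (intro continuous_at_imp_continuous_on ballI DERIV_isCont)
  then show ?thesis using assms(3) by (rule continuous_on_compose2) auto
qed

section \<open>Amplitude, phase and decay\<close>

definition W_amp :: "real \<Rightarrow> real \<Rightarrow> real \<Rightarrow> complex" where
  "W_amp \<mu> a r = 2 * cis (- (pi * \<mu> / 2)) * (LINT y|lborel. of_real (r powr (- \<mu>)) * K_integrand \<mu> (2 * a * r) y)"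

text \<open>Separates decay, oscillation and a convergent amplitude. The factor r powr -mu is kept
  inside the integral of \<open>W_amp\<close> so that one majorant serves all r >= 1.\<close>

lemma W_W_amp:
  assumes "\<mu> > -1" "a > 0" "r > 0"
  shows "W \<mu> a r = r powr (- \<mu> - 1) * Im (cis (2 * pi * a * r) * W_amp \<mu> a r)"
proof -
  have "W \<mu> a r = r powr (- 2 * \<mu> - 1) * (2 * Im (cis (2 * pi * (a * r) - pi * \<mu> / 2) * K_integral \<mu> (2 * (a * r))))"
    using assms by (subst W_scale) (auto simp: W_contour)
  also have "r powr (- 2 * \<mu> - 1) = r powr (- \<mu> - 1) * r powr (- \<mu>)"
    by (simp flip: powr_add)
  also have "\<dots> * (2 * Im (cis (2 * pi * (a * r) - pi * \<mu> / 2) * K_integral \<mu> (2 * (a * r))))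
     = r powr (- \<mu> - 1) * Im (of_real (r powr (- \<mu>)) * (2 * (cis (2 * pi * a * r) * cis (- (pi * \<mu> / 2))) * K_integral \<mu> (2 * a * r)))"
    by (simp add: cis_mult mult_ac)
  also have "of_real (r powr (- \<mu>)) * (2 * (cis (2 * pi * a * r) * cis (- (pi * \<mu> / 2))) * K_integral \<mu> (2 * a * r)) = cis (2 * pi * a * r) * W_amp \<mu> a r"
    unfolding W_amp_def K_integral_def by (simp add: mult_ac)
  finally show ?thesis .
qed

text \<open>Divided by r, the modulus of \<open>Complex (2 * a * r) y\<close> lies between 2 a and 2
  a + y as soon as r >= 1; hence a majorant free of r.\<close>

lemma scaled_K_bound:
  assumes "a > 0" "r \<ge> 1"
  shows "norm (of_real (r powr (- \<mu>)) * K_integrand \<mu> (2 * a * r) y) \<le> K_dom \<mu> (2 * a) y"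
proof (cases "y > 0")
  case True
  let ?x = "norm (Complex (2 * a * r) y) / r"
  have x: "2 * a \<le> ?x" "?x \<le> 2 * a + y"
  proof -
    show "2 * a \<le> ?x" using norm_Complex_bounds(1)[of "2 * a * r" y] assms True by (simp add: field_simps)
    have "?x \<le> (2 * a * r + y) / r" using norm_Complex_bounds(2)[of "2 * a * r" y] assms True by (intro divide_right_mono) auto
    also have "\<dots> = 2 * a + y / r" using assms by (simp add: field_simps)
    also have "y / r \<le> y" using assms True by (simp add: divide_le_eq mult_left_le)
    finally show "?x \<le> 2 * a + y" by simp
  qed
  have "norm (of_real (r powr (- \<mu>)) * K_integrand \<mu> (2 * a * r) y) = y powr \<mu> * exp (- 2 * pi * y) * (norm (Complex (2 * a * r) y) powr \<mu> * r powr (- \<mu>))"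
    using True assms by (simp add: K_integrand_def norm_mult norm_powr_of_real complex_eq_iff)
  also have "norm (Complex (2 * a * r) y) powr \<mu> * r powr (- \<mu>) = ?x powr \<mu>"
    using assms by (simp add: powr_divide powr_minus field_simps)
  also have "y powr \<mu> * exp (- 2 * pi * y) * ?x powr \<mu> \<le> K_dom \<mu> (2 * a) y"
    using True assms x by (intro K_dom_bound) auto
  finally show ?thesis .
qed (simp add: K_integrand_def K_dom_def)

lemma W_amp_bound:
  assumes "\<mu> > -1" "a > 0" "r \<ge> 1"
  shows "norm (W_amp \<mu> a r) \<le> 2 * (LINT y|lborel. K_dom \<mu> (2 * a) y)"
proof -
  have "norm (LINT y|lborel. of_real (r powr (- \<mu>)) * K_integrand \<mu> (2 * a * r) y) \<le> (LINT y|lborel. K_dom \<mu> (2 * a) y)"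
  proof (rule Bochner_Integration.integral_norm_bound_integral)
    show "integrable lborel (\<lambda>y. of_real (r powr (- \<mu>)) * K_integrand \<mu> (2 * a * r) y)"
    proof (rule Bochner_Integration.integrable_bound[OF integrable_K_dom[OF assms(1), of "2 * a"]])
      show "AE y in lborel. norm (of_real (r powr (- \<mu>)) * K_integrand \<mu> (2 * a * r) y) \<le> norm (K_dom \<mu> (2 * a) y)"
        using scaled_K_bound[OF assms(2,3)] by auto
    qed (use assms in auto)
  qed (use integrable_K_dom[OF assms(1)] scaled_K_bound[OF assms(2,3)] in auto)
  then show ?thesis unfolding W_amp_def by (simp add: norm_mult)
qed

text \<open>The modulus of the limit of \<open>W_amp\<close>. The integral is Gamma (mu + 1) / (2
  pi) powr (mu + 1), but only the positivity of the whole enters later.\<close>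

definition W_amp_lim :: "real \<Rightarrow> real \<Rightarrow> real" where
  "W_amp_lim \<mu> a = 2 * (2 * a) powr \<mu> * (LINT y|lborel. powp \<mu> y * exp (- 2 * pi * y))"

lemma integrable_powp_exp:
  assumes "\<mu> > -1"
  shows "integrable lborel (\<lambda>y. powp \<mu> y * exp (- 2 * pi * y))"
proof (rule Bochner_Integration.integrable_bound[OF integrable_K_dom[OF assms, of 1]])
  show "AE y in lborel. norm (powp \<mu> y * exp (- 2 * pi * y)) \<le> norm (K_dom \<mu> 1 y)"
    using K_dom_bound[of 1 _ 1 \<mu>] by (intro AE_I2) (auto simp: powp_def intro: order_trans[OF _ abs_ge_self])
qed auto

lemma W_amp_lim_pos:
  assumes "\<mu> > -1" "a > 0"
  shows "W_amp_lim \<mu> a > 0"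
proof -
  let ?f = "\<lambda>y. powp \<mu> y * exp (- 2 * pi * y)"
  have "(LINT y|lborel. ?f y) \<noteq> 0"
  proof
    assume "(LINT y|lborel. ?f y) = 0"
    then have "AE y in lborel. ?f y = 0"
      by (subst (asm) integral_nonneg_eq_0_iff_AE[OF integrable_powp_exp[OF assms(1)]]) auto
    then have "AE t in lborel. t \<notin> {0<..<1::real}"
      by (rule AE_mp) (auto intro!: AE_I2 simp: powp_def split: if_splits)
    then have "emeasure lborel {0<..<1::real} = 0"
      by (subst (asm) AE_iff_measurable[of "{0<..<1}"]) auto
    then show False by simp
  qed
  moreover have "(LINT y|lborel. ?f y) \<ge> 0" by simp
  ultimately have "(LINT y|lborel. ?f y) > 0" by linarith
  then show ?thesis using assms unfolding W_amp_lim_def by (intro mult_pos_pos) auto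
qed

text \<open>The leading term of the Bessel asymptotics: after division by r the base of the power in
  the integrand, \<open>Complex (2 * a) (y / r)\<close>, tends to 2 a, and dominated convergence
  gives the limit.\<close>

lemma W_amp_tendsto:
  assumes "\<mu> > -1" "a > 0"
  shows "(W_amp \<mu> a \<longlongrightarrow> of_real (W_amp_lim \<mu> a) * cis (- (pi * \<mu> / 2))) at_top"
proof -
  have "((\<lambda>r. LINT y|lborel. of_real (r powr (- \<mu>)) * K_integrand \<mu> (2 * a * r) y) \<longlongrightarrow>
        (LINT y|lborel. complex_of_real ((2 * a) powr \<mu> * (powp \<mu> y * exp (- 2 * pi * y))))) at_top"
  proof (rule integral_dominated_convergence_at_top[where w="K_dom \<mu> (2 * a)"])
    show "\<forall>\<^sub>F r in at_top. AE y in lborel. norm (of_real (r powr (- \<mu>)) * K_integrand \<mu> (2 * a * r) y) \<le> K_dom \<mu> (2 * a) y"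
      using eventually_ge_at_top[of 1] by eventually_elim (use scaled_K_bound[OF assms(2)] in auto)
    show "AE y in lborel. ((\<lambda>r. of_real (r powr (- \<mu>)) * K_integrand \<mu> (2 * a * r) y) \<longlongrightarrow>
         complex_of_real ((2 * a) powr \<mu> * (powp \<mu> y * exp (- 2 * pi * y)))) at_top"
    proof (rule AE_I2)
      fix y :: real
      show "((\<lambda>r. of_real (r powr (- \<mu>)) * K_integrand \<mu> (2 * a * r) y) \<longlongrightarrow>
         complex_of_real ((2 * a) powr \<mu> * (powp \<mu> y * exp (- 2 * pi * y)))) at_top"
      proof (cases "y > 0")
        case True
        have "((\<lambda>r. of_real (y powr \<mu> * exp (- 2 * pi * y)) * Complex (2 * a) (y / r) powr of_real \<mu>) \<longlongrightarrow>
            of_real (y powr \<mu> * exp (- 2 * pi * y)) * of_real (2 * a) powr of_real \<mu>) at_top"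
        proof (intro tendsto_intros)
          have "((\<lambda>r. y / r) \<longlongrightarrow> 0) at_top" by real_asymp
          then show "((\<lambda>r. Complex (2 * a) (y / r)) \<longlongrightarrow> of_real (2 * a)) at_top"
            unfolding Complex_eq using tendsto_add[OF tendsto_const tendsto_mult[OF tendsto_const tendsto_of_real], of "\<lambda>r. y / r" 0 at_top "of_real (2 * a)" \<i>] by simp
        qed (use assms in \<open>auto simp: complex_nonpos_Reals_iff\<close>)
        also have "of_real (2 * a) powr of_real \<mu> = complex_of_real ((2 * a) powr \<mu>)"
          using assms by (intro powr_of_real) auto
        also have "of_real (y powr \<mu> * exp (- 2 * pi * y)) * complex_of_real ((2 * a) powr \<mu>) = complex_of_real ((2 * a) powr \<mu> * (powp \<mu> y * exp (- 2 * pi * y)))"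
          using True by (simp add: powp_def)
        finally show ?thesis
        proof (rule Lim_transform_eventually)
          show "\<forall>\<^sub>F r in at_top. of_real (y powr \<mu> * exp (- 2 * pi * y)) * Complex (2 * a) (y / r) powr of_real \<mu> = of_real (r powr (- \<mu>)) * K_integrand \<mu> (2 * a * r) y"
            using eventually_gt_at_top[of 0]
          proof eventually_elim
            fix r :: real assume r: "r > 0"
            have nz: "Complex (2 * a) (y / r) \<noteq> 0" using assms by (simp add: complex_eq_iff)
            have e: "Complex (2 * a * r) y = of_real r * Complex (2 * a) (y / r)"
              using r by (simp add: complex_eq_iff)
            have "Complex (2 * a * r) y powr of_real \<mu> = of_real r powr of_real \<mu> * Complex (2 * a) (y / r) powr of_real \<mu>"
              unfolding e using r nz by (simp add: powr_def Ln_times_of_real Ln_of_real distrib_left exp_add)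
            also have "of_real r powr of_real \<mu> = complex_of_real (r powr \<mu>)" using r by (simp add: powr_of_real)
            finally show "of_real (y powr \<mu> * exp (- 2 * pi * y)) * Complex (2 * a) (y / r) powr of_real \<mu> = of_real (r powr (- \<mu>)) * K_integrand \<mu> (2 * a * r) y"
              using True r by (simp add: K_integrand_def powr_minus field_simps)
          qed
        qed
      qed (simp add: K_integrand_def powp_def)
    qed
  qed (use integrable_K_dom[OF assms(1)] assms in \<open>auto\<close>)
  then have "((\<lambda>r. 2 * cis (- (pi * \<mu> / 2)) * (LINT y|lborel. of_real (r powr (- \<mu>)) * K_integrand \<mu> (2 * a * r) y)) \<longlongrightarrow>
     2 * cis (- (pi * \<mu> / 2)) * of_real ((2 * a) powr \<mu> * (LINT y|lborel. powp \<mu> y * exp (- 2 * pi * y)))) at_top"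
    by (intro tendsto_intros) (simp del: of_real_mult)
  then show ?thesis unfolding W_amp_def[abs_def] W_amp_lim_def by (simp add: mult_ac)
qed

text \<open>The amplitude controls r >= 1 and the integral of the absolute value controls r < 1.
  Writing the bound with 1 + r makes it uniform down to 0.\<close>

lemma W_bound:
  assumes "\<mu> > -1" "a > 0"
  obtains C where "C > 0" "\<And>r. r \<ge> 0 \<Longrightarrow> \<bar>W \<mu> a r\<bar> \<le> C * (1 + r) powr (- \<mu> - 1)"
proof -
  define B where "B = (LINT t|lborel. powp \<mu> (a\<^sup>2 - t\<^sup>2))"
  define D where "D = 2 * (LINT y|lborel. K_dom \<mu> (2 * a) y)"
  have "B \<ge> 0" unfolding B_def by simp
  have "D \<ge> 0" using W_amp_bound[OF assms, of 1] unfolding D_def by (meson norm_ge_zero order_refl order_trans)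
  \<comment> \<open>The factor 2 powr (mu + 1) is the price of replacing r by 1 + r: it uses 1 + r
    <= 2 r for r >= 1 and 1 + r <= 2 below 1.\<close>
  define C where "C = (B + D + 1) * 2 powr (\<mu> + 1)"
  show thesis
  proof (rule that)
    show "C > 0" unfolding C_def using \<open>B \<ge> 0\<close> \<open>D \<ge> 0\<close> by (intro mult_pos_pos) auto
    fix r :: real assume r: "r \<ge> 0"
    show "\<bar>W \<mu> a r\<bar> \<le> C * (1 + r) powr (- \<mu> - 1)"
    proof (cases "r \<ge> 1")
      case True
      have "\<bar>W \<mu> a r\<bar> = r powr (- \<mu> - 1) * \<bar>Im (cis (2 * pi * a * r) * W_amp \<mu> a r)\<bar>"
        using True assms by (subst W_W_amp) (auto simp: abs_mult)
      also have "\<bar>Im (cis (2 * pi * a * r) * W_amp \<mu> a r)\<bar> \<le> norm (cis (2 * pi * a * r) * W_amp \<mu> a r)"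
        by (rule abs_Im_le_cmod)
      also have "\<dots> \<le> D" unfolding D_def using W_amp_bound[OF assms True] by (simp add: norm_mult)
      finally have 1: "\<bar>W \<mu> a r\<bar> \<le> r powr (- \<mu> - 1) * D" by (simp add: mult_left_mono)
      have "r powr (- \<mu> - 1) \<le> ((1 + r) / 2) powr (- \<mu> - 1)"
        using assms True by (intro powr_mono2') auto
      also have "\<dots> = 2 powr (\<mu> + 1) * (1 + r) powr (- \<mu> - 1)"
        using True by (simp add: powr_divide powr_minus field_simps powr_add powr_diff)
      finally have "r powr (- \<mu> - 1) * D \<le> (2 powr (\<mu> + 1) * (1 + r) powr (- \<mu> - 1)) * (B + D + 1)"
        using \<open>B \<ge> 0\<close> \<open>D \<ge> 0\<close> by (intro mult_mono) auto
      then show ?thesis using 1 unfolding C_def by (simp add: mult_ac)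
    next
      case False
      have "\<bar>W \<mu> a r\<bar> \<le> B"
        unfolding W_def B_def
        using integrable_powp_bounded[OF assms(1), where h="\<lambda>t. cos (2 * pi * r * t)" and B=1 and A="a\<^sup>2"] integrable_powp[OF assms(1), of "a\<^sup>2"]
        unfolding real_norm_def[symmetric]
        by (intro Bochner_Integration.integral_norm_bound_integral) (auto simp: abs_mult mult_left_le)
      also have "\<dots> \<le> (B + D + 1) * (2 powr (\<mu> + 1) * (1 + r) powr (- \<mu> - 1))"
      proof -
        have "2 powr (- \<mu> - 1) \<le> (1 + r) powr (- \<mu> - 1)"
          using False r assms by (intro powr_mono2') auto
        then have "2 powr (\<mu> + 1) * 2 powr (- \<mu> - 1) \<le> 2 powr (\<mu> + 1) * (1 + r) powr (- \<mu> - 1)"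
          by (intro mult_left_mono) auto
        then have "1 \<le> 2 powr (\<mu> + 1) * (1 + r) powr (- \<mu> - 1)" by (simp flip: powr_add)
        then have "(B + D + 1) * 1 \<le> (B + D + 1) * (2 powr (\<mu> + 1) * (1 + r) powr (- \<mu> - 1))"
          using \<open>B \<ge> 0\<close> \<open>D \<ge> 0\<close> by (intro mult_left_mono) auto
        moreover have "B \<le> (B + D + 1) * 1" using \<open>D \<ge> 0\<close> by simp
        ultimately show ?thesis by (rule order_trans[rotated])
      qed
      finally show ?thesis unfolding C_def by (simp only: mult.assoc)
    qed
  qed
qed

text \<open>The factor r in the derivative uses up the additional decay of
  \<open>W (\<mu> + 1)\<close>, which leaves exactly the order of \<open>W \<mu>\<close>.\<close>

lemma W_deriv_bound:
  assumes "\<mu> > -1" "a > 0"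
  obtains C where "C > 0" "\<And>r. r \<ge> 0 \<Longrightarrow> \<bar>2 * pi\<^sup>2 * r / (\<mu> + 1) * W (\<mu> + 1) a r\<bar> \<le> C * (1 + r) powr (- \<mu> - 1)"
proof -
  obtain C where C: "C > 0" "\<And>r. r \<ge> 0 \<Longrightarrow> \<bar>W (\<mu> + 1) a r\<bar> \<le> C * (1 + r) powr (- (\<mu> + 1) - 1)"
    using W_bound[of "\<mu> + 1" a] assms by auto
  show thesis
  proof (rule that)
    show "2 * pi\<^sup>2 / (\<mu> + 1) * C > 0" using C assms by auto
    fix r :: real assume r: "r \<ge> 0"
    have eq: "\<bar>2 * pi\<^sup>2 * r / (\<mu> + 1) * W (\<mu> + 1) a r\<bar> = 2 * pi\<^sup>2 / (\<mu> + 1) * (r * \<bar>W (\<mu> + 1) a r\<bar>)"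
      using r assms by (simp add: abs_mult)
    have "r * \<bar>W (\<mu> + 1) a r\<bar> \<le> (1 + r) * (C * (1 + r) powr (- (\<mu> + 1) - 1))"
      using C r by (intro mult_mono) auto
    also have "\<dots> = C * ((1 + r) * (1 + r) powr (- (\<mu> + 1) - 1))" by simp
    also have "(1 + r) * (1 + r) powr (- (\<mu> + 1) - 1) = (1 + r) powr (1 + (- (\<mu> + 1) - 1))" using r by (intro powr_mult_base) auto
    also have "1 + (- (\<mu> + 1) - 1) = - \<mu> - 1" by simp
    finally have "r * \<bar>W (\<mu> + 1) a r\<bar> \<le> C * (1 + r) powr (- \<mu> - 1)" .
    then have "2 * pi\<^sup>2 / (\<mu> + 1) * (r * \<bar>W (\<mu> + 1) a r\<bar>) \<le> 2 * pi\<^sup>2 / (\<mu> + 1) * (C * (1 + r) powr (- \<mu> - 1))"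
      using assms by (intro mult_left_mono) auto
    then show "\<bar>2 * pi\<^sup>2 * r / (\<mu> + 1) * W (\<mu> + 1) a r\<bar> \<le> 2 * pi\<^sup>2 / (\<mu> + 1) * C * (1 + r) powr (- \<mu> - 1)"
      unfolding eq by (simp only: mult.assoc)
  qed
qed

text \<open>The limiting phases of the two oscillating functions differ by \<open>pi * (\<mu> - \<nu>) / 2\<close>, which is not a
  multiple of \<open>pi\<close>, so the functions cannot both be small at the same place.\<close>

lemma W_pair_lower:
  assumes "\<mu> > -1" "\<nu> > -1" "0 < \<mu> - \<nu>" "\<mu> - \<nu> < 2" "a > 0"
  obtains c R where "c > 0" "R \<ge> 1"
    "\<And>r. r \<ge> R \<Longrightarrow> c \<le> r powr (\<mu> + 1) * \<bar>W \<mu> a r\<bar> + r powr (\<nu> + 1) * \<bar>W \<nu> a r\<bar>"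
proof -
  define D where "D = 2 * (LINT y|lborel. K_dom \<mu> (2 * a) y) + 2 * (LINT y|lborel. K_dom \<nu> (2 * a) y) + 1"
  have D1: "norm (W_amp \<mu> a r) \<le> D" "norm (W_amp \<nu> a r) \<le> D" "0 < D" if "r \<ge> 1" for r
    using W_amp_bound[OF assms(1,5) that] W_amp_bound[OF assms(2,5) that] norm_ge_zero[of "W_amp \<mu> a r"] norm_ge_zero[of "W_amp \<nu> a r"]
    unfolding D_def by linarith+
  define L where "L = W_amp_lim \<mu> a * W_amp_lim \<nu> a * sin (pi * (\<mu> - \<nu>) / 2)"
  have "0 < sin (pi * (\<mu> - \<nu>) / 2)"
    using assms mult_strict_left_mono[OF assms(4) pi_gt_zero] by (intro sin_gt_zero) auto
  then have "L > 0" unfolding L_def using W_amp_lim_pos assms by (intro mult_pos_pos) auto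
  have "((\<lambda>r. \<bar>Im (W_amp \<mu> a r * cnj (W_amp \<nu> a r))\<bar>) \<longlongrightarrow> \<bar>Im (of_real (W_amp_lim \<mu> a) * cis (- (pi * \<mu> / 2)) * cnj (of_real (W_amp_lim \<nu> a) * cis (- (pi * \<nu> / 2))))\<bar>) at_top"
    using assms by (intro tendsto_intros W_amp_tendsto) auto
  also have "of_real (W_amp_lim \<mu> a) * cis (- (pi * \<mu> / 2)) * cnj (of_real (W_amp_lim \<nu> a) * cis (- (pi * \<nu> / 2))) = of_real (W_amp_lim \<mu> a * W_amp_lim \<nu> a) * cis (- (pi * (\<mu> - \<nu>) / 2))"
    by (simp add: cis_cnj cis_mult algebra_simps diff_divide_distrib)
  also have "\<bar>Im (of_real (W_amp_lim \<mu> a * W_amp_lim \<nu> a) * cis (- (pi * (\<mu> - \<nu>) / 2)))\<bar> = L"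
    using \<open>L > 0\<close> unfolding L_def by (simp del: of_real_mult)
  finally have "\<forall>\<^sub>F r in at_top. \<bar>Im (W_amp \<mu> a r * cnj (W_amp \<nu> a r))\<bar> > L / 2"
    using \<open>L > 0\<close> by (intro order_tendstoD) auto
  then obtain R where R: "\<And>r. r \<ge> R \<Longrightarrow> \<bar>Im (W_amp \<mu> a r * cnj (W_amp \<nu> a r))\<bar> > L / 2"
    unfolding eventually_at_top_linorder by blast
  show thesis
  proof (rule that)
    show "L / 2 / D > 0" using \<open>L > 0\<close> D1(3)[of 1] by auto
    show "max R 1 \<ge> 1" by simp
    fix r assume "r \<ge> max R 1"
    then have r: "r \<ge> R" "r \<ge> 1" by auto
    define x where "x = cis (2 * pi * a * r) * W_amp \<mu> a r"
    define y where "y = cis (2 * pi * a * r) * W_amp \<nu> a r"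
    have n: "norm x \<le> D" "norm y \<le> D" unfolding x_def y_def using D1[OF r(2)] by (auto simp: norm_mult)
    \<comment> \<open>The common oscillation cancels in x * cnj y, so the limits of the amplitudes
      keep Im (x * cnj y) away from 0. But this number is Im x * Re y - Re x * Im y, which would be
      small if both imaginary parts were.\<close>
    have "x * cnj y = W_amp \<mu> a r * cnj (W_amp \<nu> a r) * (cis (2 * pi * a * r) * cis (- (2 * pi * a * r)))"
      unfolding x_def y_def by (simp add: cis_cnj mult_ac)
    also have "\<dots> = W_amp \<mu> a r * cnj (W_amp \<nu> a r)" by (subst cis_mult) simp
    finally have "L / 2 < \<bar>Im (x * cnj y)\<bar>" using R[OF r(1)] by simp
    also have "\<dots> = \<bar>Im x * Re y - Re x * Im y\<bar>" by simp
    also have "\<dots> \<le> \<bar>Im x\<bar> * \<bar>Re y\<bar> + \<bar>Re x\<bar> * \<bar>Im y\<bar>" by (simp add: abs_triangle_ineq4[THEN order_trans] abs_mult flip: abs_mult)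
    also have "\<dots> \<le> \<bar>Im x\<bar> * D + D * \<bar>Im y\<bar>"
      using n abs_Re_le_cmod[of x] abs_Re_le_cmod[of y] by (intro add_mono mult_left_mono mult_right_mono) auto
    finally have "L / 2 / D \<le> \<bar>Im x\<bar> + \<bar>Im y\<bar>"
      using D1(3)[OF r(2)] by (simp add: field_simps)
    also have "\<bar>Im x\<bar> = r powr (\<mu> + 1) * \<bar>W \<mu> a r\<bar>"
    proof -
      have "r powr (\<mu> + 1) * r powr (- \<mu> - 1) = 1" using r by (simp flip: powr_add)
      then show ?thesis using r assms unfolding x_def by (subst W_W_amp) (auto simp: abs_mult simp flip: mult.assoc)
    qed
    also have "\<bar>Im y\<bar> = r powr (\<nu> + 1) * \<bar>W \<nu> a r\<bar>"
    proof -
      have "r powr (\<nu> + 1) * r powr (- \<nu> - 1) = 1" using r by (simp flip: powr_add)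
      then show ?thesis using r assms unfolding y_def by (subst W_W_amp) (auto simp: abs_mult simp flip: mult.assoc)
    qed
    finally show "L / 2 / D \<le> r powr (\<mu> + 1) * \<bar>W \<mu> a r\<bar> + r powr (\<nu> + 1) * \<bar>W \<nu> a r\<bar>" .
  qed
qed

section \<open>The Fourier transform of the truncated power\<close>

text \<open>By uniqueness of translation invariant measures; the unit ball determines the constant.\<close>

lemma lborel_orthogonal:
  fixes f :: "'a::euclidean_space \<Rightarrow> 'a"
  assumes f: "orthogonal_transformation f"
  shows "distr lborel borel f = lborel"
proof (rule measure_eqI)
  have lin: "linear f" using f by (rule orthogonal_transformation_linear)
  have [measurable]: "f \<in> borel_measurable borel"
    using lin by (intro borel_measurable_continuous_onI linear_continuous_on linear_conv_bounded_linear[THEN iffD1])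
  obtain g where g: "\<And>y. f (g y) = y"
    using f orthogonal_transformation_surj by (metis surj_f_inv_f)
  show "sets (distr lborel borel f) = sets lborel" by simp
  fix A assume "A \<in> sets (distr lborel borel f)"
  then have [measurable]: "A \<in> sets borel" by simp
  \<comment> \<open>A comparison set that is invariant under f and under negation and has finite
    positive measure, so that it can be cancelled at the end.\<close>
  define B where "B = (ball 0 1 :: 'a set)"
  have [measurable]: "B \<in> sets borel" unfolding B_def by simp
  have Bsym: "y \<in> B \<longleftrightarrow> - y \<in> B" for y unfolding B_def by simp
  have eB: "emeasure lborel B \<noteq> 0" "emeasure lborel B \<noteq> \<infinity>"
    unfolding B_def using unit_ball_vol_pos[of "real DIM('a)"] by (auto simp: emeasure_ball ennreal_eq_0_iff not_le simp flip: not_less)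
  have shift: "(\<integral>\<^sup>+y. h (y + c) \<partial>lborel) = (\<integral>\<^sup>+y. h y \<partial>lborel)" if "h \<in> borel_measurable borel" for h :: "'a \<Rightarrow> ennreal" and c
    using that by (subst (2) lborel_distr_plus[of c, symmetric]) (simp add: nn_integral_distr add.commute)
  have nB: "(\<integral>\<^sup>+x. indicator B (f x) \<partial>lborel) = emeasure lborel B"
  proof -
    have "indicator B (f x) = (indicator B x :: ennreal)" for x
      using f by (simp add: B_def indicator_def orthogonal_transformation_norm)
    then show ?thesis by simp
  qed
  \<comment> \<open>The double integral of the indicators of A at f x and of B at y is evaluated in
    two ways: directly, and after shifting y by f x and then x by g y, which moves the translation
    onto A, where it has no effect on the measure.\<close>
  have "(\<integral>\<^sup>+x. indicator A (f x) \<partial>lborel) * emeasure lborel B = (\<integral>\<^sup>+x. (\<integral>\<^sup>+y. indicator A (f x) * indicator B y \<partial>lborel) \<partial>lborel)"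
    by (simp add: nn_integral_cmult nn_integral_multc)
  also have "\<dots> = (\<integral>\<^sup>+x. (\<integral>\<^sup>+y. indicator A (f x) * indicator B (y + - f x) \<partial>lborel) \<partial>lborel)"
    by (subst shift) auto
  also have "\<dots> = (\<integral>\<^sup>+y. (\<integral>\<^sup>+x. indicator A (f x) * indicator B (y + - f x) \<partial>lborel) \<partial>lborel)"
    by (rule lborel_pair.Fubini') measurable
  also have "\<dots> = (\<integral>\<^sup>+y. (\<integral>\<^sup>+x. indicator A (f x + y) * indicator B (f x) \<partial>lborel) \<partial>lborel)"
  proof (rule nn_integral_cong)
    fix y
    have "(\<integral>\<^sup>+x. indicator A (f x) * indicator B (y + - f x) \<partial>lborel) = (\<integral>\<^sup>+x. indicator A (f (x + g y)) * indicator B (y + - f (x + g y)) \<partial>lborel)"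
      by (rule shift[symmetric]) measurable
    also have "\<dots> = (\<integral>\<^sup>+x. indicator A (f x + y) * indicator B (f x) \<partial>lborel)"
      using Bsym by (intro nn_integral_cong) (simp add: linear_add[OF lin] g indicator_def)
    finally show "(\<integral>\<^sup>+x. indicator A (f x) * indicator B (y + - f x) \<partial>lborel) = (\<integral>\<^sup>+x. indicator A (f x + y) * indicator B (f x) \<partial>lborel)" .
  qed
  also have "\<dots> = (\<integral>\<^sup>+x. (\<integral>\<^sup>+y. indicator A (f x + y) * indicator B (f x) \<partial>lborel) \<partial>lborel)"
    by (rule lborel_pair.Fubini') measurable
  also have "\<dots> = (\<integral>\<^sup>+x. emeasure lborel A * indicator B (f x) \<partial>lborel)"
  proof (rule nn_integral_cong)
    fix x
    have "(\<integral>\<^sup>+y. indicator A (f x + y) * indicator B (f x) \<partial>lborel) = (\<integral>\<^sup>+y. indicator A (y + f x) \<partial>lborel) * indicator B (f x)"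
      by (subst nn_integral_multc) (auto simp: add.commute)
    also have "(\<integral>\<^sup>+y. indicator A (y + f x) \<partial>lborel) = emeasure lborel A"
      by (subst shift) auto
    finally show "(\<integral>\<^sup>+y. indicator A (f x + y) * indicator B (f x) \<partial>lborel) = emeasure lborel A * indicator B (f x)" .
  qed
  also have "\<dots> = emeasure lborel A * emeasure lborel B"
    by (subst nn_integral_cmult) (auto simp: nB)
  finally have "(\<integral>\<^sup>+x. indicator A (f x) \<partial>lborel) = emeasure lborel A"
    using eB by (simp add: mult.commute[of _ "emeasure lborel B"] ennreal_mult_cancel_left)
  moreover have "(\<integral>\<^sup>+x. indicator A (f x) \<partial>lborel) = emeasure (distr lborel borel f) A"
    using nn_integral_distr[of f lborel borel "indicator A"] by simp
  ultimately show "emeasure (distr lborel borel f) A = emeasure lborel A" by simp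
qed

lemma LINT_orthogonal:
  fixes f :: "'a::euclidean_space \<Rightarrow> 'a" and h :: "'a \<Rightarrow> 'b::{banach,second_countable_topology}"
  assumes "orthogonal_transformation f" "h \<in> borel_measurable borel"
  shows "(LINT x|lborel. h (f x)) = (LINT x|lborel. h x)"
proof -
  have [measurable]: "f \<in> borel_measurable borel"
    using orthogonal_transformation_linear[OF assms(1)]
    by (intro borel_measurable_continuous_onI linear_continuous_on linear_conv_bounded_linear[THEN iffD1])
  show ?thesis
    using assms(2) by (subst (2) lborel_orthogonal[OF assms(1), symmetric]) (simp add: integral_distr)
qed

text \<open>Each integrated coordinate contributes a factor \<open>powp_const\<close> and raises the
  exponent by 1/2; this collects the factors for \<open>n\<close> coordinates.\<close>

fun slice_const :: "nat \<Rightarrow> real \<Rightarrow> real" where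
  "slice_const 0 \<beta> = 1"
| "slice_const (Suc n) \<beta> = powp_const \<beta> * slice_const n (\<beta> + 1/2)"

lemma slice_const_pos: "\<beta> > -1 \<Longrightarrow> slice_const n \<beta> > 0"
  by (induction n arbitrary: \<beta>) (auto intro!: mult_pos_pos powp_const_pos)

interpretation lborel_product: product_sigma_finite "\<lambda>_::'i. lborel :: real measure"
  by standard

lemma sum_upd_sq:
  assumes "finite I" "i \<notin> I"
  shows "(\<Sum>b\<in>insert i I. ((x(i := y)) b)\<^sup>2) = y\<^sup>2 + (\<Sum>b\<in>I. (x b)\<^sup>2 :: real)"
proof -
  have "(\<Sum>b\<in>I. ((x(i := y)) b)\<^sup>2) = (\<Sum>b\<in>I. (x b)\<^sup>2)"
    using assms by (intro sum.cong) auto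
  then show ?thesis using assms by simp
qed

lemma nn_integral_powp:
  assumes "\<beta> > -1"
  shows "(\<integral>\<^sup>+y. ennreal (powp \<beta> (A - y\<^sup>2)) \<partial>lborel) = ennreal (powp_const \<beta> * powp (\<beta> + 1/2) A)"
  using assms by (subst nn_integral_eq_integral) (auto simp: integrable_powp integral_powp)

lemma integrable_powp_PiM:
  assumes "finite I" "\<beta> > -1"
  shows "integrable (Pi\<^sub>M I (\<lambda>_. lborel)) (\<lambda>x. powp \<beta> (A - (\<Sum>b\<in>I. (x b)\<^sup>2)))"
  using assms
proof (induction I arbitrary: \<beta> rule: finite_induct)
  case empty
  show ?case
    by (simp add: PiM_empty integrable_count_space)
next
  case (insert i I)
  have IH: "integrable (Pi\<^sub>M I (\<lambda>_. lborel)) (\<lambda>x. powp (\<beta> + 1/2) (A - (\<Sum>b\<in>I. (x b)\<^sup>2)))"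
    using insert by auto
  have [measurable]: "(\<lambda>x. powp \<beta> (A - (\<Sum>b\<in>insert i I. (x b)\<^sup>2))) \<in> borel_measurable (Pi\<^sub>M (insert i I) (\<lambda>_. lborel))"
    by measurable
  have "(\<integral>\<^sup>+x. ennreal (norm (powp \<beta> (A - (\<Sum>b\<in>insert i I. (x b)\<^sup>2)))) \<partial>Pi\<^sub>M (insert i I) (\<lambda>_. lborel))
      = (\<integral>\<^sup>+x. (\<integral>\<^sup>+y. ennreal (powp \<beta> (A - (\<Sum>b\<in>insert i I. ((x(i := y)) b)\<^sup>2))) \<partial>lborel) \<partial>Pi\<^sub>M I (\<lambda>_. lborel))"
    using insert.hyps by (subst lborel_product.product_nn_integral_insert) auto
  also have "\<dots> = (\<integral>\<^sup>+x. ennreal (powp_const \<beta> * powp (\<beta> + 1/2) (A - (\<Sum>b\<in>I. (x b)\<^sup>2))) \<partial>Pi\<^sub>M I (\<lambda>_. lborel))"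
  proof (rule nn_integral_cong)
    fix x :: "'a \<Rightarrow> real"
    have "A - (\<Sum>b\<in>insert i I. ((x(i := y)) b)\<^sup>2) = (A - (\<Sum>b\<in>I. (x b)\<^sup>2)) - y\<^sup>2" for y
      unfolding sum_upd_sq[OF insert.hyps] by simp
    then show "(\<integral>\<^sup>+y. ennreal (powp \<beta> (A - (\<Sum>b\<in>insert i I. ((x(i := y)) b)\<^sup>2))) \<partial>lborel) = ennreal (powp_const \<beta> * powp (\<beta> + 1/2) (A - (\<Sum>b\<in>I. (x b)\<^sup>2)))"
      using insert.prems by (simp only: nn_integral_powp)
  qed
  also have "\<dots> < \<infinity>"
    using powp_const_pos[OF insert.prems]
    by (subst nn_integral_eq_integral[OF integrable_mult_right[OF IH]]) auto
  finally show ?case by (simp add: integrable_iff_bounded)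
qed

text \<open>The oscillating factor \<open>h\<close> depends on the coordinate \<open>b0\<close>
  alone, which is left for last. The exponent is arbitrary in the induction because every slice
  changes it.\<close>

lemma integral_powp_PiM:
  fixes h :: "real \<Rightarrow> complex"
  assumes "finite I" "b0 \<notin> I" "\<beta> > -1" "h \<in> borel_measurable borel" "\<And>t. norm (h t) \<le> 1"
  shows "(LINT x|Pi\<^sub>M (insert b0 I) (\<lambda>_. lborel). of_real (powp \<beta> (A - (\<Sum>b\<in>insert b0 I. (x b)\<^sup>2))) * h (x b0))
       = of_real (slice_const (card I) \<beta>) * (LINT t|lborel. of_real (powp (\<beta> + card I / 2) (A - t\<^sup>2)) * h t)"
  using assms(1-3)
proof (induction I arbitrary: \<beta> rule: finite_induct)
  case empty
  note [measurable] = assms(4)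
  have "(LINT x|Pi\<^sub>M {b0} (\<lambda>_. lborel). of_real (powp \<beta> (A - (x b0)\<^sup>2)) * h (x b0))
      = (LINT t|lborel. of_real (powp \<beta> (A - t\<^sup>2)) * h t)"
    by (rule lborel_product.product_integral_singleton) measurable
  then show ?case by simp
next
  case (insert j I)
  note [measurable] = assms(4)
  let ?J = "insert b0 I" and ?L = "\<lambda>_. lborel :: real measure"
  have j: "j \<notin> ?J" "finite ?J" using insert by auto
  have int: "integrable (Pi\<^sub>M (insert j ?J) ?L) (\<lambda>x. of_real (powp \<beta> (A - (\<Sum>b\<in>insert j ?J. (x b)\<^sup>2))) * h (x b0))"
  proof (rule Bochner_Integration.integrable_bound[OF integrable_powp_PiM])
    show "AE x in Pi\<^sub>M (insert j ?J) ?L. norm (of_real (powp \<beta> (A - (\<Sum>b\<in>insert j ?J. (x b)\<^sup>2))) * h (x b0)) \<le> norm (powp \<beta> (A - (\<Sum>b\<in>insert j ?J. (x b)\<^sup>2)))"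
      using assms(5) by (auto simp: norm_mult mult_left_le)
  qed (use insert in \<open>auto\<close>)
  have "(LINT x|Pi\<^sub>M (insert b0 (insert j I)) ?L. of_real (powp \<beta> (A - (\<Sum>b\<in>insert b0 (insert j I). (x b)\<^sup>2))) * h (x b0))
      = (LINT x|Pi\<^sub>M (insert j ?J) ?L. of_real (powp \<beta> (A - (\<Sum>b\<in>insert j ?J. (x b)\<^sup>2))) * h (x b0))"
    by (simp only: insert_commute)
  also have "\<dots> = (LINT x|Pi\<^sub>M ?J ?L. (LINT y|lborel. of_real (powp \<beta> (A - (\<Sum>b\<in>insert j ?J. ((x(j := y)) b)\<^sup>2))) * h ((x(j := y)) b0)))"
    by (rule lborel_product.product_integral_insert[OF j(2,1) int])
  also have "\<dots> = (LINT x|Pi\<^sub>M ?J ?L. of_real (powp_const \<beta>) * (of_real (powp (\<beta> + 1/2) (A - (\<Sum>b\<in>?J. (x b)\<^sup>2))) * h (x b0)))"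
  proof (rule Bochner_Integration.integral_cong[OF refl])
    fix x :: "'a \<Rightarrow> real"
    have "A - (\<Sum>b\<in>insert j ?J. ((x(j := y)) b)\<^sup>2) = (A - (\<Sum>b\<in>?J. (x b)\<^sup>2)) - y\<^sup>2" for y
      unfolding sum_upd_sq[OF j(2,1)] by simp
    moreover have "(x(j := y)) b0 = x b0" for y using j by auto
    ultimately have "(LINT y|lborel. of_real (powp \<beta> (A - (\<Sum>b\<in>insert j ?J. ((x(j := y)) b)\<^sup>2))) * h ((x(j := y)) b0))
       = (LINT y|lborel. of_real (powp \<beta> ((A - (\<Sum>b\<in>?J. (x b)\<^sup>2)) - y\<^sup>2)) * h (x b0))"
      by (simp only:)
    also have "\<dots> = of_real (powp_const \<beta>) * (of_real (powp (\<beta> + 1/2) (A - (\<Sum>b\<in>?J. (x b)\<^sup>2))) * h (x b0))"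
      using insert.prems by (simp add: integral_powp)
    finally show "(LINT y|lborel. of_real (powp \<beta> (A - (\<Sum>b\<in>insert j ?J. ((x(j := y)) b)\<^sup>2))) * h ((x(j := y)) b0))
       = of_real (powp_const \<beta>) * (of_real (powp (\<beta> + 1/2) (A - (\<Sum>b\<in>?J. (x b)\<^sup>2))) * h (x b0))" .
  qed
  also have "\<dots> = of_real (powp_const \<beta>) * (of_real (slice_const (card I) (\<beta> + 1/2)) * (LINT t|lborel. of_real (powp (\<beta> + 1/2 + card I / 2) (A - t\<^sup>2)) * h t))"
    using insert.IH[of "\<beta> + 1/2"] insert.prems by simp
  finally show ?case using insert.hyps by (simp add: mult.assoc add_divide_distrib add_ac)
qed

lemma U_fun_powp: "a > 0 \<Longrightarrow> U_fun \<beta> a x = powp \<beta> (a\<^sup>2 - (norm x)\<^sup>2)"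
  using power_mono_iff[of a "norm x" 2] by (auto simp: U_fun_def powp_def simp del: power_mono_iff)

lemma borel_measurable_U_fun [measurable]: "U_fun \<beta> a \<in> borel_measurable borel"
  unfolding U_fun_def[abs_def] by measurable

lemma integral_lborel_PiM:
  fixes h :: "'a::euclidean_space \<Rightarrow> 'b::{banach,second_countable_topology}"
  assumes [measurable]: "h \<in> borel_measurable borel"
  shows "(LINT x|lborel. h x) = (LINT f|Pi\<^sub>M Basis (\<lambda>_. lborel). h (\<Sum>b\<in>Basis. f b *\<^sub>R b))"
    and "integrable lborel h \<longleftrightarrow> integrable (Pi\<^sub>M Basis (\<lambda>_. lborel)) (\<lambda>f. h (\<Sum>b\<in>Basis. f b *\<^sub>R b))"
proof -
  have [measurable]: "(\<lambda>f. \<Sum>b\<in>Basis. f b *\<^sub>R b :: 'a) \<in> Pi\<^sub>M Basis (\<lambda>_. lborel) \<rightarrow>\<^sub>M borel" by measurable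
  show "(LINT x|lborel. h x) = (LINT f|Pi\<^sub>M Basis (\<lambda>_. lborel). h (\<Sum>b\<in>Basis. f b *\<^sub>R b))"
    by (subst lborel_eq) (simp add: integral_distr)
  show "integrable lborel h \<longleftrightarrow> integrable (Pi\<^sub>M Basis (\<lambda>_. lborel)) (\<lambda>f. h (\<Sum>b\<in>Basis. f b *\<^sub>R b))"
    by (subst lborel_eq) (simp add: integrable_distr_eq)
qed

lemma norm_sum_Basis: "(norm (\<Sum>b\<in>Basis. f b *\<^sub>R b :: 'a::euclidean_space))\<^sup>2 = (\<Sum>b\<in>(Basis :: 'a set). (f b)\<^sup>2)"
  unfolding power2_norm_eq_inner by (subst euclidean_inner) (simp add: inner_sum_left_Basis power2_eq_square)

lemma integrable_U_fun:
  assumes "\<beta> > -1" "a > 0"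
  shows "integrable lborel (U_fun \<beta> a :: real^'n \<Rightarrow> real)"
  using integrable_powp_PiM[of "Basis :: (real^'n) set" \<beta> "a\<^sup>2"] assms
  by (subst integral_lborel_PiM(2)) (auto simp: U_fun_powp norm_sum_Basis)

text \<open>A rotation takes the frequency to a coordinate axis. Then only one coordinate oscillates
  and all others can be sliced away, which leaves \<open>W\<close> with exponent raised by half
  their number.\<close>

lemma fourier_U_fun:
  fixes \<xi> :: "real ^ 'n"
  assumes "\<beta> > -1" "a > 0"
  shows "(LINT x|lborel. of_real (U_fun \<beta> a x) * cis (- 2 * pi * (\<xi> \<bullet> x)))
     = of_real (slice_const (CARD('n) - 1) \<beta> * W (\<beta> + (real CARD('n) - 1) / 2) a (norm \<xi>))"
proof -
  obtain e :: "real^'n" where e: "e \<in> Basis" using nonempty_Basis by blast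
  let ?h = "\<lambda>t. cis (2 * pi * norm \<xi> * t)"
  have mh: "?h \<in> borel_measurable borel" unfolding cis_conv_exp by measurable
  \<comment> \<open>The minus sign turns the kernel cis (-2 pi ...) into the one of
    \<open>W_cis\<close>.\<close>
  have "norm (- norm \<xi> *\<^sub>R e) = norm \<xi>" using e by simp
  then obtain f where f: "orthogonal_transformation f" "f (- norm \<xi> *\<^sub>R e) = \<xi>"
    using orthogonal_transformation_exists by metis
  have m: "(\<lambda>x. complex_of_real (U_fun \<beta> a x) * cis (- 2 * pi * (\<xi> \<bullet> x))) \<in> borel_measurable borel"
    unfolding cis_conv_exp by measurable
  have "(LINT x|lborel. of_real (U_fun \<beta> a x) * cis (- 2 * pi * (\<xi> \<bullet> x)))
      = (LINT x|lborel. of_real (U_fun \<beta> a (f x)) * cis (- 2 * pi * (\<xi> \<bullet> f x)))"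
    by (rule LINT_orthogonal[OF f(1) m, symmetric])
  also have "\<dots> = (LINT x|lborel. of_real (powp \<beta> (a\<^sup>2 - (norm x)\<^sup>2)) * ?h (x \<bullet> e))"
  proof (rule Bochner_Integration.integral_cong[OF refl])
    fix x
    have "\<xi> \<bullet> f x = (- norm \<xi> *\<^sub>R e) \<bullet> x"
      using f by (metis orthogonal_transformation_def)
    then show "of_real (U_fun \<beta> a (f x)) * cis (- 2 * pi * (\<xi> \<bullet> f x)) = of_real (powp \<beta> (a\<^sup>2 - (norm x)\<^sup>2)) * ?h (x \<bullet> e)"
      using assms orthogonal_transformation_norm[OF f(1)] by (simp add: U_fun_powp inner_commute mult_ac)
  qed
  also have "\<dots> = (LINT g|Pi\<^sub>M Basis (\<lambda>_. lborel). of_real (powp \<beta> (a\<^sup>2 - (norm (\<Sum>b\<in>Basis. g b *\<^sub>R b :: real^'n))\<^sup>2)) * ?h ((\<Sum>b\<in>Basis. g b *\<^sub>R b) \<bullet> e))"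
    using mh by (intro integral_lborel_PiM(1)) (unfold cis_conv_exp, measurable)
  also have "\<dots> = (LINT g|Pi\<^sub>M (insert e (Basis - {e})) (\<lambda>_. lborel). of_real (powp \<beta> (a\<^sup>2 - (\<Sum>b\<in>insert e (Basis - {e}). (g b)\<^sup>2))) * ?h (g e))"
  proof -
    have "insert e (Basis - {e}) = Basis" using e by auto
    then show ?thesis using e unfolding norm_sum_Basis by (simp only: inner_sum_left_Basis)
  qed
  also have "\<dots> = of_real (slice_const (card (Basis - {e})) \<beta>) * (LINT t|lborel. of_real (powp (\<beta> + card (Basis - {e}) / 2) (a\<^sup>2 - t\<^sup>2)) * ?h t)"
    by (rule integral_powp_PiM[OF _ _ assms(1) mh]) auto
  also have "card (Basis - {e}) = CARD('n) - 1" using e by simp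
  also have "real (CARD('n) - 1) = real CARD('n) - 1" by (simp add: of_nat_diff Suc_leI)
  also have "(LINT t|lborel. of_real (powp (\<beta> + (real CARD('n) - 1) / 2) (a\<^sup>2 - t\<^sup>2)) * ?h t) = of_real (W (\<beta> + (real CARD('n) - 1) / 2) a (norm \<xi>))"
    using assms by (intro W_cis) (auto simp: Suc_leI add_strict_increasing2 intro: less_le_trans)
  finally show ?thesis by simp
qed

lemma integrable_norm_le:
  fixes f :: "'a \<Rightarrow> 'b::{banach,second_countable_topology}"
  assumes "integrable M g" "f \<in> borel_measurable M" "\<And>x. x \<in> space M \<Longrightarrow> norm (f x) \<le> g x"
  shows "integrable M f"
  by (rule Bochner_Integration.integrable_bound[OF assms(1,2)]) (use assms(3) in \<open>auto intro!: AE_I2 order_trans[OF assms(3)]\<close>)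

text \<open>No integrability of \<open>f\<close> is asked for: the integral of a non-integrable
  function is 0 by convention, and \<open>g\<close> is nonnegative.\<close>

lemma norm_LINT_le:
  fixes f :: "'a \<Rightarrow> 'b::{banach,second_countable_topology}"
  assumes "integrable M g" "\<And>x. x \<in> space M \<Longrightarrow> norm (f x) \<le> g x"
  shows "norm (LINT x|M. f x) \<le> (LINT x|M. g x)"
proof (cases "integrable M f")
  case True
  have "norm (LINT x|M. f x) \<le> (LINT x|M. norm (f x))" by simp
  also have "\<dots> \<le> (LINT x|M. g x)" using assms True by (intro integral_mono integrable_norm) auto
  finally show ?thesis .
next
  case False
  have "0 \<le> (LINT x|M. g x)"
    using assms(2) by (intro Bochner_Integration.integral_nonneg) (meson norm_ge_zero order_trans)
  then show ?thesis using False by (simp add: not_integrable_integral_eq)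
qed

section \<open>Poisson summation for band-limited functions\<close>

definition ee :: "real \<Rightarrow> complex" where "ee t = cis (2 * pi * t)"

lemma ee_add: "ee (s + t) = ee s * ee t"
  by (simp add: ee_def cis_mult distrib_left)

lemma norm_ee [simp]: "norm (ee t) = 1" by (simp add: ee_def)

lemma ee_0 [simp]: "ee 0 = 1" by (simp add: ee_def)

lemma ee_nonzero [simp]: "ee t \<noteq> 0" by (simp add: ee_def)

lemma ee_minus: "ee (- t) = inverse (ee t)"
  by (simp add: ee_def cis_inverse)

lemma ee_diff: "ee (s - t) = ee s / ee t"
  using ee_add[of s "-t"] by (simp add: ee_minus divide_inverse)

lemma continuous_on_ee [continuous_intros]: "continuous_on S f \<Longrightarrow> continuous_on S (\<lambda>x. ee (f x))"
  unfolding ee_def by (intro continuous_intros)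

lemma borel_measurable_ee [measurable (raw)]:
  assumes [measurable]: "f \<in> borel_measurable M"
  shows "(\<lambda>x. ee (f x)) \<in> borel_measurable M"
  unfolding ee_def cis_conv_exp by measurable

lemma ee_eq_1_iff: "ee t = 1 \<longleftrightarrow> t \<in> \<int>"
proof -
  have "ee t = 1 \<longleftrightarrow> exp (\<i> * of_real (2 * pi * t)) = 1" by (simp add: ee_def cis_conv_exp)
  also have "\<dots> \<longleftrightarrow> (\<exists>n::int. t = of_int n)"
    by (subst exp_eq_1) (auto simp: mult_ac)
  finally show ?thesis by (auto simp: Ints_def)
qed

text \<open>The antiderivative in t of \<open>ee (t * y)\<close> that vanishes at t = 0.\<close>

definition ee_prim :: "real \<Rightarrow> real \<Rightarrow> complex" where
  "ee_prim t y = (if y = 0 then of_real t else (ee (t * y) - 1) / (2 * pi * \<i> * y))"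

lemma ee_prim_deriv: "((\<lambda>t. ee_prim t y) has_vector_derivative ee (t * y)) (at t)"
proof (cases "y = 0")
  case True
  then show ?thesis unfolding ee_prim_def
    by (auto intro!: derivative_eq_intros simp: has_vector_derivative_def bounded_linear_of_real scaleR_conv_of_real intro: has_derivative_of_real)
next
  case False
  have "((\<lambda>z. exp (2 * pi * \<i> * y * z)) has_field_derivative 2 * pi * \<i> * y * exp (2 * pi * \<i> * y * of_real t)) (at (of_real t))"
    by (auto intro!: derivative_eq_intros)
  then have "((\<lambda>t. exp (2 * pi * \<i> * y * of_real t)) has_vector_derivative 2 * pi * \<i> * y * exp (2 * pi * \<i> * y * of_real t)) (at t)"
    by (rule has_vector_derivative_real_field)
  moreover have "exp (2 * pi * \<i> * y * of_real t) = ee (t * y)" for t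
    by (simp add: ee_def cis_conv_exp mult_ac)
  ultimately have "((\<lambda>t. ee (t * y)) has_vector_derivative 2 * pi * \<i> * y * ee (t * y)) (at t)" by simp
  then have "((\<lambda>t. (ee (t * y) - 1) / (2 * pi * \<i> * y)) has_vector_derivative (2 * pi * \<i> * y * ee (t * y) - 0) / (2 * pi * \<i> * y)) (at t)"
    by (intro has_vector_derivative_divide has_vector_derivative_diff has_vector_derivative_const)
  then show ?thesis using False by (simp add: ee_prim_def)
qed

text \<open>The sum of \<open>ee (n * y)\<close> over \<open>-N \<le> n < N\<close> minus the integral of \<open>ee (t * y)\<close> over \<open>-N \<le> t \<le> N\<close> equals
  \<open>cot_kernel y * (ee (N * y) - ee (- N * y))\<close>. For \<open>y\<close> bounded away from \<open>\<plusminus>1\<close> the kernel is bounded.\<close>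

definition cot_kernel :: "real \<Rightarrow> complex" where
  "cot_kernel y = (if y = 0 then 0 else 1 / (ee y - 1) - 1 / (2 * pi * \<i> * y))"

lemma geometric_ee:
  assumes "y \<noteq> 0" "\<bar>y\<bar> < 1"
  shows "(\<Sum>n<N. ee (real n * y)) = (ee (real N * y) - 1) / (ee y - 1)"
proof -
  have "ee y \<noteq> 1"
  proof
    assume "ee y = 1"
    then have "y \<in> \<int>" by (simp add: ee_eq_1_iff)
    then obtain k where "y = of_int k" by (auto elim: Ints_cases)
    then show False using assms by auto
  qed
  moreover have "ee (real n * y) = ee y ^ n" for n
    by (induction n) (auto simp: ee_add distrib_right)
  ultimately show ?thesis by (simp add: geometric_sum)
qed

lemma ee_has_vector_derivative: "(ee has_vector_derivative 2 * pi * \<i> * ee t) (at t)"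
proof -
  have "((\<lambda>z. exp (2 * pi * \<i> * z)) has_field_derivative 2 * pi * \<i> * exp (2 * pi * \<i> * of_real t)) (at (of_real t))"
    by (auto intro!: derivative_eq_intros)
  then have "((\<lambda>t. exp (2 * pi * \<i> * of_real t)) has_vector_derivative 2 * pi * \<i> * exp (2 * pi * \<i> * of_real t)) (at t)"
    by (rule has_vector_derivative_real_field)
  moreover have "(\<lambda>t. exp (2 * pi * \<i> * of_real t)) = ee"
    by (auto simp: ee_def cis_conv_exp mult_ac fun_eq_iff)
  ultimately show ?thesis by (metis (no_types))
qed

lemma norm_ee_minus_1: "norm (ee y - 1) \<le> 2 * pi * \<bar>y\<bar>"
proof -
  have "norm (ee y - ee 0) \<le> (2 * pi) * norm (y - 0)"
  proof (rule differentiable_bound[of UNIV])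
    show "(ee has_derivative (\<lambda>h. h *\<^sub>R (2 * pi * \<i> * ee x))) (at x within UNIV)" for x
      using ee_has_vector_derivative[of x] by (simp add: has_vector_derivative_def)
    show "onorm (\<lambda>h. h *\<^sub>R (2 * pi * \<i> * ee x)) \<le> 2 * pi" for x
      by (intro onorm_bound) (auto simp: norm_mult)
  qed auto
  then show ?thesis by simp
qed

lemma norm_ee_minus_linear: "norm (ee y - 1 - 2 * pi * \<i> * y) \<le> 4 * pi\<^sup>2 * y\<^sup>2"
proof -
  let ?f = "\<lambda>t. ee t - 2 * pi * \<i> * of_real t"
  have "norm (?f y - ?f 0) \<le> (4 * pi\<^sup>2 * \<bar>y\<bar>) * norm (y - 0)"
  proof (rule differentiable_bound[of "{-\<bar>y\<bar>..\<bar>y\<bar>}" ?f "\<lambda>x h. h *\<^sub>R (2 * pi * \<i> * (ee x - 1))"])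
    show "(?f has_derivative (\<lambda>h. h *\<^sub>R (2 * pi * \<i> * (ee x - 1)))) (at x within {-\<bar>y\<bar>..\<bar>y\<bar>})" for x
    proof -
      have d1: "((\<lambda>t. complex_of_real t) has_vector_derivative 1) (at x)"
        using has_vector_derivative_of_real[OF DERIV_ident[of "at x"]] by simp
      have "(?f has_vector_derivative (2 * pi * \<i> * ee x - 2 * pi * \<i> * 1)) (at x)"
        by (rule has_vector_derivative_diff[OF ee_has_vector_derivative has_vector_derivative_mult_right[OF d1]])
      also have "2 * pi * \<i> * ee x - 2 * pi * \<i> * 1 = 2 * pi * \<i> * (ee x - 1)"
        by (simp only: right_diff_distrib)
      finally have "(?f has_vector_derivative (2 * pi * \<i> * (ee x - 1))) (at x within {-\<bar>y\<bar>..\<bar>y\<bar>})"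
        by (rule has_vector_derivative_at_within)
      then show ?thesis by (simp add: has_vector_derivative_def)
    qed
    show "onorm (\<lambda>h. h *\<^sub>R (2 * pi * \<i> * (ee x - 1))) \<le> 4 * pi\<^sup>2 * \<bar>y\<bar>" if "x \<in> {-\<bar>y\<bar>..\<bar>y\<bar>}" for x
    proof (intro onorm_bound)
      have "norm (ee x - 1) \<le> 2 * pi * \<bar>y\<bar>"
        using norm_ee_minus_1[of x] that by (auto intro!: order_trans[OF norm_ee_minus_1])
      then have "2 * pi * norm (ee x - 1) \<le> 2 * pi * (2 * pi * \<bar>y\<bar>)" by (intro mult_left_mono) auto
      moreover have "norm (2 * pi * \<i> * (ee x - 1)) = 2 * pi * norm (ee x - 1)"
        by (subst norm_mult) (simp add: norm_mult)
      moreover have "2 * pi * (2 * pi * \<bar>y\<bar>) = 4 * pi\<^sup>2 * \<bar>y\<bar>" by (simp add: power2_eq_square)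
      ultimately have "norm (2 * pi * \<i> * (ee x - 1)) \<le> 4 * pi\<^sup>2 * \<bar>y\<bar>" by linarith
      then show "norm (h *\<^sub>R (2 * pi * \<i> * (ee x - 1))) \<le> 4 * pi\<^sup>2 * \<bar>y\<bar> * norm h" for h
        by (simp add: mult.commute mult_left_mono del: norm_mult)
    qed auto
  qed auto
  then show ?thesis by (simp add: power2_eq_square algebra_simps)
qed

text \<open>At 0 the simple poles of the two terms cancel, by the second-order estimate of
  \<open>ee\<close>. Away from 0 compactness suffices, since the next zeros of
  \<open>ee y - 1\<close> are at 1 and -1.\<close>

lemma cot_kernel_bounded:
  assumes "0 < \<delta>" "\<delta> < 1"
  obtains B where "B > 0" "\<And>y. \<bar>y\<bar> \<le> 1 - \<delta> \<Longrightarrow> norm (cot_kernel y) \<le> B"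
proof -
  \<comment> \<open>For |y| below 1 / (4 pi) the quadratic remainder 4 pi^2 y^2 is at most half of
    the linear term 2 pi |y|.\<close>
  define \<epsilon> where "\<epsilon> = 1 / (4 * pi)"
  have e: "\<epsilon> > 0" unfolding \<epsilon>_def by simp
  define S where "S = {y. \<epsilon> \<le> \<bar>y\<bar> \<and> \<bar>y\<bar> \<le> 1 - \<delta>}"
  have "S = {-(1-\<delta>)..1-\<delta>} \<inter> ({..-\<epsilon>} \<union> {\<epsilon>..})" unfolding S_def using e by auto
  then have "compact S" by (auto intro!: compact_Int_closed)
  have "ee y \<noteq> 1" if "y \<in> S" for y
  proof
    assume "ee y = 1"
    then have "y \<in> \<int>" by (simp add: ee_eq_1_iff)
    then obtain k where "y = of_int k" by (auto elim: Ints_cases)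
    then have "0 < real_of_int \<bar>k\<bar>" "real_of_int \<bar>k\<bar> < 1" using that e assms unfolding S_def by auto
    then show False unfolding of_int_less_1_iff of_int_0_less_iff by linarith
  qed
  then have "continuous_on S (\<lambda>y. 1 / (ee y - 1))"
    by (intro continuous_intros) auto
  then have "compact ((\<lambda>y. 1 / (ee y - 1)) ` S)" using \<open>compact S\<close> by (rule compact_continuous_image)
  then have "bounded ((\<lambda>y. 1 / (ee y - 1)) ` S)" by (rule compact_imp_bounded)
  then obtain D where "\<forall>z\<in>(\<lambda>y. 1 / (ee y - 1)) ` S. norm z \<le> D" unfolding bounded_iff by blast
  then have D: "\<And>y. y \<in> S \<Longrightarrow> norm (1 / (ee y - 1)) \<le> D" by blast
  show thesis
  proof (rule that)
    show "max D 0 + 4 > 0" by simp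
    fix y :: real assume y: "\<bar>y\<bar> \<le> 1 - \<delta>"
    show "norm (cot_kernel y) \<le> max D 0 + 4"
    proof (cases "y = 0")
      case False
      show ?thesis
      proof (cases "\<bar>y\<bar> \<ge> \<epsilon>")
        case True
        then have "norm (1 / (ee y - 1)) \<le> D" using D y unfolding S_def by auto
        moreover have "norm (1 / (2 * pi * \<i> * y)) \<le> 4"
        proof -
          have "norm (1 / (2 * pi * \<i> * y)) = 1 / (2 * pi * \<bar>y\<bar>)" by (simp add: norm_mult norm_divide)
          also have "\<dots> \<le> 1 / (2 * pi * \<epsilon>)" using True e by (intro divide_left_mono mult_left_mono mult_pos_pos) auto
          also have "\<dots> \<le> 4" unfolding \<epsilon>_def by simp
          finally show ?thesis .
        qed
        ultimately show ?thesis unfolding cot_kernel_def using False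
          norm_triangle_ineq4[of "1 / (ee y - 1)" "1 / (2 * pi * \<i> * y)"] by simp
      next
        case small: False
        have yp: "\<bar>y\<bar> > 0" using False by simp
        have "2 * pi * \<bar>y\<bar> = norm (2 * pi * \<i> * y)" by (simp add: norm_mult)
        also have "\<dots> \<le> norm (ee y - 1) + norm (ee y - 1 - 2 * pi * \<i> * y)"
          using norm_triangle_ineq4[of "ee y - 1" "ee y - 1 - 2 * pi * \<i> * y"] by simp
        also have "\<dots> \<le> norm (ee y - 1) + 4 * pi\<^sup>2 * y\<^sup>2" using norm_ee_minus_linear by simp
        also have "4 * pi\<^sup>2 * y\<^sup>2 = (4 * pi * \<bar>y\<bar>) * (pi * \<bar>y\<bar>)" by (simp add: power2_eq_square abs_mult_self)
        also have "\<dots> \<le> 1 * (pi * \<bar>y\<bar>)" using small unfolding \<epsilon>_def by (intro mult_right_mono) (auto simp: field_simps)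
        finally have l: "pi * \<bar>y\<bar> \<le> norm (ee y - 1)" by simp
        have "0 < pi * \<bar>y\<bar>" using yp by (intro mult_pos_pos) auto
        then have nz: "ee y - 1 \<noteq> 0" using l by (metis less_le_not_le norm_zero)
        have "cot_kernel y = (2 * pi * \<i> * y - (ee y - 1)) / ((ee y - 1) * (2 * pi * \<i> * y))"
          unfolding cot_kernel_def using False nz by (simp add: diff_frac_eq)
        then have "norm (cot_kernel y) = norm (ee y - 1 - 2 * pi * \<i> * y) / (norm (ee y - 1) * (2 * pi * \<bar>y\<bar>))"
          by (simp add: norm_divide norm_mult norm_minus_commute)
        also have "\<dots> \<le> 4 * pi\<^sup>2 * y\<^sup>2 / ((pi * \<bar>y\<bar>) * (2 * pi * \<bar>y\<bar>))"
          using l yp by (intro frac_le norm_ee_minus_linear mult_right_mono mult_pos_pos) auto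
        also have "\<dots> = 2" using yp by (simp add: power2_eq_square abs_mult_self)
        finally show ?thesis by simp
      qed
    qed (simp add: cot_kernel_def)
  qed
qed

lemma borel_measurable_cot_kernel [measurable]: "cot_kernel \<in> borel_measurable borel"
  unfolding cot_kernel_def[abs_def] by measurable

text \<open>Averages over the windows from K to 2 K - 1 inherit the limit of a convergent sequence.
  In \<open>poisson_1d\<close> convergence is known beforehand, and only the value of the limit has
  to be identified.\<close>

lemma lim_zero_of_averages:
  fixes T :: "nat \<Rightarrow> complex"
  assumes T: "T \<longlonglongrightarrow> L" and A: "(\<lambda>K. (\<Sum>i<K. T (K + i)) / of_nat K) \<longlonglongrightarrow> 0"
  shows "L = 0"
proof -
  have "(\<lambda>K. (\<Sum>i<K. T (K + i)) / of_nat K) \<longlonglongrightarrow> L"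
  proof (rule metric_LIMSEQ_I)
    fix r :: real assume r: "r > 0"
    obtain N where N: "\<And>n. n \<ge> N \<Longrightarrow> norm (T n - L) < r / 2"
      using metric_LIMSEQ_D[OF T, of "r / 2"] r unfolding dist_norm by auto
    show "\<exists>no. \<forall>n\<ge>no. dist ((\<Sum>i<n. T (n + i)) / of_nat n) L < r"
    proof (intro exI allI impI)
      fix n assume n: "n \<ge> max N 1"
      have "(\<Sum>i<n. T (n + i)) / of_nat n - L = (\<Sum>i<n. T (n + i) - L) / of_nat n"
        using n by (simp add: sum_subtractf field_simps)
      also have "norm \<dots> = norm (\<Sum>i<n. T (n + i) - L) / real n" by (simp add: norm_divide)
      also have "\<dots> \<le> (real n * (r / 2)) / real n"
        using n N by (intro divide_right_mono order_trans[OF norm_sum] order_trans[OF sum_bounded_above[where K="r/2"]]) (auto intro: less_imp_le)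
      also have "\<dots> < r" using r n by simp
      finally show "dist ((\<Sum>i<n. T (n + i)) / of_nat n) L < r" by (simp add: dist_norm)
    qed
  qed
  with A show ?thesis using LIMSEQ_unique by blast
qed

lemma integrable_inverse_square_lborel: "integrable lborel (\<lambda>t::real. 1 / (1 + t\<^sup>2))"
  using integrable_inverse_1_plus_square by (simp add: set_integrable_def inverse_eq_divide)

lemma Ints_eq_nat_union: "(\<int> :: real set) = range real \<union> (\<lambda>n. - real n) ` UNIV"
proof -
  have "of_int k \<in> range real \<union> range (\<lambda>n. - real n)" for k :: int
    by (cases k rule: int_cases2) auto
  then show ?thesis by (auto elim!: Ints_cases)
qed

lemma integrable_inverse_square_Ints: "integrable (count_space \<int>) (\<lambda>t::real. 1 / (1 + t\<^sup>2))"
proof -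
  have "summable (\<lambda>n. 1 / (1 + (real n)\<^sup>2))"
  proof (rule summable_comparison_test_bigo)
    show "summable (\<lambda>n. norm (1 / real n ^ 2))"
      using inverse_power_summable[of 2] by (simp add: inverse_eq_divide)
    show "(\<lambda>n. 1 / (1 + (real n)\<^sup>2)) \<in> O(\<lambda>n. 1 / real n ^ 2)" by real_asymp
  qed
  then have "Infinite_Set_Sum.abs_summable_on (\<lambda>n. 1 / (1 + (real n)\<^sup>2)) UNIV"
    by (subst abs_summable_on_nat_iff') (simp add: abs_of_pos add_pos_nonneg)
  then have "Infinite_Set_Sum.abs_summable_on (\<lambda>t::real. 1 / (1 + t\<^sup>2)) (range real)"
      "Infinite_Set_Sum.abs_summable_on (\<lambda>t::real. 1 / (1 + t\<^sup>2)) (range (\<lambda>n. - real n))"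
    by (auto intro!: abs_summable_on_reindex)
  then have "Infinite_Set_Sum.abs_summable_on (\<lambda>t::real. 1 / (1 + t\<^sup>2)) \<int>"
    unfolding Ints_eq_nat_union by (rule abs_summable_on_union)
  then show ?thesis by (simp add: Infinite_Set_Sum.abs_summable_on_def)
qed

text \<open>The frequencies \<open>y x\<close> may carry an arbitrary measure, so the oscillating remainder need not tend to 0
  by itself; its averages over \<open>N\<close> in \<open>{K..<2 * K}\<close> do.\<close>

lemma poisson_1d:
  fixes c :: "'x \<Rightarrow> complex" and y :: "'x \<Rightarrow> real"
  assumes c: "integrable M c" and y[measurable]: "y \<in> borel_measurable M"
    and \<delta>: "0 < \<delta>" "\<delta> < 1" and yb: "\<And>x. x \<in> space M \<Longrightarrow> \<bar>y x\<bar> \<le> 1 - \<delta>"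
    and G: "\<And>t. G t = (LINT x|M. c x * ee (t * y x))"
    and Gb: "\<And>t. norm (G t) \<le> C / (1 + t\<^sup>2)"
  shows "(LINT t|lborel. G t) = (LINT t|count_space \<int>. G t)"
proof -
  have [measurable]: "c \<in> borel_measurable M" using c by simp
  define A where "A t = (LINT x|M. c x * ee_prim t (y x))" for t
  have mprim [measurable]: "(\<lambda>x. ee_prim t (y x)) \<in> borel_measurable M" for t
    unfolding ee_prim_def by measurable
  have ee_prim_b: "norm (ee_prim t s) \<le> \<bar>t\<bar>" for t s
  proof (cases "s = 0")
    case False
    have "norm (ee_prim t s) = norm (ee (t * s) - 1) / (2 * pi * \<bar>s\<bar>)" using False by (simp add: ee_prim_def norm_divide norm_mult)
    also have "\<dots> \<le> (2 * pi * \<bar>t * s\<bar>) / (2 * pi * \<bar>s\<bar>)" by (intro divide_right_mono norm_ee_minus_1) auto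
    also have "\<dots> = \<bar>t\<bar>" using False by (simp add: abs_mult)
    finally show ?thesis .
  qed (simp add: ee_prim_def)
  have iprim: "integrable M (\<lambda>x. c x * ee_prim t (y x))" for t
    by (rule integrable_norm_le[of M "\<lambda>x. norm (c x) * \<bar>t\<bar>"]) (use c ee_prim_b in \<open>auto simp: norm_mult intro!: mult_left_mono\<close>)
  have ice: "integrable M (\<lambda>x. c x * ee (t * y x))" for t
    by (rule integrable_norm_le[of M "\<lambda>x. norm (c x)"]) (use c in \<open>auto simp: norm_mult\<close>)
  have Ad: "(A has_vector_derivative G t) (at t)" for t
    unfolding A_def G
    by (rule has_vector_derivative_LINT[where g="\<lambda>x. norm (c x)"])
       (use c iprim in \<open>auto simp: norm_mult intro!: has_vector_derivative_mult_right ee_prim_deriv\<close>)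
  have contG: "continuous_on UNIV G"
  proof -
    have "continuous (at t) G" for t
      unfolding continuous_at_sequentially
    proof (intro allI impI, unfold comp_def G)
      fix X :: "nat \<Rightarrow> real" assume X: "X \<longlonglongrightarrow> t"
      show "(\<lambda>n. LINT x|M. c x * ee (X n * y x)) \<longlonglongrightarrow> (LINT x|M. c x * ee (t * y x))"
      proof (rule integral_dominated_convergence[where w="\<lambda>x. norm (c x)"])
        show "AE x in M. (\<lambda>i. c x * ee (X i * y x)) \<longlonglongrightarrow> c x * ee (t * y x)"
          using X unfolding ee_def by (intro AE_I2 tendsto_intros)
      qed (use c in \<open>auto simp: norm_mult\<close>)
    qed
    then show ?thesis by (simp add: continuous_at_imp_continuous_on)
  qed
  then have [measurable]: "G \<in> borel_measurable borel" by (rule borel_measurable_continuous_onI)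
  have iGl: "integrable lborel G"
    by (rule integrable_norm_le[of lborel "\<lambda>t. C / (1 + t\<^sup>2)"])
       (use Gb integrable_mult_right[OF integrable_inverse_square_lborel, of C] in auto)
  have iGc: "integrable (count_space \<int>) G"
    by (rule integrable_norm_le[of _ "\<lambda>t. C / (1 + t\<^sup>2)"])
       (use Gb integrable_mult_right[OF integrable_inverse_square_Ints, of C] in auto)
  define I where "I N = (LINT t|lborel. indicator {-real N..real N} t *\<^sub>R G t)" for N :: nat
  \<comment> \<open>With the half-open range -N <= n < N the sum is one geometric sum of 2 N terms,
    equal to (ee (N y) - ee (-N y)) / (ee y - 1) without any boundary term.\<close>
  define S where "S N = (\<Sum>n<2*N. G (real n - real N))" for N :: nat
  define T where "T N = (LINT x|M. c x * cot_kernel (y x) * (ee (real N * y x) - ee (- (real N * y x))))" for N :: nat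
  have limI: "I \<longlonglongrightarrow> (LINT t|lborel. G t)"
    unfolding I_def
  proof (rule integral_dominated_convergence[where w="\<lambda>t. norm (G t)"])
    show "AE t in lborel. (\<lambda>N. indicator {- real N..real N} t *\<^sub>R G t) \<longlonglongrightarrow> G t"
    proof (rule AE_I2)
      fix t :: real
      have "\<forall>\<^sub>F N in sequentially. \<bar>t\<bar> \<le> real N" by real_asymp
      then have "\<forall>\<^sub>F N in sequentially. indicator {- real N..real N} t *\<^sub>R G t = G t"
        by eventually_elim (auto simp: indicator_def)
      then show "(\<lambda>N. indicator {- real N..real N} t *\<^sub>R G t) \<longlonglongrightarrow> G t" by (rule tendsto_eventually)
    qed
  qed (use iGl in \<open>auto simp: indicator_def\<close>)
  have S_alt: "S N = (LINT t|count_space \<int>. indicator {-real N..<real N} t *\<^sub>R G t)" for N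
  proof -
    let ?F = "(\<lambda>n. real n - real N) ` {..<2*N}"
    have sub: "{t \<in> \<int>. t \<in> {-real N..<real N}} \<subseteq> ?F"
    proof
      fix t assume t: "t \<in> {t \<in> \<int>. t \<in> {-real N..<real N}}"
      then obtain k where k: "t = of_int k" by (auto elim: Ints_cases)
      then have "- int N \<le> k" "k < int N" using t by auto
      then show "t \<in> ?F" using k by (intro image_eqI[of _ _ "nat (k + int N)"]) auto
    qed
    have fin: "finite {t \<in> \<int>. indicator {-real N..<real N} t *\<^sub>R G t \<noteq> 0}"
      by (rule finite_subset[of _ ?F]) (use sub in \<open>auto simp: indicator_def\<close>)
    have "S N = (\<Sum>t\<in>?F. G t)"
      unfolding S_def by (subst sum.reindex) (auto simp: inj_on_def)
    also have "\<dots> = (\<Sum>t\<in>?F. indicator {-real N..<real N} t *\<^sub>R G t)"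
      by (intro sum.cong) auto
    also have "\<dots> = (\<Sum>t | t \<in> \<int> \<and> indicator {-real N..<real N} t *\<^sub>R G t \<noteq> 0. indicator {-real N..<real N} t *\<^sub>R G t)"
      by (rule sum.mono_neutral_right) (use sub in \<open>auto simp: indicator_def\<close>)
    also have "\<dots> = (LINT t|count_space \<int>. indicator {-real N..<real N} t *\<^sub>R G t)"
      using fin by (rule lebesgue_integral_count_space_finite_support[symmetric])
    finally show ?thesis .
  qed
  have limS: "S \<longlonglongrightarrow> (LINT t|count_space \<int>. G t)"
    unfolding S_alt[abs_def]
  proof (rule integral_dominated_convergence[where w="\<lambda>t. norm (G t)"])
    show "AE t in count_space \<int>. (\<lambda>N. indicator {- real N..<real N} t *\<^sub>R G t) \<longlonglongrightarrow> G t"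
    proof (rule AE_I2)
      fix t :: real
      have "\<forall>\<^sub>F N in sequentially. \<bar>t\<bar> < real N" by real_asymp
      then have "\<forall>\<^sub>F N in sequentially. indicator {- real N..<real N} t *\<^sub>R G t = G t"
        by eventually_elim (auto simp: indicator_def)
      then show "(\<lambda>N. indicator {- real N..<real N} t *\<^sub>R G t) \<longlonglongrightarrow> G t" by (rule tendsto_eventually)
    qed
  qed (use iGc in \<open>auto simp: indicator_def\<close>)
  obtain B where B: "B > 0" "\<And>y. \<bar>y\<bar> \<le> 1 - \<delta> \<Longrightarrow> norm (cot_kernel y) \<le> B" using cot_kernel_bounded[OF \<delta>] by blast
  have I_alt: "I N = A N - A (- real N)" for N
  proof -
    have "(G has_integral A N - A (- real N)) {-real N..real N}"
      by (rule fundamental_theorem_of_calculus) (auto intro: has_vector_derivative_at_within Ad)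
    moreover have "integral {-real N..real N} G = I N"
      unfolding I_def by (rule integral_eq_LINT) (rule continuous_on_subset[OF contG], simp)
    ultimately show ?thesis by (simp add: integral_unique)
  qed
  have ST: "S N - I N = T N" for N
  proof -
    have s: "S N = (LINT x|M. (\<Sum>n<2*N. c x * ee ((real n - real N) * y x)))"
      unfolding S_def G using ice by (subst Bochner_Integration.integral_sum) auto
    have i: "I N = (LINT x|M. c x * ee_prim (real N) (y x) - c x * ee_prim (- real N) (y x))"
      unfolding I_alt A_def using iprim by simp
    have "S N - I N = (LINT x|M. (\<Sum>n<2*N. c x * ee ((real n - real N) * y x)) - (c x * ee_prim (real N) (y x) - c x * ee_prim (- real N) (y x)))"
      unfolding s i using ice iprim
      by (intro Bochner_Integration.integral_diff[symmetric] Bochner_Integration.integrable_sum Bochner_Integration.integrable_diff) auto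
    also have "\<dots> = T N"
      unfolding T_def
    proof (rule Bochner_Integration.integral_cong[OF refl])
      fix x assume x: "x \<in> space M"
      show "(\<Sum>n<2*N. c x * ee ((real n - real N) * y x)) - (c x * ee_prim (real N) (y x) - c x * ee_prim (- real N) (y x))
         = c x * cot_kernel (y x) * (ee (real N * y x) - ee (- (real N * y x)))"
      proof (cases "y x = 0")
        case True
        then show ?thesis by (simp add: ee_prim_def cot_kernel_def)
      next
        case False
        have "(\<Sum>n<2*N. c x * ee ((real n - real N) * y x)) = c x * (ee (- (real N * y x)) * (\<Sum>n<2*N. ee (real n * y x)))"
          by (simp add: sum_distrib_left ee_add[symmetric] algebra_simps)
        also have "(\<Sum>n<2*N. ee (real n * y x)) = (ee (real (2*N) * y x) - 1) / (ee (y x) - 1)"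
          using False yb[OF x] \<delta> by (intro geometric_ee) auto
        also have "ee (- (real N * y x)) * ((ee (real (2*N) * y x) - 1) / (ee (y x) - 1)) = (ee (real N * y x) - ee (- (real N * y x))) / (ee (y x) - 1)"
        proof -
          have "real (2*N) * y x = real N * y x + real N * y x" by simp
          then show ?thesis by (simp only: ee_add) (simp add: ee_minus field_simps)
        qed
        finally have 1: "(\<Sum>n<2*N. c x * ee ((real n - real N) * y x)) = c x * ((ee (real N * y x) - ee (- (real N * y x))) / (ee (y x) - 1))" .
        have 2: "ee_prim (real N) (y x) - ee_prim (- real N) (y x) = (ee (real N * y x) - ee (- (real N * y x))) / (2 * pi * \<i> * y x)"
          using False by (simp add: ee_prim_def diff_divide_distrib)
        have "c x * ee_prim (real N) (y x) - c x * ee_prim (- real N) (y x) = c x * ((ee (real N * y x) - ee (- (real N * y x))) / (2 * pi * \<i> * y x))"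
          unfolding 2[symmetric] by (simp add: algebra_simps)
        moreover have "u * (E / d) - u * (E / w) = u * (1 / d - 1 / w) * E" for u E d w :: complex
          by (simp add: algebra_simps)
        ultimately show ?thesis unfolding 1 cot_kernel_def using False by simp
      qed
    qed
    finally show ?thesis .
  qed
  \<comment> \<open>That T converges follows from the decay of G; what remains is to show that its
    limit is 0.\<close>
  have limT: "T \<longlonglongrightarrow> (LINT t|count_space \<int>. G t) - (LINT t|lborel. G t)"
    using tendsto_diff[OF limS limI] unfolding ST .
  have pqc: "norm (c x * cot_kernel (y x)) \<le> norm (c x) * B" if "x \<in> space M" for x
    using B(2)[OF yb[OF that]] by (auto simp: norm_mult intro!: mult_left_mono)
  have "(\<lambda>K. (\<Sum>i<K. T (K + i)) / of_nat K) \<longlonglongrightarrow> (LINT x|M. 0)"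
  proof -
    let ?h = "\<lambda>N x. ee (real N * y x) - ee (- (real N * y x))"
    have iT: "integrable M (\<lambda>x. c x * cot_kernel (y x) * ?h N x)" for N
    proof (rule integrable_norm_le[of M "\<lambda>x. norm (c x) * B * 2"])
      fix x assume "x \<in> space M"
      moreover have "norm (?h N x) \<le> 2" by (rule order_trans[OF norm_triangle_ineq4]) simp
      ultimately show "norm (c x * cot_kernel (y x) * ?h N x) \<le> norm (c x) * B * 2"
        unfolding norm_mult[of _ "?h N x"] using pqc B(1) by (intro mult_mono) auto
    qed (use c in auto)
    have eq: "(\<Sum>i<K. T (K + i)) / of_nat K = (LINT x|M. c x * cot_kernel (y x) * ((\<Sum>i<K. ?h (K + i) x) / of_nat K))" for K
    proof -
      have "(\<Sum>i<K. T (K + i)) = (LINT x|M. (\<Sum>i<K. c x * cot_kernel (y x) * ?h (K + i) x))"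
        unfolding T_def using iT by (intro Bochner_Integration.integral_sum[symmetric])
      then have "(\<Sum>i<K. T (K + i)) / of_nat K = (LINT x|M. (\<Sum>i<K. c x * cot_kernel (y x) * ?h (K + i) x) / of_nat K)"
        by simp
      then show ?thesis by (simp only: sum_distrib_left[symmetric] times_divide_eq_right)
    qed
    show ?thesis unfolding eq
    proof (rule integral_dominated_convergence[where w="\<lambda>x. norm (c x) * B * 2"])
      show "AE x in M. norm (c x * cot_kernel (y x) * ((\<Sum>i<K. ?h (K + i) x) / of_nat K)) \<le> norm (c x) * B * 2" for K
      proof (rule AE_I2)
        fix x assume x: "x \<in> space M"
        have "norm (?h N x) \<le> 2" for N by (rule order_trans[OF norm_triangle_ineq4]) simp
        then have "norm (\<Sum>i<K. ?h (K + i) x) \<le> real K * 2"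
          by (intro order_trans[OF norm_sum] order_trans[OF sum_bounded_above[where K=2]]) (auto simp del: of_nat_add)
        then have "norm ((\<Sum>i<K. ?h (K + i) x) / of_nat K) \<le> 2"
          by (cases "K = 0") (auto simp: norm_divide field_simps)
        then show "norm (c x * cot_kernel (y x) * ((\<Sum>i<K. ?h (K + i) x) / of_nat K)) \<le> norm (c x) * B * 2"
          unfolding norm_mult[of _ "(\<Sum>i<K. ?h (K + i) x) / of_nat K"] using pqc[OF x] B(1) by (intro mult_mono) auto
      qed
      show "AE x in M. (\<lambda>K. c x * cot_kernel (y x) * ((\<Sum>i<K. ?h (K + i) x) / of_nat K)) \<longlonglongrightarrow> 0"
      proof (rule AE_I2)
        fix x assume x: "x \<in> space M"
        show "(\<lambda>K. c x * cot_kernel (y x) * ((\<Sum>i<K. ?h (K + i) x) / of_nat K)) \<longlonglongrightarrow> 0"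
        proof (cases "y x = 0")
          case False
          have y1: "\<bar>y x\<bar> < 1" "\<bar>- y x\<bar> < 1" using yb[OF x] \<delta> by auto
          \<comment> \<open>For a fixed nonzero frequency these geometric sums are bounded uniformly
            in K, and division by K sends them to 0. The bound may degenerate as the frequency tends
            to 0, since dominated convergence asks only for pointwise limits.\<close>
          have g: "norm (\<Sum>i<K. ee (real (K + i) * s)) \<le> 2 / norm (ee s - 1)" if "s \<noteq> 0" "\<bar>s\<bar> < 1" for s K
          proof -
            have "(\<Sum>i<K. ee (real (K + i) * s)) = ee (real K * s) * (\<Sum>i<K. ee (real i * s))"
              by (simp add: sum_distrib_left ee_add distrib_right)
            also have "norm \<dots> = norm (ee (real K * s) - 1) / norm (ee s - 1)"
              using that by (simp add: geometric_ee norm_mult norm_divide)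
            also have "\<dots> \<le> 2 / norm (ee s - 1)"
              by (intro divide_right_mono order_trans[OF norm_triangle_ineq4]) auto
            finally show ?thesis .
          qed
          define D where "D = 2 / norm (ee (y x) - 1) + 2 / norm (ee (- y x) - 1)"
          have "norm (\<Sum>i<K. ?h (K + i) x) \<le> D" for K
          proof -
            have "(\<Sum>i<K. ?h (K + i) x) = (\<Sum>i<K. ee (real (K + i) * y x)) - (\<Sum>i<K. ee (real (K + i) * (- y x)))"
              by (simp add: sum_subtractf)
            also have "norm \<dots> \<le> D" unfolding D_def
              using False y1 by (intro order_trans[OF norm_triangle_ineq4] add_mono g) auto
            finally show ?thesis .
          qed
          then have b: "norm ((\<Sum>i<K. ?h (K + i) x) / of_nat K) \<le> D / real K" for K
            by (simp add: norm_divide divide_right_mono)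
          have "(\<lambda>K. D / real K) \<longlonglongrightarrow> 0" by real_asymp
          then have "(\<lambda>K. (\<Sum>i<K. ?h (K + i) x) / of_nat K) \<longlonglongrightarrow> 0"
            by (rule Lim_null_comparison[rotated]) (use b in auto)
          then show ?thesis by (rule tendsto_mult_right_zero)
        qed (simp add: cot_kernel_def)
      qed
    qed (use c in auto)
  qed
  then have "(LINT t|count_space \<int>. G t) - (LINT t|lborel. G t) = 0"
    using lim_zero_of_averages[OF limT] by simp
  then show ?thesis by simp
qed

section \<open>Poisson summation in several variables\<close>

definition int_lattice :: "'a::euclidean_space set" where
  "int_lattice = {x. \<forall>b\<in>Basis. x \<bullet> b \<in> \<int>}"

definition vec_of :: "('a \<Rightarrow> real) \<Rightarrow> 'a::euclidean_space" where
  "vec_of f = (\<Sum>b\<in>Basis. f b *\<^sub>R b)"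

lemma vec_of_inner [simp]: "b \<in> Basis \<Longrightarrow> vec_of f \<bullet> b = f b"
  unfolding vec_of_def by simp

lemma vec_of_upd: "b \<in> Basis \<Longrightarrow> vec_of (g(b := t)) = vec_of (g(b := 0)) + t *\<^sub>R b"
  by (rule euclidean_eqI) (auto simp: inner_add_left inner_Basis)

text \<open>The exponent \<open>2 * DIM('a)\<close> puts the weight below the product of the 1 / (1
  + x_b^2) over all coordinates. That product is integrable whichever coordinates are summed and
  whichever are integrated.\<close>

definition wt :: "'a::euclidean_space \<Rightarrow> real" where
  "wt x = inverse ((1 + norm x) ^ (2 * DIM('a)))"

lemma wt_nonneg [simp]: "wt x \<ge> 0"
  by (simp add: wt_def)

lemma borel_measurable_wt [measurable]: "wt \<in> borel_measurable borel"
  unfolding wt_def[abs_def] by measurable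

lemma wt_le: "wt x \<le> (\<Prod>b\<in>Basis. 1 / (1 + (x \<bullet> b)\<^sup>2))"
proof -
  have "(\<Prod>b\<in>Basis. (1 + (x \<bullet> b)\<^sup>2)) \<le> (\<Prod>b\<in>(Basis :: 'a set). (1 + norm x)\<^sup>2)"
  proof (rule prod_mono, intro conjI)
    fix b :: 'a assume "b \<in> Basis"
    then have "\<bar>x \<bullet> b\<bar> \<le> norm x" by (rule Basis_le_norm)
    then have "(x \<bullet> b)\<^sup>2 \<le> (norm x)\<^sup>2" by (simp add: abs_le_square_iff[symmetric])
    moreover have "(1 + norm x)\<^sup>2 = 1 + (norm x)\<^sup>2 + 2 * norm x" by (simp add: power2_sum)
    ultimately show "1 + (x \<bullet> b)\<^sup>2 \<le> (1 + norm x)\<^sup>2" using norm_ge_zero[of x] by linarith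
  qed (simp add: add_nonneg_nonneg)
  also have "\<dots> = (1 + norm x) ^ (2 * DIM('a))" by (simp add: power_mult)
  finally have "inverse ((1 + norm x) ^ (2 * DIM('a))) \<le> inverse (\<Prod>b\<in>Basis. (1 + (x \<bullet> b)\<^sup>2))"
    by (intro le_imp_inverse_le) (auto intro!: prod_pos add_pos_nonneg)
  also have "\<dots> = (\<Prod>b\<in>Basis. 1 / (1 + (x \<bullet> b)\<^sup>2))"
    by (simp add: divide_inverse prod_inversef[unfolded comp_def])
  finally show ?thesis by (simp add: wt_def)
qed

text \<open>Poisson summation is applied one coordinate at a time: the coordinates in \<open>J\<close> are summed over the
  integers, the others are integrated.\<close>

definition mixed :: "'a set \<Rightarrow> 'a::euclidean_space \<Rightarrow> real measure" where
  "mixed J b = (if b \<in> J then count_space \<int> else lborel)"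

lemma product_sigma_finite_mixed: "product_sigma_finite (mixed J)"
  unfolding product_sigma_finite_def
proof
  fix b
  have "sigma_finite_measure (count_space (\<int> :: real set))"
    by (rule sigma_finite_measure_count_space_countable) (simp add: Ints_def)
  then show "sigma_finite_measure (mixed J b)"
    by (auto simp: mixed_def lborel.sigma_finite_measure_axioms)
qed

lemma measurable_ident_mixed: "(\<lambda>x. x) \<in> mixed J b \<rightarrow>\<^sub>M borel"
  by (auto simp: mixed_def)

lemma measurable_vec_of [measurable]: "vec_of \<in> Pi\<^sub>M Basis (mixed J) \<rightarrow>\<^sub>M borel"
  unfolding vec_of_def[abs_def]
proof (intro borel_measurable_sum borel_measurable_scaleR borel_measurable_const)
  fix b :: 'a assume "b \<in> Basis"
  then show "(\<lambda>f. f b) \<in> borel_measurable (Pi\<^sub>M Basis (mixed J))"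
    using measurable_comp[OF measurable_component_singleton[of b Basis "mixed J"] measurable_ident_mixed[of J b]]
    by (simp add: comp_def)
qed

lemma integrable_mixed_prod: "integrable (Pi\<^sub>M Basis (mixed J)) (\<lambda>f. \<Prod>b\<in>Basis. 1 / (1 + (f b)\<^sup>2))"
proof -
  interpret product_sigma_finite "mixed J" by (rule product_sigma_finite_mixed)
  show ?thesis
    by (rule product_integrable_prod)
       (auto simp: mixed_def integrable_inverse_square_lborel integrable_inverse_square_Ints)
qed

lemma integrable_mixed:
  fixes F :: "'a::euclidean_space \<Rightarrow> 'b::{banach,second_countable_topology}"
  assumes "F \<in> borel_measurable borel" "\<And>x. norm (F x) \<le> C * wt x" "C \<ge> 0"
  shows "integrable (Pi\<^sub>M Basis (mixed J)) (\<lambda>f. F (vec_of f))"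
proof (rule integrable_norm_le)
  show "integrable (Pi\<^sub>M Basis (mixed J)) (\<lambda>f. C * (\<Prod>b\<in>Basis. 1 / (1 + (f b)\<^sup>2)))"
    by (intro integrable_mult_right integrable_mixed_prod)
  show "norm (F (vec_of f)) \<le> C * (\<Prod>b\<in>Basis. 1 / (1 + (f b)\<^sup>2))" for f
  proof -
    have "norm (F (vec_of f)) \<le> C * wt (vec_of f)" by (rule assms)
    also have "\<dots> \<le> C * (\<Prod>b\<in>Basis. 1 / (1 + (vec_of f \<bullet> b)\<^sup>2))"
      by (intro mult_left_mono wt_le assms)
    finally show ?thesis by simp
  qed
qed (use assms(1) in measurable)

lemma mixed_lborel:
  fixes F :: "'a::euclidean_space \<Rightarrow> 'b::{banach,second_countable_topology}"
  assumes "F \<in> borel_measurable borel"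
  shows "(LINT f|Pi\<^sub>M Basis (mixed {}). F (vec_of f)) = (LINT x|lborel. F x)"
    "integrable (Pi\<^sub>M Basis (mixed {})) (\<lambda>f. F (vec_of f)) \<longleftrightarrow> integrable lborel F"
proof -
  have eq: "mixed {} = (\<lambda>_ :: 'a. lborel)" by (auto simp: mixed_def fun_eq_iff)
  show "(LINT f|Pi\<^sub>M Basis (mixed {}). F (vec_of f)) = (LINT x|lborel. F x)"
    unfolding eq vec_of_def by (rule integral_lborel_PiM(1)[OF assms, symmetric])
  show "integrable (Pi\<^sub>M Basis (mixed {})) (\<lambda>f. F (vec_of f)) \<longleftrightarrow> integrable lborel F"
    unfolding eq vec_of_def by (rule integral_lborel_PiM(2)[OF assms, symmetric])
qed

lemma bij_vec_of_int_lattice: "bij_betw vec_of (Pi\<^sub>E Basis (\<lambda>_. \<int>)) (int_lattice :: 'a::euclidean_space set)"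
proof (rule bij_betw_byWitness[where f'="\<lambda>x. restrict (\<lambda>b. x \<bullet> b) Basis"])
  show "\<forall>f\<in>Pi\<^sub>E Basis (\<lambda>_. \<int>). restrict (\<lambda>b. (vec_of f :: 'a) \<bullet> b) Basis = f"
  proof
    fix f :: "'a \<Rightarrow> real" assume "f \<in> Pi\<^sub>E Basis (\<lambda>_. \<int>)"
    then have "f \<in> extensional Basis" by (simp add: PiE_def)
    then show "restrict (\<lambda>b. (vec_of f :: 'a) \<bullet> b) Basis = f"
      by (intro extensionalityI[of _ Basis]) auto
  qed
  show "\<forall>x\<in>int_lattice. vec_of (restrict (\<lambda>b. x \<bullet> b) Basis) = (x :: 'a)"
  proof
    fix x :: 'a
    show "vec_of (restrict (\<lambda>b. x \<bullet> b) Basis) = x"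
      by (rule euclidean_eqI) simp
  qed
  show "vec_of ` Pi\<^sub>E Basis (\<lambda>_. \<int>) \<subseteq> (int_lattice :: 'a set)"
    by (auto simp: int_lattice_def)
  show "(\<lambda>x. restrict (\<lambda>b. x \<bullet> b) Basis) ` (int_lattice :: 'a set) \<subseteq> Pi\<^sub>E Basis (\<lambda>_. \<int>)"
    by (auto simp: int_lattice_def)
qed

lemma mixed_int_lattice:
  fixes F :: "'a::euclidean_space \<Rightarrow> 'b::{banach,second_countable_topology}"
  shows "(LINT f|Pi\<^sub>M Basis (mixed Basis). F (vec_of f)) = (LINT x|count_space int_lattice. F x)"
    "integrable (Pi\<^sub>M Basis (mixed Basis)) (\<lambda>f. F (vec_of f)) \<longleftrightarrow> integrable (count_space int_lattice) F"
proof -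
  have "Pi\<^sub>M Basis (mixed Basis) = Pi\<^sub>M (Basis :: 'a set) (\<lambda>_. count_space \<int>)"
    by (intro PiM_cong) (auto simp: mixed_def)
  also have "\<dots> = count_space (Pi\<^sub>E Basis (\<lambda>_. \<int>))"
    by (rule count_space_PiM_finite) (auto simp: Ints_def)
  finally have eq: "Pi\<^sub>M (Basis :: 'a set) (mixed Basis) = count_space (Pi\<^sub>E Basis (\<lambda>_. \<int>))" .
  show "(LINT f|Pi\<^sub>M Basis (mixed Basis). F (vec_of f)) = (LINT x|count_space int_lattice. F x)"
    unfolding eq by (rule integral_bij_count_space[OF bij_vec_of_int_lattice])
  show "integrable (Pi\<^sub>M Basis (mixed Basis)) (\<lambda>f. F (vec_of f)) \<longleftrightarrow> integrable (count_space int_lattice) F"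
    unfolding eq using integrable_bij_count_space[OF bij_vec_of_int_lattice] by blast
qed

lemma integrable_wt_lborel: "integrable lborel (wt :: 'a::euclidean_space \<Rightarrow> real)"
  using integrable_mixed[of "wt :: 'a \<Rightarrow> real" 1 "{}"] mixed_lborel(2)[of "wt :: 'a \<Rightarrow> real"] by auto

lemma integrable_wt_int_lattice: "integrable (count_space int_lattice) (wt :: 'a::euclidean_space \<Rightarrow> real)"
  using integrable_mixed[of "wt :: 'a \<Rightarrow> real" 1 Basis] mixed_int_lattice(2)[of "wt :: 'a \<Rightarrow> real"] by auto

text \<open>The Fourier transform of \<open>\<Psi>\<close> is the image under \<open>v\<close> of the complex measure with density \<open>c\<close> with respect
  to \<open>M\<close>; its support lies in the ball of radius \<open>R\<close>. Images of measures keep products and convolutions simple.\<close>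

definition band_limited :: "'x measure \<Rightarrow> ('x \<Rightarrow> complex) \<Rightarrow> ('x \<Rightarrow> 'a) \<Rightarrow> real \<Rightarrow> ('a::euclidean_space \<Rightarrow> complex) \<Rightarrow> bool" where
  "band_limited M c v R \<Psi> \<longleftrightarrow> sigma_finite_measure M \<and> integrable M c \<and> v \<in> borel_measurable M \<and> (\<forall>x\<in>space M. norm (v x) \<le> R)
     \<and> (\<forall>\<xi>. \<Psi> \<xi> = (LINT x|M. c x * ee (- (\<xi> \<bullet> v x))))"

lemma band_limited_measurable:
  assumes "band_limited M c v R \<Psi>"
  shows "\<Psi> \<in> borel_measurable borel"
proof -
  interpret sigma_finite_measure M using assms by (simp add: band_limited_def)
  have [measurable]: "c \<in> borel_measurable M" "v \<in> borel_measurable M" using assms by (auto simp: band_limited_def)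
  have "\<Psi> = (\<lambda>\<xi>. LINT x|M. c x * ee (- (\<xi> \<bullet> v x)))" using assms by (auto simp: band_limited_def)
  also have "\<dots> \<in> borel_measurable borel" by measurable
  finally show ?thesis .
qed

text \<open>Along direction b the function is again the transform of a measure, with real
  frequencies (x0 - v x) . b. Their modulus is at most 1/2 + R < 1, so \<open>poisson_1d\<close>
  turns the integral over this coordinate into a sum. Induction over the basis then converts all
  coordinates.\<close>

lemma poisson:
  fixes \<Psi> :: "'a::euclidean_space \<Rightarrow> complex"
  assumes B: "band_limited M c v R \<Psi>" and R: "0 \<le> R" "R < 1/2" and x0: "\<And>b. b \<in> Basis \<Longrightarrow> \<bar>x0 \<bullet> b\<bar> \<le> 1/2"
    and bound: "\<And>\<xi>. norm (\<Psi> \<xi>) \<le> C * wt \<xi>" and C: "C \<ge> 0"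
  shows "(LINT m|count_space int_lattice. \<Psi> m * ee (m \<bullet> x0)) = (LINT \<xi>|lborel. \<Psi> \<xi> * ee (\<xi> \<bullet> x0))"
proof -
  note [measurable] = band_limited_measurable[OF B]
  have c: "integrable M c" and v [measurable]: "v \<in> borel_measurable M" and vR: "\<And>x. x \<in> space M \<Longrightarrow> norm (v x) \<le> R"
    and \<Psi>: "\<And>\<xi>. \<Psi> \<xi> = (LINT x|M. c x * ee (- (\<xi> \<bullet> v x)))" using B by (auto simp: band_limited_def)
  have [measurable]: "c \<in> borel_measurable M" using c by simp
  define F where "F \<xi> = \<Psi> \<xi> * ee (\<xi> \<bullet> x0)" for \<xi>
  have mF [measurable]: "F \<in> borel_measurable borel" unfolding F_def[abs_def] by measurable
  have Fb: "norm (F \<xi>) \<le> C * wt \<xi>" for \<xi> using bound unfolding F_def by (simp add: norm_mult)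
  define Q where "Q J = (LINT f|Pi\<^sub>M Basis (mixed J). F (vec_of f))" for J
  have step: "Q (insert b J) = Q J" if b: "b \<in> Basis" "b \<notin> J" for b J
  proof -
    interpret J: product_sigma_finite "mixed J" by (rule product_sigma_finite_mixed)
    interpret J': product_sigma_finite "mixed (insert b J)" by (rule product_sigma_finite_mixed)
    let ?I = "Basis - {b}"
    have ins: "insert b ?I = Basis" using b by auto
    have 1: "Q J = (LINT g|Pi\<^sub>M ?I (mixed J). (LINT t|lborel. F (vec_of (g(b := t)))))"
      unfolding Q_def using J.product_integral_insert[of ?I b "\<lambda>f. F (vec_of f)", unfolded ins] integrable_mixed[OF mF Fb C, of J] b
      by (simp add: mixed_def)
    have 2: "Q (insert b J) = (LINT g|Pi\<^sub>M ?I (mixed (insert b J)). (LINT t|count_space \<int>. F (vec_of (g(b := t)))))"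
      unfolding Q_def using J'.product_integral_insert[of ?I b "\<lambda>f. F (vec_of f)", unfolded ins] integrable_mixed[OF mF Fb C, of "insert b J"] b
      by (simp add: mixed_def)
    have 3: "Pi\<^sub>M ?I (mixed (insert b J)) = Pi\<^sub>M ?I (mixed J)"
      by (intro PiM_cong) (auto simp: mixed_def)
    have 4: "(LINT t|lborel. F (vec_of (g(b := t)))) = (LINT t|count_space \<int>. F (vec_of (g(b := t))))" for g :: "'a \<Rightarrow> real"
    proof (rule poisson_1d)
      let ?u = "vec_of (g(b := 0))"
      show "integrable M (\<lambda>x. c x * ee (?u \<bullet> (x0 - v x)))"
        by (rule integrable_norm_le[of M "\<lambda>x. norm (c x)"]) (use c in \<open>auto simp: norm_mult\<close>)
      show "(\<lambda>x. (x0 - v x) \<bullet> b) \<in> borel_measurable M" by measurable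
      show "0 < (if R = 0 then 1/2 else 1/2 - R)" "(if R = 0 then 1/2 else 1/2 - R) < 1" using R by auto
      show "\<bar>(x0 - v x) \<bullet> b\<bar> \<le> 1 - (if R = 0 then 1/2 else 1/2 - R)" if "x \<in> space M" for x
        using Basis_le_norm[OF b(1), of "v x"] vR[OF that] x0[OF b(1)] by (auto simp: inner_diff_left)
      show "F (vec_of (g(b := t))) = (LINT x|M. c x * ee (?u \<bullet> (x0 - v x)) * ee (t * ((x0 - v x) \<bullet> b)))" for t
      proof -
        let ?w = "vec_of (g(b := t))"
        have "F ?w = (LINT x|M. (c x * ee (- (?w \<bullet> v x))) * ee (?w \<bullet> x0))"
          unfolding F_def \<Psi> by simp
        also have "\<dots> = (LINT x|M. c x * ee (?u \<bullet> (x0 - v x)) * ee (t * ((x0 - v x) \<bullet> b)))"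
        proof (rule Bochner_Integration.integral_cong[OF refl])
          fix x
          have "- (?w \<bullet> v x) + ?w \<bullet> x0 = ?u \<bullet> (x0 - v x) + t * ((x0 - v x) \<bullet> b)"
            unfolding vec_of_upd[OF b(1), of g t] by (simp add: inner_add_left inner_diff_right inner_diff_left inner_commute algebra_simps)
          then show "(c x * ee (- (?w \<bullet> v x))) * ee (?w \<bullet> x0) = c x * ee (?u \<bullet> (x0 - v x)) * ee (t * ((x0 - v x) \<bullet> b))"
            unfolding mult.assoc ee_add[symmetric] by (simp only:)
        qed
        finally show ?thesis .
      qed
      show "norm (F (vec_of (g(b := t)))) \<le> C / (1 + t\<^sup>2)" for t
      proof -
        let ?w = "vec_of (g(b := t))"
        have 1: "norm (F ?w) \<le> C * (\<Prod>b'\<in>Basis. 1 / (1 + (?w \<bullet> b')\<^sup>2))"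
          using Fb[of ?w] mult_left_mono[OF wt_le[of ?w] C] by linarith
        have "(\<Prod>b'\<in>Basis. 1 / (1 + (?w \<bullet> b')\<^sup>2)) = (1 / (1 + (?w \<bullet> b)\<^sup>2)) * (\<Prod>b'\<in>?I. 1 / (1 + (?w \<bullet> b')\<^sup>2))"
          using b by (intro prod.remove) auto
        also have "\<dots> \<le> (1 / (1 + (?w \<bullet> b)\<^sup>2)) * 1"
          by (intro mult_left_mono prod_le_1) (auto simp: divide_le_eq add_pos_nonneg add_nonneg_nonneg)
        also have "\<dots> = 1 / (1 + t\<^sup>2)" using b by (simp only: vec_of_inner fun_upd_same mult_1_right)
        finally have "C * (\<Prod>b'\<in>Basis. 1 / (1 + (?w \<bullet> b')\<^sup>2)) \<le> C * (1 / (1 + t\<^sup>2))"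
          using C by (rule mult_left_mono)
        with 1 show ?thesis by simp
      qed
    qed
    show ?thesis unfolding 1 2 3 4 ..
  qed
  have "Q J = Q {}" if "finite J" "J \<subseteq> Basis" for J
    using that by (induction J rule: finite_induct) (auto simp: step)
  from this[of Basis] have "Q Basis = Q {}" by simp
  then show ?thesis
    unfolding Q_def mixed_int_lattice(1) mixed_lborel(1)[OF mF] unfolding F_def .
qed

section \<open>Products and convolutions of band-limited functions\<close>

lemma integrable_fst_mult_snd:
  fixes f :: "'a \<Rightarrow> complex" and g :: "'b \<Rightarrow> complex"
  assumes "sigma_finite_measure M" "sigma_finite_measure N" "integrable M f" "integrable N g"
  shows "integrable (M \<Otimes>\<^sub>M N) (\<lambda>z. f (fst z) * g (snd z))"
proof -
  interpret M: sigma_finite_measure M by fact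
  interpret N: sigma_finite_measure N by fact
  interpret pair_sigma_finite M N ..
  have [measurable]: "f \<in> borel_measurable M" "g \<in> borel_measurable N" using assms by auto
  show ?thesis
  proof (rule Fubini_integrable)
    show "(\<lambda>z. f (fst z) * g (snd z)) \<in> borel_measurable (M \<Otimes>\<^sub>M N)" by measurable
    show "integrable M (\<lambda>x. LINT y|N. norm (f (fst (x, y)) * g (snd (x, y))))"
      using assms(3) by (simp add: norm_mult)
    show "AE x in M. integrable N (\<lambda>y. f (fst (x, y)) * g (snd (x, y)))"
      using assms(4) by simp
  qed
qed

lemma LINT_pair:
  fixes F :: "'a \<times> 'b \<Rightarrow> complex"
  assumes "sigma_finite_measure M" "sigma_finite_measure N" "integrable (M \<Otimes>\<^sub>M N) F"
  shows "(\<integral>z. F z \<partial>(M \<Otimes>\<^sub>M N)) = (LINT x|M. (LINT y|N. F (x, y)))"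
proof -
  interpret M: sigma_finite_measure M by fact
  interpret N: sigma_finite_measure N by fact
  interpret pair_sigma_finite M N ..
  show ?thesis by (rule integral_fst'[OF assms(3), symmetric])
qed

text \<open>A product of transforms belongs to the convolution of the measures, which is the image
  of the product measure under addition. Hence the radii add up.\<close>

lemma band_limited_mult:
  assumes B: "band_limited M c v R \<Psi>" "band_limited N d u S \<Phi>"
  shows "band_limited (M \<Otimes>\<^sub>M N) (\<lambda>z. c (fst z) * d (snd z)) (\<lambda>z. v (fst z) + u (snd z)) (R + S) (\<lambda>\<xi>. \<Psi> \<xi> * \<Phi> \<xi>)"
proof -
  have M: "sigma_finite_measure M" and N: "sigma_finite_measure N" using B by (auto simp: band_limited_def)
  interpret M: sigma_finite_measure M by fact
  interpret N: sigma_finite_measure N by fact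
  interpret P: pair_sigma_finite M N ..
  have c: "integrable M c" and d: "integrable N d" and [measurable]: "v \<in> borel_measurable M" "u \<in> borel_measurable N"
    using B by (auto simp: band_limited_def)
  have [measurable]: "c \<in> borel_measurable M" "d \<in> borel_measurable N" using c d by auto
  show ?thesis unfolding band_limited_def
  proof (intro conjI allI ballI)
    show "sigma_finite_measure (M \<Otimes>\<^sub>M N)" by (rule P.sigma_finite_measure_axioms)
    show "integrable (M \<Otimes>\<^sub>M N) (\<lambda>z. c (fst z) * d (snd z))" by (rule integrable_fst_mult_snd[OF M N c d])
    show "(\<lambda>z. v (fst z) + u (snd z)) \<in> borel_measurable (M \<Otimes>\<^sub>M N)" by measurable
    show "norm (v (fst z) + u (snd z)) \<le> R + S" if "z \<in> space (M \<Otimes>\<^sub>M N)" for z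
      using B that by (intro order_trans[OF norm_triangle_ineq] add_mono) (auto simp: band_limited_def space_pair_measure)
    fix \<xi>
    have ic: "integrable M (\<lambda>x. c x * ee (- (\<xi> \<bullet> v x)))" by (rule integrable_norm_le[of M "\<lambda>x. norm (c x)"]) (use c in \<open>auto simp: norm_mult\<close>)
    have id: "integrable N (\<lambda>x. d x * ee (- (\<xi> \<bullet> u x)))" by (rule integrable_norm_le[of N "\<lambda>x. norm (d x)"]) (use d in \<open>auto simp: norm_mult\<close>)
    have eq: "c (fst z) * d (snd z) * ee (- (\<xi> \<bullet> (v (fst z) + u (snd z)))) = (c (fst z) * ee (- (\<xi> \<bullet> v (fst z)))) * (d (snd z) * ee (- (\<xi> \<bullet> u (snd z))))" for z
      by (simp add: inner_add_right ee_diff ee_minus divide_inverse)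
    have "(\<integral>z. c (fst z) * d (snd z) * ee (- (\<xi> \<bullet> (v (fst z) + u (snd z)))) \<partial>(M \<Otimes>\<^sub>M N))
       = (LINT x|M. (LINT y|N. (c x * ee (- (\<xi> \<bullet> v x))) * (d y * ee (- (\<xi> \<bullet> u y)))))"
      unfolding eq by (subst LINT_pair[OF M N integrable_fst_mult_snd[OF M N ic id]]) simp
    also have "\<dots> = \<Psi> \<xi> * \<Phi> \<xi>" using B by (simp add: band_limited_def)
    finally show "\<Psi> \<xi> * \<Phi> \<xi> = (\<integral>z. c (fst z) * d (snd z) * ee (- (\<xi> \<bullet> (v (fst z) + u (snd z)))) \<partial>(M \<Otimes>\<^sub>M N))" ..
  qed
qed

text \<open>Convolution with \<open>g\<close> in the frequency variable multiplies the underlying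
  measure by a bounded function, so its support does not grow, however rough \<open>g\<close> is.
  Here \<open>g\<close> may be the indicator function of a ball. The additional factor
  \<open>lborel\<close> encodes that function as an integral.\<close>

lemma band_limited_convolution:
  fixes g :: "'a::euclidean_space \<Rightarrow> complex"
  assumes B: "band_limited M c v R \<Psi>" and g: "integrable lborel g"
  shows "band_limited (lborel \<Otimes>\<^sub>M M) (\<lambda>z. g (fst z) * c (snd z) * ee (fst z \<bullet> v (snd z))) (\<lambda>z. v (snd z)) R (\<lambda>\<xi>. LINT \<zeta>|lborel. g \<zeta> * \<Psi> (\<xi> - \<zeta>))"
proof -
  have M: "sigma_finite_measure M" using B by (auto simp: band_limited_def)
  interpret M: sigma_finite_measure M by fact
  interpret P: pair_sigma_finite "lborel :: 'a measure" M ..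
  have c: "integrable M c" and [measurable]: "v \<in> borel_measurable M"
    using B by (auto simp: band_limited_def)
  have [measurable]: "c \<in> borel_measurable M" "g \<in> borel_measurable borel" using c g by auto
  have int: "integrable (lborel \<Otimes>\<^sub>M M) (\<lambda>z. g (fst z) * c (snd z))"
    by (rule integrable_fst_mult_snd[OF _ M g c]) (rule lborel.sigma_finite_measure_axioms)
  have int2: "integrable (lborel \<Otimes>\<^sub>M M) (\<lambda>z. g (fst z) * c (snd z) * ee (h z))" if "h \<in> borel_measurable (lborel \<Otimes>\<^sub>M M)" for h
    by (rule integrable_norm_le[OF integrable_norm[OF int]]) (use that in \<open>auto simp: norm_mult\<close>)
  show ?thesis unfolding band_limited_def
  proof (intro conjI allI ballI)
    show "sigma_finite_measure (lborel \<Otimes>\<^sub>M M :: ('a \<times> _) measure)" by (rule P.sigma_finite_measure_axioms)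
    show "integrable (lborel \<Otimes>\<^sub>M M) (\<lambda>z. g (fst z) * c (snd z) * ee (fst z \<bullet> v (snd z)))" by (rule int2) measurable
    show "(\<lambda>z. v (snd z)) \<in> borel_measurable (lborel \<Otimes>\<^sub>M M)" by measurable
    show "norm (v (snd z)) \<le> R" if "z \<in> space (lborel \<Otimes>\<^sub>M M)" for z :: "'a \<times> _"
      using B that by (auto simp: band_limited_def space_pair_measure)
    fix \<xi>
    have eq: "g (fst z) * c (snd z) * ee (fst z \<bullet> v (snd z)) * ee (- (\<xi> \<bullet> v (snd z))) = g (fst z) * c (snd z) * ee (- ((\<xi> - fst z) \<bullet> v (snd z)))" for z
      by (simp only: mult.assoc ee_add[symmetric]) (simp add: inner_diff_left)
    have "(\<integral>z. g (fst z) * c (snd z) * ee (fst z \<bullet> v (snd z)) * ee (- (\<xi> \<bullet> v (snd z))) \<partial>(lborel \<Otimes>\<^sub>M M))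
       = (LINT \<zeta>|lborel. (LINT y|M. g \<zeta> * (c y * ee (- ((\<xi> - \<zeta>) \<bullet> v y)))))"
      unfolding eq by (subst LINT_pair[OF _ M int2]) (auto simp: lborel.sigma_finite_measure_axioms mult.assoc)
    also have "\<dots> = (LINT \<zeta>|lborel. g \<zeta> * \<Psi> (\<xi> - \<zeta>))" using B by (simp add: band_limited_def)
    finally show "(LINT \<zeta>|lborel. g \<zeta> * \<Psi> (\<xi> - \<zeta>)) = (\<integral>z. g (fst z) * c (snd z) * ee (fst z \<bullet> v (snd z)) * ee (- (\<xi> \<bullet> v (snd z))) \<partial>(lborel \<Otimes>\<^sub>M M))" ..
  qed
qed

text \<open>The map is set to 0 off the ball, where the density vanishes, so that its values are
  bounded by \<open>a\<close> everywhere.\<close>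

lemma band_limited_U_fun:
  assumes "\<beta> > -1" "a > 0"
  shows "band_limited lborel (\<lambda>x. of_real (U_fun \<beta> a x)) (\<lambda>x. if norm x < a then x else 0) a
     (\<lambda>\<xi> :: real^'n. of_real (slice_const (CARD('n) - 1) \<beta> * W (\<beta> + (real CARD('n) - 1) / 2) a (norm \<xi>)))"
  unfolding band_limited_def
proof (intro conjI allI ballI)
  show "integrable lborel (\<lambda>x :: real^'n. complex_of_real (U_fun \<beta> a x))"
    by (rule integrable_of_real[OF integrable_U_fun[OF assms]])
  fix \<xi> :: "real^'n"
  show "of_real (slice_const (CARD('n) - 1) \<beta> * W (\<beta> + (real CARD('n) - 1) / 2) a (norm \<xi>))
     = (LINT x|lborel. of_real (U_fun \<beta> a x) * ee (- (\<xi> \<bullet> (if norm x < a then x else 0))))"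
    unfolding fourier_U_fun[OF assms, symmetric]
    by (intro Bochner_Integration.integral_cong) (auto simp: U_fun_def ee_def)
qed (use assms in \<open>auto simp: lborel.sigma_finite_measure_axioms\<close>)

section \<open>A band-limited radial cutoff\<close>

lemma W_abs: "W \<mu> a \<bar>r\<bar> = W \<mu> a r"
  using W_uminus[of \<mu> a r] by (simp add: abs_if)

text \<open>The norm is not differentiable at 0. When the line meets that point, evenness of
  \<open>W\<close> replaces the norm by the signed distance s - r.\<close>

lemma W_norm_deriv:
  fixes e \<zeta> :: "'a::euclidean_space"
  assumes "\<mu> > -1" "a > 0" "norm e = 1"
  shows "((\<lambda>r. W \<mu> a (norm (r *\<^sub>R e - \<zeta>))) has_real_derivative
     - (2 * pi\<^sup>2 / (\<mu> + 1)) * W (\<mu> + 1) a (norm (r *\<^sub>R e - \<zeta>)) * ((r *\<^sub>R e - \<zeta>) \<bullet> e)) (at r)"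
proof (cases "r *\<^sub>R e = \<zeta>")
  case True
  have "W \<mu> a (norm (s *\<^sub>R e - \<zeta>)) = W \<mu> a (s - r)" for s
  proof -
    have "s *\<^sub>R e - \<zeta> = (s - r) *\<^sub>R e" using True by (simp add: algebra_simps)
    then have "norm (s *\<^sub>R e - \<zeta>) = \<bar>s - r\<bar>" using assms by simp
    then show ?thesis by (simp only: W_abs)
  qed
  moreover have "((\<lambda>s. W \<mu> a (s - r)) has_real_derivative (- (2 * pi\<^sup>2 * (r - r) / (\<mu> + 1)) * W (\<mu> + 1) a (r - r)) * (1 - 0)) (at r)"
    by (rule DERIV_chain2[OF W_deriv[OF assms(1,2)]]) (auto intro!: derivative_eq_intros)
  ultimately show ?thesis using True by simp
next
  case False
  define w where "w = r *\<^sub>R e - \<zeta>"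
  have w: "w \<noteq> 0" using False by (simp add: w_def)
  have d1: "((\<lambda>r. r *\<^sub>R e - \<zeta>) has_derivative (\<lambda>h. h *\<^sub>R e)) (at r)"
    by (auto intro!: derivative_eq_intros)
  have d2: "(norm has_derivative (\<lambda>h. h \<bullet> sgn w)) (at (r *\<^sub>R e - \<zeta>))"
    using has_derivative_norm[OF w] unfolding w_def .
  have "((\<lambda>r. norm (r *\<^sub>R e - \<zeta>)) has_derivative (\<lambda>h. (h *\<^sub>R e) \<bullet> sgn w)) (at r)"
    by (rule has_derivative_compose[OF d1 d2])
  also have "(\<lambda>h. (h *\<^sub>R e) \<bullet> sgn w) = (*) ((w \<bullet> e) / norm w)"
    by (rule ext) (simp add: sgn_div_norm inner_commute divide_inverse)
  finally have "((\<lambda>r. norm (r *\<^sub>R e - \<zeta>)) has_real_derivative (w \<bullet> e) / norm w) (at r)"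
    unfolding has_field_derivative_def .
  from DERIV_chain2[OF W_deriv[OF assms(1,2)] this]
  have "((\<lambda>r. W \<mu> a (norm (r *\<^sub>R e - \<zeta>))) has_real_derivative
     (- (2 * pi\<^sup>2 * norm w / (\<mu> + 1)) * W (\<mu> + 1) a (norm w)) * ((w \<bullet> e) / norm w)) (at r)"
    by (simp add: w_def)
  then show ?thesis unfolding w_def[symmetric] using w by (simp add: field_simps)
qed

lemma orthogonal_transformation_uminus: "orthogonal_transformation (uminus :: 'a::euclidean_space \<Rightarrow> 'a)"
  using orthogonal_transformation_neg[of "\<lambda>x :: 'a. x"] by simp

lemma LINT_reflect:
  fixes h :: "'a::euclidean_space \<Rightarrow> 'b::{banach,second_countable_topology}"
  assumes [measurable]: "h \<in> borel_measurable borel"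
  shows "(LINT \<zeta>|lborel. h (c - \<zeta>)) = (LINT \<zeta>|lborel. h \<zeta>)"
proof -
  have "(LINT \<zeta>|lborel. h (c - \<zeta>)) = (LINT \<zeta>|lborel. h (c - (- \<zeta>)))"
    by (rule LINT_orthogonal[of uminus "\<lambda>\<zeta>. h (c - \<zeta>)", symmetric]) (auto simp: orthogonal_transformation_uminus)
  also have "\<dots> = (LINT \<zeta>|distr lborel borel ((+) c). h \<zeta>)"
    by (subst integral_distr) auto
  finally show ?thesis by (simp add: lborel_distr_plus)
qed

lemma integrable_reflect:
  fixes h :: "'a::euclidean_space \<Rightarrow> 'b::{banach,second_countable_topology}"
  assumes h: "integrable lborel h"
  shows "integrable lborel (\<lambda>\<zeta>. h (c - \<zeta>))"
proof -
  have [measurable]: "h \<in> borel_measurable borel" using h by simp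
  have "integrable (distr lborel borel ((+) c)) h" using h by (simp add: lborel_distr_plus)
  then have "integrable lborel (\<lambda>\<zeta>. h (c + \<zeta>))" by (subst (asm) integrable_distr_eq) auto
  then have "integrable (distr lborel borel uminus) (\<lambda>\<zeta>. h (c + \<zeta>))"
    by (subst lborel_orthogonal) (auto simp: orthogonal_transformation_uminus)
  then show ?thesis by (subst (asm) integrable_distr_eq) auto
qed

lemma square_powr_decay:
  assumes "r \<ge> 0" "real k / 2 \<le> x"
  shows "(1 + r) powr (- x) * (1 + r) powr (- x) \<le> inverse ((1 + r) ^ k)"
proof -
  have "(1 + r) powr (- x) * (1 + r) powr (- x) = (1 + r) powr (- x + - x)"
    by (rule powr_add[symmetric])
  also have "\<dots> \<le> (1 + r) powr (- real k)"
    using assms by (intro powr_mono) auto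
  also have "\<dots> = inverse ((1 + r) ^ k)"
    using assms by (simp add: powr_minus powr_realpow)
  finally show ?thesis .
qed

lemma W_0_pos:
  assumes "\<mu> > -1" "a > 0"
  shows "W \<mu> a 0 > 0"
proof -
  have "W \<mu> a 0 = powp_const \<mu> * powp (\<mu> + 1/2) (a\<^sup>2)"
    unfolding W_def using assms(1) by (simp add: integral_powp)
  then show ?thesis using powp_const_pos[OF assms(1)] assms(2) by (simp add: powp_def)
qed

text \<open>The decay of \<open>G\<close> is used in two portions: \<open>L\<close> powers measure
  the distance from \<open>z\<close> to \<open>S\<close>, and the weight \<open>wt\<close> makes the
  remaining integral finite.\<close>

lemma LINT_decay_bound:
  fixes G :: "'a::euclidean_space \<Rightarrow> real"
  assumes G: "\<And>w. \<bar>G w\<bar> \<le> C * (inverse ((1 + norm w) ^ L) * wt w)" and "C \<ge> 0"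
    and S: "\<And>\<zeta>. \<zeta> \<in> S \<Longrightarrow> inverse ((1 + norm (z - \<zeta>)) ^ L) \<le> D"
    and "D \<ge> 0"
  shows "\<bar>LINT \<zeta>|lborel. indicator S \<zeta> * G (z - \<zeta>)\<bar> \<le> C * D * (LINT w|lborel. wt (w :: 'a))"
proof -
  have "norm (LINT \<zeta>|lborel. indicator S \<zeta> * G (z - \<zeta>)) \<le> (LINT \<zeta>|lborel. C * D * wt (z - \<zeta>))"
  proof (rule norm_LINT_le)
    show "integrable lborel (\<lambda>\<zeta>. C * D * wt (z - \<zeta>))"
      by (intro integrable_mult_right integrable_reflect integrable_wt_lborel)
    fix \<zeta>
    show "norm (indicator S \<zeta> * G (z - \<zeta>)) \<le> C * D * wt (z - \<zeta>)"
    proof (cases "\<zeta> \<in> S")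
      case True
      have "\<bar>G (z - \<zeta>)\<bar> \<le> C * (inverse ((1 + norm (z - \<zeta>)) ^ L) * wt (z - \<zeta>))" by (rule G)
      also have "\<dots> \<le> C * (D * wt (z - \<zeta>))"
        using S[OF True] assms by (intro mult_left_mono mult_right_mono) auto
      finally show ?thesis using True by (simp add: mult.assoc)
    qed (use assms in auto)
  qed
  also have "\<dots> = C * D * (LINT w|lborel. wt (w :: 'a))"
    by (simp add: LINT_reflect)
  finally show ?thesis by simp
qed

text \<open>The cutoff is the indicator function of the ball of radius \<open>l\<close> convolved with a normalized square of
  the Fourier transform of some \<^term>\<open>U_fun M b\<close> with \<open>M\<close> large.\<close>

lemma cutoff_exists:
  fixes L :: nat and b :: real
  assumes b: "b > 0"
  obtains \<eta> \<eta>' :: "real \<Rightarrow> real \<Rightarrow> real" and C where "C > 0"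
    "\<And>l. l > 0 \<Longrightarrow> \<exists>c v. band_limited (lborel \<Otimes>\<^sub>M (lborel \<Otimes>\<^sub>M lborel) :: ((real^'n) \<times> (real^'n) \<times> (real^'n)) measure) c v (2 * b) (\<lambda>\<xi> :: real^'n. of_real (\<eta> l (norm \<xi>)))"
    "\<And>l r. l > 0 \<Longrightarrow> (\<eta> l has_real_derivative \<eta>' l r) (at r)"
    "\<And>l. \<eta>' l \<in> borel_measurable borel"
    "\<And>l r. l > 0 \<Longrightarrow> r \<ge> 0 \<Longrightarrow> \<bar>(if r < l then 1 else 0) - \<eta> l r\<bar> \<le> C * inverse ((1 + \<bar>r - l\<bar>) ^ L)"
    "\<And>l r. l > 0 \<Longrightarrow> r \<ge> 0 \<Longrightarrow> \<bar>\<eta>' l r\<bar> \<le> C * inverse ((1 + \<bar>r - l\<bar>) ^ L)"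
    "\<And>l r. l > 0 \<Longrightarrow> r \<ge> 0 \<Longrightarrow> \<bar>\<eta> l r\<bar> \<le> C * (1 + l) ^ L * inverse ((1 + r) ^ L)"
proof -
  define d where "d = DIM(real^'n)"
  have d: "d = CARD('n)" "d \<ge> 1" unfolding d_def by (auto simp: Suc_leI)
  \<comment> \<open>As nu + 1 >= M, the square of \<open>W \<nu> b\<close> decays with order at
    least 2 M = L + 2 d: L powers for the distance to the sphere and 2 d for
    \<open>wt\<close>.\<close>
  define M where "M = real (L + 2 * d) / 2"
  define \<nu> where "\<nu> = M + (real CARD('n) - 1) / 2"
  have "M \<ge> 0" unfolding M_def by simp
  then have M: "M > -1" by linarith
  have "real CARD('n) \<ge> 1" using d by simp
  then have \<nu>1: "\<nu> > -1" using \<open>M \<ge> 0\<close> unfolding \<nu>_def by (simp add: field_simps)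
  have \<nu>2: "M \<le> \<nu> + 1" using \<open>real CARD('n) \<ge> 1\<close> unfolding \<nu>_def by (simp add: field_simps)
  note \<nu> = \<nu>1 \<nu>2
  obtain e :: "real^'n" where e: "e \<in> Basis" using nonempty_Basis by blast
  then have ne: "norm e = 1" by simp
  \<comment> \<open>Squaring makes the kernel nonnegative, so its total mass is positive and can be
    normalized. The function p below is its derivative in the direction e.\<close>
  define q where "q w = (W \<nu> b (norm w))\<^sup>2" for w :: "real^'n"
  define p where "p w = 2 * W \<nu> b (norm w) * (- (2 * pi\<^sup>2 / (\<nu> + 1)) * W (\<nu> + 1) b (norm w) * (w \<bullet> e))" for w :: "real^'n"
  have contq: "continuous_on UNIV q" unfolding q_def
    using \<nu> b by (intro continuous_intros) auto
  have contp: "continuous_on UNIV p" unfolding p_def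
    using \<nu> b by (intro continuous_intros) auto
  have [measurable]: "q \<in> borel_measurable borel" "p \<in> borel_measurable borel"
    using contq contp by (auto intro: borel_measurable_continuous_onI)
  obtain C1 where C1: "C1 > 0" "\<And>r. r \<ge> 0 \<Longrightarrow> \<bar>W \<nu> b r\<bar> \<le> C1 * (1 + r) powr (- \<nu> - 1)"
    using W_bound[OF \<nu>(1) b] by blast
  obtain C2 where C2: "C2 > 0" "\<And>r. r \<ge> 0 \<Longrightarrow> \<bar>2 * pi\<^sup>2 * r / (\<nu> + 1) * W (\<nu> + 1) b r\<bar> \<le> C2 * (1 + r) powr (- \<nu> - 1)"
    using W_deriv_bound[OF \<nu>(1) b] by blast
  define B where "B = C1 * C1 + 2 * (C1 * C2)"
  have B: "B > 0" unfolding B_def using C1 C2 by (simp add: add_pos_pos)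
  have dec: "(1 + r) powr (- \<nu> - 1) * (1 + r) powr (- \<nu> - 1) \<le> inverse ((1 + r) ^ (L + 2 * d))" if "r \<ge> 0" for r
    using square_powr_decay[OF that, of "L + 2 * d" "\<nu> + 1"] \<nu> unfolding M_def by simp
  have split: "inverse ((1 + norm w) ^ (L + 2 * d)) = inverse ((1 + norm w) ^ L) * wt w" for w :: "real^'n"
    unfolding wt_def d_def by (simp add: power_add)
  have q_bound: "\<bar>q w\<bar> \<le> B * (inverse ((1 + norm w) ^ L) * wt w)" for w
  proof -
    let ?x = "(1 + norm w) powr (- \<nu> - 1)"
    have "\<bar>q w\<bar> = \<bar>W \<nu> b (norm w)\<bar> * \<bar>W \<nu> b (norm w)\<bar>" by (simp add: q_def power2_eq_square abs_mult)
    also have "\<dots> \<le> (C1 * ?x) * (C1 * ?x)"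
      using C1 by (intro mult_mono C1) auto
    also have "\<dots> = (C1 * C1) * (?x * ?x)" by simp
    also have "\<dots> \<le> B * inverse ((1 + norm w) ^ (L + 2 * d))"
      unfolding B_def using C1 C2 by (intro mult_mono dec) auto
    finally show ?thesis unfolding split .
  qed
  have p_bound: "\<bar>p w\<bar> \<le> B * (inverse ((1 + norm w) ^ L) * wt w)" for w
  proof -
    let ?x = "(1 + norm w) powr (- \<nu> - 1)"
    have we: "\<bar>w \<bullet> e\<bar> \<le> norm w" using Basis_le_norm[OF e] .
    have "\<bar>2 * pi\<^sup>2 / (\<nu> + 1) * W (\<nu> + 1) b (norm w) * (w \<bullet> e)\<bar> = \<bar>2 * pi\<^sup>2 / (\<nu> + 1) * W (\<nu> + 1) b (norm w)\<bar> * \<bar>w \<bullet> e\<bar>"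
      by (rule abs_mult)
    also have "\<dots> \<le> \<bar>2 * pi\<^sup>2 / (\<nu> + 1) * W (\<nu> + 1) b (norm w)\<bar> * norm w"
      using we by (intro mult_left_mono) auto
    also have "\<dots> = \<bar>2 * pi\<^sup>2 * norm w / (\<nu> + 1) * W (\<nu> + 1) b (norm w)\<bar>"
      by (simp add: abs_mult)
    also have "\<dots> \<le> C2 * ?x" by (rule C2) simp
    finally have 1: "\<bar>2 * pi\<^sup>2 / (\<nu> + 1) * W (\<nu> + 1) b (norm w) * (w \<bullet> e)\<bar> \<le> C2 * ?x" .
    have "\<bar>p w\<bar> = 2 * (\<bar>W \<nu> b (norm w)\<bar> * \<bar>2 * pi\<^sup>2 / (\<nu> + 1) * W (\<nu> + 1) b (norm w) * (w \<bullet> e)\<bar>)"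
      unfolding p_def by (simp add: abs_mult)
    also have "\<dots> \<le> 2 * ((C1 * ?x) * (C2 * ?x))"
      using C1 C2 by (intro mult_left_mono mult_mono C1 1) auto
    also have "\<dots> = (2 * (C1 * C2)) * (?x * ?x)" by simp
    also have "\<dots> \<le> B * inverse ((1 + norm w) ^ (L + 2 * d))"
      unfolding B_def using C1 C2 by (intro mult_mono dec) auto
    finally show ?thesis unfolding split .
  qed
  have le_wt: "B * (inverse ((1 + norm w) ^ L) * wt w) \<le> B * wt w" for w :: "real^'n"
    using B by (intro mult_left_mono mult_left_le_one_le) (auto simp: inverse_le_1_iff)
  have wt1: "wt w \<le> 1" for w :: "real^'n"
    unfolding wt_def by (auto simp: inverse_le_1_iff)
  have intq: "integrable lborel q" "integrable lborel p"
    using order_trans[OF q_bound le_wt] order_trans[OF p_bound le_wt]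
    by (auto intro!: integrable_norm_le[of lborel "\<lambda>w. B * wt w"] integrable_mult_right integrable_wt_lborel)
  define c0 where "c0 = (LINT w|lborel. q w)"
  have c0: "c0 > 0"
  proof -
    have "c0 \<noteq> 0"
    proof
      assume "c0 = 0"
      then have ae: "AE w in lborel. q w = 0"
        unfolding c0_def by (subst (asm) integral_nonneg_eq_0_iff_AE[OF intq(1)]) (auto simp: q_def)
      have "q 0 > 0" using W_0_pos[OF \<nu>(1) b] by (simp add: q_def)
      then have "eventually (\<lambda>w. q w > 0) (nhds 0)"
        using contq by (intro order_tendstoD[of q "q 0"]) (auto simp: continuous_on_eq_continuous_at isCont_def tendsto_nhds_iff)
      then obtain r where r: "r > 0" "\<And>w. dist w 0 < r \<Longrightarrow> q w > 0"
        unfolding eventually_nhds_metric by auto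
      have "AE w in lborel. w \<notin> ball (0 :: real^'n) r"
        using ae
      proof eventually_elim
        fix w assume "q w = 0"
        then show "w \<notin> ball 0 r" using r(2)[of w] by (auto simp: dist_commute)
      qed
      then have "emeasure lborel (ball (0 :: real^'n) r) = 0"
        by (subst (asm) AE_iff_measurable[of "ball 0 r"]) auto
      moreover have "0 < unit_ball_vol (real DIM(real^'n)) * r ^ DIM(real^'n)"
        using r(1) by (intro mult_pos_pos unit_ball_vol_pos) auto
      ultimately show False
        using r(1) emeasure_ball[of r "0 :: real^'n"] by (simp only: ennreal_eq_0_iff less_imp_le)
    qed
    moreover have "c0 \<ge> 0" unfolding c0_def q_def by simp
    ultimately show ?thesis by simp
  qed
  define wi where "wi = (LINT w|lborel. wt (w :: real^'n))"
  have wi: "wi \<ge> 0" unfolding wi_def by simp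
  \<comment> \<open>The convolution is evaluated on the line through e, which makes it a function of
    all real r. Rotation invariance later identifies it with the radial function on the whole
    space.\<close>
  define \<eta> where "\<eta> l r = (LINT \<zeta>|lborel. indicator (ball 0 l) \<zeta> * q (r *\<^sub>R e - \<zeta>)) / c0" for l r
  define \<eta>' where "\<eta>' l r = (LINT \<zeta>|lborel. indicator (ball 0 l) \<zeta> * p (r *\<^sub>R e - \<zeta>)) / c0" for l r
  define C where "C = (B * wi + 1) / c0"
  have C: "C > 0" unfolding C_def using B wi c0 by (intro divide_pos_pos add_nonneg_pos) auto
  have intball: "integrable lborel (indicator (ball 0 l) :: real^'n \<Rightarrow> real)" for l
    by (rule integrable_real_indicator) (use emeasure_lborel_ball_finite[of "0 :: real^'n" l] in \<open>auto\<close>)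
  have tail: "\<bar>(LINT \<zeta>|lborel. indicator S \<zeta> * G (z - \<zeta>)) / c0\<bar> \<le> C * D"
    if "\<And>w. \<bar>G w\<bar> \<le> B * (inverse ((1 + norm w) ^ L) * wt w)" "D \<ge> 0"
      "\<And>\<zeta>. \<zeta> \<in> S \<Longrightarrow> inverse ((1 + norm (z - \<zeta>)) ^ L) \<le> D" for G S D and z :: "real^'n"
  proof -
    have "\<bar>LINT \<zeta>|lborel. indicator S \<zeta> * G (z - \<zeta>)\<bar> \<le> B * D * wi"
      unfolding wi_def using that B by (intro LINT_decay_bound[where L=L]) auto
    also have "\<dots> \<le> (B * wi + 1) * D" using that by (simp add: algebra_simps)
    finally show ?thesis unfolding C_def using c0 by (simp add: field_simps)
  qed
  have near: "inverse ((1 + norm (r *\<^sub>R e - \<zeta>)) ^ L) \<le> inverse ((1 + s) ^ L)" if "0 \<le> s" "s \<le> norm (r *\<^sub>R e - \<zeta>)" for r s \<zeta>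
    using that by (intro le_imp_inverse_le power_mono) auto
  have total: "(LINT \<zeta>|lborel. q (z - \<zeta>)) = c0" "(LINT \<zeta>|lborel. p (z - \<zeta>)) = 0" for z
  proof -
    show "(LINT \<zeta>|lborel. q (z - \<zeta>)) = c0" unfolding c0_def by (rule LINT_reflect) simp
    have 1: "(LINT \<zeta>|lborel. p (z - \<zeta>)) = (LINT \<zeta>|lborel. p \<zeta>)" for z by (rule LINT_reflect) simp
    \<comment> \<open>Since p is odd its integral vanishes. This allows the derivative inside the
      ball to be estimated by the integral over the complement.\<close>
    have "p (0 - \<zeta>) = - p \<zeta>" for \<zeta> by (simp add: p_def)
    then have "(LINT \<zeta>|lborel. p \<zeta>) = - (LINT \<zeta>|lborel. p \<zeta>)" using 1[of 0] by simp
    then show "(LINT \<zeta>|lborel. p (z - \<zeta>)) = 0" unfolding 1 by simp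
  qed
  have compl: "(LINT \<zeta>|lborel. indicator (- S) \<zeta> * G (z - \<zeta>)) = (LINT \<zeta>|lborel. G (z - \<zeta>)) - (LINT \<zeta>|lborel. indicator S \<zeta> * G (z - \<zeta>))"
    if G: "integrable lborel G" and [measurable]: "S \<in> sets borel" for G :: "real^'n \<Rightarrow> real" and S z
  proof -
    have i1: "integrable lborel (\<lambda>\<zeta>. G (z - \<zeta>))" by (rule integrable_reflect[OF G])
    then have i2: "integrable lborel (\<lambda>\<zeta>. indicator S \<zeta> * G (z - \<zeta>))"
      using integrable_mult_indicator[OF _ i1, of S] by simp
    show ?thesis unfolding Bochner_Integration.integral_diff[OF i1 i2, symmetric]
      by (intro Bochner_Integration.integral_cong) (auto simp: indicator_def)
  qed
  show thesis
  proof (rule that[of C \<eta> \<eta>'])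
    show "C > 0" by fact
    fix l :: real
    show "\<eta>' l \<in> borel_measurable borel"
    proof -
      let ?F = "\<lambda>z :: real \<times> (real^'n). indicat_real (ball 0 l) (snd z) * p (fst z *\<^sub>R e - snd z)"
      have m1: "(snd :: real \<times> (real^'n) \<Rightarrow> _) \<in> borel_measurable borel"
        by (intro borel_measurable_continuous_onI continuous_intros)
      have m2: "(\<lambda>z :: real \<times> (real^'n). fst z *\<^sub>R e - snd z) \<in> borel_measurable borel"
        by (intro borel_measurable_continuous_onI continuous_intros)
      have mi: "indicat_real (ball (0 :: real^'n) l) \<in> borel_measurable borel" by (rule borel_measurable_indicator) simp
      have "?F \<in> borel_measurable borel"
        using \<open>p \<in> borel_measurable borel\<close>
        by (intro borel_measurable_times measurable_compose[OF m1 mi] measurable_compose[OF m2])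
      moreover have "sets (borel \<Otimes>\<^sub>M lborel :: (real \<times> (real^'n)) measure) = sets borel"
        unfolding borel_prod[symmetric] by (rule sets_pair_measure_cong) auto
      ultimately have "?F \<in> borel_measurable (borel \<Otimes>\<^sub>M lborel)"
        by (simp cong: measurable_cong_sets)
      then have "(\<lambda>r. LINT \<zeta>|lborel. ?F (r, \<zeta>)) \<in> borel_measurable borel"
        by (intro lborel.borel_measurable_lebesgue_integral) (simp add: case_prod_unfold)
      then show ?thesis unfolding \<eta>'_def[abs_def] by simp
    qed
    assume l: "l > 0"
    show "\<exists>c v. band_limited (lborel \<Otimes>\<^sub>M (lborel \<Otimes>\<^sub>M lborel) :: ((real^'n) \<times> (real^'n) \<times> (real^'n)) measure) c v (2 * b) (\<lambda>\<xi> :: real^'n. of_real (\<eta> l (norm \<xi>)))"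
    proof -
      define sc where "sc = slice_const (CARD('n) - 1) M"
      have sc: "sc > 0" unfolding sc_def by (rule slice_const_pos[OF M])
      \<comment> \<open>The constant \<open>sc\<close> comes from \<open>fourier_U_fun\<close> and
        occurs squared, as the kernel is a product of two transforms; it is divided out together
        with the mass c0.\<close>
      have g: "integrable lborel (\<lambda>\<zeta> :: real^'n. complex_of_real (indicator (ball 0 l) \<zeta> / (c0 * sc\<^sup>2)))"
        using intball[of l] by (intro integrable_of_real integrable_divide)
      note b1 = band_limited_U_fun[OF M b, where 'n='n, folded \<nu>_def sc_def]
      note b2 = band_limited_convolution[OF band_limited_mult[OF b1 b1] g]
      have "(LINT \<zeta>|lborel. complex_of_real (indicator (ball 0 l) \<zeta> / (c0 * sc\<^sup>2)) * (of_real (sc * W \<nu> b (norm (\<xi> - \<zeta>))) * of_real (sc * W \<nu> b (norm (\<xi> - \<zeta>)))))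
         = of_real (\<eta> l (norm \<xi>))" for \<xi> :: "real^'n"
      proof -
        have "norm (norm \<xi> *\<^sub>R e) = norm \<xi>" using ne by simp
        then obtain f where f: "orthogonal_transformation f" "f (norm \<xi> *\<^sub>R e) = \<xi>"
          using orthogonal_transformation_exists by metis
        have "(LINT \<zeta>|lborel. complex_of_real (indicator (ball 0 l) \<zeta> / (c0 * sc\<^sup>2)) * (of_real (sc * W \<nu> b (norm (\<xi> - \<zeta>))) * of_real (sc * W \<nu> b (norm (\<xi> - \<zeta>)))))
          = (LINT \<zeta>|lborel. complex_of_real (indicator (ball 0 l) \<zeta> * q (\<xi> - \<zeta>) / c0))"
          using sc by (intro Bochner_Integration.integral_cong) (auto simp: q_def power2_eq_square)
        also have "\<dots> = of_real ((LINT \<zeta>|lborel. indicator (ball 0 l) \<zeta> * q (\<xi> - \<zeta>)) / c0)"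
          by (simp del: of_real_divide of_real_mult)
        also have "(LINT \<zeta>|lborel. indicator (ball 0 l) \<zeta> * q (\<xi> - \<zeta>)) = (LINT \<zeta>|lborel. indicator (ball 0 l) (f \<zeta>) * q (\<xi> - f \<zeta>))"
        proof (rule LINT_orthogonal[OF f(1), symmetric])
          have "(\<lambda>\<zeta>. \<xi> - \<zeta>) \<in> borel_measurable borel" by (intro borel_measurable_continuous_onI continuous_intros)
          then show "(\<lambda>\<zeta>. indicator (ball 0 l) \<zeta> * q (\<xi> - \<zeta>)) \<in> borel_measurable borel"
            using \<open>q \<in> borel_measurable borel\<close>
            by (intro borel_measurable_times borel_measurable_indicator measurable_compose[of "\<lambda>\<zeta>. \<xi> - \<zeta>" borel borel q]) auto
        qed
        also have "\<dots> = (LINT \<zeta>|lborel. indicator (ball 0 l) \<zeta> * q (norm \<xi> *\<^sub>R e - \<zeta>))"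
        proof (rule Bochner_Integration.integral_cong[OF refl])
          fix \<zeta>
          have "norm (\<xi> - f \<zeta>) = norm (f (norm \<xi> *\<^sub>R e - \<zeta>))"
            using f linear_diff[OF orthogonal_transformation_linear[OF f(1)]] by metis
          also have "\<dots> = norm (norm \<xi> *\<^sub>R e - \<zeta>)" by (rule orthogonal_transformation_norm[OF f(1)])
          finally have "q (\<xi> - f \<zeta>) = q (norm \<xi> *\<^sub>R e - \<zeta>)" by (simp add: q_def)
          then show "indicator (ball 0 l) (f \<zeta>) * q (\<xi> - f \<zeta>) = indicator (ball 0 l) \<zeta> * q (norm \<xi> *\<^sub>R e - \<zeta>)"
            using orthogonal_transformation_norm[OF f(1)] by (simp add: indicator_def)
        qed
        finally show ?thesis unfolding \<eta>_def .
      qed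
      then have "band_limited (lborel \<Otimes>\<^sub>M (lborel \<Otimes>\<^sub>M lborel)) (\<lambda>z. complex_of_real (indicator (ball 0 l) (fst z) / (c0 * sc\<^sup>2)) *
            (complex_of_real (U_fun M b (fst (snd z))) * complex_of_real (U_fun M b (snd (snd z)))) *
            ee (fst z \<bullet> ((if norm (fst (snd z)) < b then fst (snd z) else 0) + (if norm (snd (snd z)) < b then snd (snd z) else 0))))
          (\<lambda>z. (if norm (fst (snd z)) < b then fst (snd z) else 0) + (if norm (snd (snd z)) < b then snd (snd z) else 0))
          (b + b) (\<lambda>\<xi> :: real^'n. of_real (\<eta> l (norm \<xi>)))"
        using b2 by (simp only:)
      then show ?thesis unfolding mult_2 by (intro exI)
    qed
    fix r :: real
    show "(\<eta> l has_real_derivative \<eta>' l r) (at r)"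
    proof -
      have pb: "\<bar>p w\<bar> \<le> B" for w
      proof -
        have "\<bar>p w\<bar> \<le> B * wt w" using p_bound[of w] le_wt[of w] by linarith
        also have "\<dots> \<le> B * 1" using B wt1 by (intro mult_left_mono) auto
        finally show ?thesis by simp
      qed
      have "((\<lambda>r. LINT \<zeta>|lborel. indicator (ball 0 l) \<zeta> * q (r *\<^sub>R e - \<zeta>)) has_vector_derivative
        (LINT \<zeta>|lborel. indicator (ball 0 l) \<zeta> * p (r *\<^sub>R e - \<zeta>))) (at r)"
      proof (rule has_vector_derivative_LINT[where g="\<lambda>\<zeta>. indicator (ball 0 l) \<zeta> * B"])
        show "integrable lborel (\<lambda>\<zeta>. indicator (ball 0 l) \<zeta> * q (r *\<^sub>R e - \<zeta>))" for r
          using integrable_mult_indicator[OF _ integrable_reflect[OF intq(1), of "r *\<^sub>R e"], of "ball 0 l"] by simp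
        show "integrable lborel (\<lambda>\<zeta> :: real^'n. indicator (ball 0 l) \<zeta> * B)"
          using intball by simp
        show "norm (indicator (ball 0 l) \<zeta> * p (r *\<^sub>R e - \<zeta>)) \<le> indicator (ball 0 l) \<zeta> * B" for r \<zeta>
          using pb by (simp add: indicator_def)
        show "((\<lambda>r. indicator (ball 0 l) \<zeta> * q (r *\<^sub>R e - \<zeta>)) has_vector_derivative indicator (ball 0 l) \<zeta> * p (r *\<^sub>R e - \<zeta>)) (at r)" for r \<zeta>
        proof -
          have "((\<lambda>r. q (r *\<^sub>R e - \<zeta>)) has_real_derivative p (r *\<^sub>R e - \<zeta>)) (at r)"
            unfolding q_def p_def using DERIV_power[OF W_norm_deriv[OF \<nu>(1) b ne, of \<zeta> r], of 2] by (simp add: mult_ac)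
          from DERIV_cmult[OF this] show ?thesis
            by (simp add: has_real_derivative_iff_has_vector_derivative)
        qed
        have "(\<lambda>\<zeta>. r *\<^sub>R e - \<zeta>) \<in> borel_measurable borel" by (intro borel_measurable_continuous_onI continuous_intros)
        then have "(\<lambda>\<zeta>. indicator (ball 0 l) \<zeta> * p (r *\<^sub>R e - \<zeta>)) \<in> borel_measurable borel"
          using \<open>p \<in> borel_measurable borel\<close>
          by (intro borel_measurable_times borel_measurable_indicator measurable_compose[of "\<lambda>\<zeta>. r *\<^sub>R e - \<zeta>" borel borel p]) auto
        then show "(\<lambda>\<zeta>. indicator (ball 0 l) \<zeta> * p (r *\<^sub>R e - \<zeta>)) \<in> borel_measurable lborel" by simp
      qed
      then show ?thesis unfolding \<eta>_def[abs_def] \<eta>'_def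
        by (intro DERIV_cdivide) (simp add: has_real_derivative_iff_has_vector_derivative)
    qed
    assume r: "r \<ge> 0"
    have nr: "norm (r *\<^sub>R e) = r" using r ne by simp
    \<comment> \<open>For r >= l the integral runs over the ball, for r < l over its complement; in
      both cases the kernel is evaluated only at distance at least |r - l|.\<close>
    have out: "r - l \<le> norm (r *\<^sub>R e - \<zeta>)" if "\<zeta> \<in> ball 0 l" for \<zeta>
      using that norm_triangle_ineq2[of "r *\<^sub>R e" \<zeta>] nr by simp
    have inn: "l - r \<le> norm (r *\<^sub>R e - \<zeta>)" if "\<zeta> \<in> - ball 0 l" for \<zeta>
      using that norm_triangle_ineq2[of \<zeta> "r *\<^sub>R e"] nr by (simp add: norm_minus_commute)
    show "\<bar>(if r < l then 1 else 0) - \<eta> l r\<bar> \<le> C * inverse ((1 + \<bar>r - l\<bar>) ^ L)"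
    proof (cases "r < l")
      case True
      have "1 - \<eta> l r = (LINT \<zeta>|lborel. indicator (- ball 0 l) \<zeta> * q (r *\<^sub>R e - \<zeta>)) / c0"
        unfolding \<eta>_def using c0 by (subst compl[OF intq(1)]) (auto simp: total field_simps)
      also have "\<bar>\<dots>\<bar> \<le> C * inverse ((1 + (l - r)) ^ L)"
        using True inn by (intro tail q_bound near) auto
      finally show ?thesis using True by simp
    next
      case False
      have "\<bar>\<eta> l r\<bar> \<le> C * inverse ((1 + (r - l)) ^ L)"
        unfolding \<eta>_def using False out by (intro tail q_bound near) auto
      then show ?thesis using False by simp
    qed
    show "\<bar>\<eta>' l r\<bar> \<le> C * inverse ((1 + \<bar>r - l\<bar>) ^ L)"
    proof (cases "r < l")
      case True
      have "- \<eta>' l r = (LINT \<zeta>|lborel. indicator (- ball 0 l) \<zeta> * p (r *\<^sub>R e - \<zeta>)) / c0"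
        unfolding \<eta>'_def using c0 by (subst compl[OF intq(2)]) (auto simp: total field_simps)
      also have "\<bar>\<dots>\<bar> \<le> C * inverse ((1 + (l - r)) ^ L)"
        using True inn by (intro tail p_bound near) auto
      finally show ?thesis using True by simp
    next
      case False
      have "\<bar>\<eta>' l r\<bar> \<le> C * inverse ((1 + (r - l)) ^ L)"
        unfolding \<eta>'_def using False out by (intro tail p_bound near) auto
      then show ?thesis using False by simp
    qed
    have "\<bar>\<eta> l r\<bar> \<le> C * ((1 + l) ^ L * inverse ((1 + r) ^ L))"
      unfolding \<eta>_def
    proof (intro tail q_bound)
      fix \<zeta> assume "\<zeta> \<in> ball (0 :: real^'n) l"
      then have z: "norm \<zeta> < l" by simp
      have "r \<le> norm (r *\<^sub>R e - \<zeta>) + norm \<zeta>"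
        using norm_triangle_ineq[of "r *\<^sub>R e - \<zeta>" \<zeta>] nr by simp
      also have "\<dots> \<le> norm (r *\<^sub>R e - \<zeta>) + l" using z by simp
      finally have "1 + r \<le> (1 + norm (r *\<^sub>R e - \<zeta>)) * (1 + l)" using mult_nonneg_nonneg[OF less_imp_le[OF l] norm_ge_zero[of "r *\<^sub>R e - \<zeta>"]] by (simp add: algebra_simps)
      then have "(1 + r) ^ L \<le> (1 + norm (r *\<^sub>R e - \<zeta>)) ^ L * (1 + l) ^ L"
        unfolding power_mult_distrib[symmetric] using r by (intro power_mono) auto
      moreover have "(1 + r) ^ L > 0" "(1 + norm (r *\<^sub>R e - \<zeta>)) ^ L > 0" using r by (auto intro!: zero_less_power add_pos_nonneg)
      ultimately show "inverse ((1 + norm (r *\<^sub>R e - \<zeta>)) ^ L) \<le> (1 + l) ^ L * inverse ((1 + r) ^ L)"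
        by (simp add: field_simps)
    qed (use l r in auto)
    then show "\<bar>\<eta> l r\<bar> \<le> C * (1 + l) ^ L * inverse ((1 + r) ^ L)" by (simp add: mult.assoc)
  qed
qed

section \<open>Summation by parts\<close>

text \<open>The measure is either counting measure on the lattice or Lebesgue measure. The inner
  radius \<open>R\<close> is there for weights that are controlled only for large radii, as in
  \<open>partition_exists\<close>.\<close>

definition trunc_sum :: "'a measure \<Rightarrow> ('a::euclidean_space) \<Rightarrow> (real \<Rightarrow> real) \<Rightarrow> real \<Rightarrow> real \<Rightarrow> complex" where
  "trunc_sum M x0 \<phi> R t = (LINT \<xi>|M. of_real (if R \<le> norm \<xi> \<and> norm \<xi> < t then \<phi> (norm \<xi>) else 0) * ee (\<xi> \<bullet> x0))"

lemma ident_borel_measurable: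
  assumes "f \<in> borel_measurable borel" "(\<lambda>x. x) \<in> borel_measurable M"
  shows "f \<in> borel_measurable M"
  using measurable_compose[OF assms(2,1)] .

lemma wt_bound:
  fixes \<xi> :: "'a::euclidean_space"
  assumes "norm \<xi> < t"
  shows "inverse ((1 + t) ^ (2 * DIM('a))) \<le> wt \<xi>"
  unfolding wt_def using assms by (intro le_imp_inverse_le power_mono zero_less_power add_pos_nonneg) auto

lemma trunc_sum_bound:
  fixes x0 :: "'a::euclidean_space"
  assumes wt: "integrable M (wt :: 'a \<Rightarrow> real)" and B: "\<And>r. r \<ge> 0 \<Longrightarrow> \<bar>\<phi> r\<bar> \<le> B"
    and "t \<ge> 0"
  shows "norm (trunc_sum M x0 \<phi> R t) \<le> B * (1 + t) ^ (2 * DIM('a)) * (LINT \<xi>|M. wt \<xi>)"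
proof -
  have B0: "B \<ge> 0" using B[of 0] by (meson abs_ge_zero order_refl order_trans)
  have "norm (trunc_sum M x0 \<phi> R t) \<le> (LINT \<xi>|M. B * (1 + t) ^ (2 * DIM('a)) * wt \<xi>)"
    unfolding trunc_sum_def
  proof (rule norm_LINT_le)
    fix \<xi> :: 'a
    show "norm (complex_of_real (if R \<le> norm \<xi> \<and> norm \<xi> < t then \<phi> (norm \<xi>) else 0) * ee (\<xi> \<bullet> x0)) \<le> B * (1 + t) ^ (2 * DIM('a)) * wt \<xi>"
    proof (cases "R \<le> norm \<xi> \<and> norm \<xi> < t")
      case True
      then have "1 \<le> (1 + t) ^ (2 * DIM('a)) * wt \<xi>"
        using wt_bound[of \<xi> t] assms by (simp add: field_simps)
      then have "B * 1 \<le> B * ((1 + t) ^ (2 * DIM('a)) * wt \<xi>)" using B0 by (intro mult_left_mono) auto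
      then show ?thesis using True B[of "norm \<xi>"] by (simp add: norm_mult mult.assoc)
    qed (use B0 assms in \<open>auto simp: norm_mult\<close>)
  qed (use wt in auto)
  then show ?thesis by simp
qed

text \<open>Summation by parts against the truncated sums, written with Fubini's theorem so that it applies to
  counting measure and Lebesgue measure alike.\<close>

lemma abel_summation:
  fixes x0 :: "'a::euclidean_space"
  assumes M: "sigma_finite_measure M" "(\<lambda>x. x) \<in> borel_measurable M" "integrable M (wt :: 'a \<Rightarrow> real)"
    and \<phi>: "\<phi> \<in> borel_measurable borel" "\<And>r. r \<ge> 0 \<Longrightarrow> \<bar>\<phi> r\<bar> \<le> B"
    and f1: "f1 \<in> borel_measurable borel" "\<And>t. t \<ge> R \<Longrightarrow> \<bar>f1 t\<bar> \<le> C * inverse ((1 + t) ^ (2 * DIM('a) + 2))"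
    and R: "R \<ge> 0"
    and f: "\<And>r. r \<ge> R \<Longrightarrow> f r = (if r < l then A else 0) - (LINT t|lborel. indicator {r<..} t * f1 t)"
  shows "(LINT \<xi>|M. of_real (if R \<le> norm \<xi> then \<phi> (norm \<xi>) * f (norm \<xi>) else 0) * ee (\<xi> \<bullet> x0))
      = of_real A * trunc_sum M x0 \<phi> R l - (LINT t|lborel. of_real (f1 t) * trunc_sum M x0 \<phi> R t)"
    and "integrable lborel (\<lambda>t. of_real (f1 t) * trunc_sum M x0 \<phi> R t)"
proof -
  interpret M: sigma_finite_measure M by fact
  interpret P: pair_sigma_finite M "lborel :: real measure" ..
  note [measurable] = M(2) \<phi>(1) f1(1)
  have mn [measurable]: "norm \<in> borel_measurable M" by (rule ident_borel_measurable[OF _ M(2)]) simp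
  have mE [measurable]: "(\<lambda>\<xi>. ee (\<xi> \<bullet> x0)) \<in> borel_measurable M" by measurable
  have B0: "B \<ge> 0" using \<phi>(2)[of 0] by (meson abs_ge_zero order_refl order_trans)
  have C0: "C \<ge> 0"
  proof -
    have "0 \<le> C * inverse ((1 + R) ^ (2 * DIM('a) + 2))" using f1(2)[of R] by (meson abs_ge_zero order_refl order_trans)
    moreover have "inverse ((1 + R) ^ (2 * DIM('a) + 2)) > 0" using R by simp
    ultimately show ?thesis by (simp add: zero_le_mult_iff)
  qed
  define w where "w \<xi> t = (if R \<le> norm \<xi> \<and> norm \<xi> < t then \<phi> (norm \<xi>) else 0)" for \<xi> :: 'a and t
  define H where "H z = complex_of_real (w (fst z) (snd z) * f1 (snd z)) * ee (fst z \<bullet> x0)" for z :: "'a \<times> real"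
  \<comment> \<open>Of the exponent \<open>2 * DIM('a) + 2\<close>, the first part becomes
    \<open>wt \<xi>\<close> because norm xi < t, and the remaining 2 gives integrability in t. This
    is the majorant for Fubini's theorem.\<close>
  have wb: "\<bar>w \<xi> t * f1 t\<bar> \<le> B * C * (wt \<xi> * (1 / (1 + t\<^sup>2)))" for \<xi> t
  proof (cases "R \<le> norm \<xi> \<and> norm \<xi> < t")
    case True
    then have t: "t \<ge> R" "t \<ge> 0" using R by auto
    have "\<bar>f1 t\<bar> \<le> C * inverse ((1 + t) ^ (2 * DIM('a) + 2))" by (rule f1(2)[OF t(1)])
    also have "inverse ((1 + t) ^ (2 * DIM('a) + 2)) = inverse ((1 + t) ^ (2 * DIM('a))) * inverse ((1 + t)\<^sup>2)"
      by (simp only: power_add inverse_mult_distrib)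
    also have "C * (inverse ((1 + t) ^ (2 * DIM('a))) * inverse ((1 + t)\<^sup>2)) \<le> C * (wt \<xi> * (1 / (1 + t\<^sup>2)))"
    proof (intro mult_left_mono mult_mono wt_bound)
      have "inverse ((1 + t)\<^sup>2) \<le> inverse (1 + t\<^sup>2)"
        using t by (intro le_imp_inverse_le) (auto simp: power2_sum add_pos_nonneg)
      then show "inverse ((1 + t)\<^sup>2) \<le> 1 / (1 + t\<^sup>2)" by (simp add: inverse_eq_divide)
    qed (use True C0 in auto)
    finally have 1: "\<bar>f1 t\<bar> \<le> C * (wt \<xi> * (1 / (1 + t\<^sup>2)))" .
    have "\<bar>w \<xi> t * f1 t\<bar> \<le> B * (C * (wt \<xi> * (1 / (1 + t\<^sup>2))))"
      unfolding abs_mult using True \<phi>(2)[of "norm \<xi>"] B0 by (intro mult_mono 1) (auto simp: w_def)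
    then show ?thesis by (simp add: mult.assoc)
  next
    case False
    then have "w \<xi> t = 0" unfolding w_def by auto
    moreover have "0 \<le> B * C * (wt \<xi> * (1 / (1 + t\<^sup>2)))" using B0 C0 by (intro mult_nonneg_nonneg) (auto simp: add_nonneg_nonneg)
    ultimately show ?thesis by simp
  qed
  have iD: "integrable (M \<Otimes>\<^sub>M lborel) (\<lambda>z. complex_of_real (wt (fst z)) * complex_of_real (1 / (1 + (snd z)\<^sup>2)))"
    by (rule integrable_fst_mult_snd[OF M(1) lborel.sigma_finite_measure_axioms])
       (rule integrable_of_real, (rule M(3) integrable_inverse_square_lborel))+
  have iH: "integrable (M \<Otimes>\<^sub>M lborel) H"
  proof (rule integrable_norm_le)
    show "integrable (M \<Otimes>\<^sub>M lborel) (\<lambda>z. B * C * norm (complex_of_real (wt (fst z)) * complex_of_real (1 / (1 + (snd z)\<^sup>2))))"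
      by (intro integrable_mult_right integrable_norm iD)
    show "norm (H z) \<le> B * C * norm (complex_of_real (wt (fst z)) * complex_of_real (1 / (1 + (snd z)\<^sup>2)))" for z
    proof -
      have "norm (H z) = \<bar>w (fst z) (snd z) * f1 (snd z)\<bar>"
        unfolding H_def norm_mult norm_of_real by simp
      moreover have "norm (complex_of_real (wt (fst z)) * complex_of_real (1 / (1 + (snd z)\<^sup>2))) = wt (fst z) * (1 / (1 + (snd z)\<^sup>2))"
        unfolding norm_mult norm_of_real by (subst (1 2) abs_of_nonneg) (auto simp: add_nonneg_nonneg)
      ultimately show ?thesis using wb[of "fst z" "snd z"] by (simp only:)
    qed
    show "H \<in> borel_measurable (M \<Otimes>\<^sub>M lborel)"
      unfolding H_def w_def by measurable
  qed
  have inner1: "(LINT \<xi>|M. H (\<xi>, t)) = of_real (f1 t) * trunc_sum M x0 \<phi> R t" for t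
  proof -
    have "(LINT \<xi>|M. H (\<xi>, t)) = (LINT \<xi>|M. of_real (f1 t) * (of_real (w \<xi> t) * ee (\<xi> \<bullet> x0)))"
      by (simp add: H_def mult_ac)
    then show ?thesis unfolding trunc_sum_def w_def by simp
  qed
  have swap: "(LINT t|lborel. (LINT \<xi>|M. H (\<xi>, t))) = (LINT \<xi>|M. (LINT t|lborel. H (\<xi>, t)))"
    using P.Fubini_integral[of "\<lambda>\<xi> t. H (\<xi>, t)"] iH by simp
  show "integrable lborel (\<lambda>t. of_real (f1 t) * trunc_sum M x0 \<phi> R t)"
    using P.integrable_snd[of "\<lambda>\<xi> t. H (\<xi>, t)"] iH unfolding inner1 by simp
  have i2: "integrable M (\<lambda>\<xi>. (LINT t|lborel. H (\<xi>, t)))"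
    using P.integrable_fst[of "\<lambda>\<xi> t. H (\<xi>, t)"] iH by simp
  have i1: "integrable M (\<lambda>\<xi>. of_real A * (of_real (w \<xi> l) * ee (\<xi> \<bullet> x0)))"
  proof (intro integrable_mult_right, rule integrable_norm_le)
    show "integrable M (\<lambda>\<xi>. B * (1 + \<bar>l\<bar>) ^ (2 * DIM('a)) * wt \<xi>)" using M(3) by simp
    show "(\<lambda>\<xi>. complex_of_real (w \<xi> l) * ee (\<xi> \<bullet> x0)) \<in> borel_measurable M"
      unfolding w_def by measurable
    fix \<xi> :: 'a
    show "norm (complex_of_real (w \<xi> l) * ee (\<xi> \<bullet> x0)) \<le> B * (1 + \<bar>l\<bar>) ^ (2 * DIM('a)) * wt \<xi>"
    proof (cases "R \<le> norm \<xi> \<and> norm \<xi> < l")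
      case True
      then have l: "l \<ge> 0" using norm_ge_zero[of \<xi>] by linarith
      then have "1 \<le> (1 + l) ^ (2 * DIM('a)) * wt \<xi>"
        using wt_bound[of \<xi> l] True by (simp add: field_simps)
      then have "B * 1 \<le> B * ((1 + l) ^ (2 * DIM('a)) * wt \<xi>)" using B0 by (intro mult_left_mono) auto
      then show ?thesis using True l \<phi>(2)[of "norm \<xi>"] by (simp add: norm_mult mult.assoc w_def)
    qed (use B0 in \<open>auto simp: norm_mult w_def\<close>)
  qed
  \<comment> \<open>By hypothesis f is a step of height A ending at l, minus a tail integral. The
    step yields the truncated sum at l, and in the tail the condition norm xi < t turns into a
    truncation at radius t.\<close>
  have "(LINT \<xi>|M. of_real (if R \<le> norm \<xi> then \<phi> (norm \<xi>) * f (norm \<xi>) else 0) * ee (\<xi> \<bullet> x0))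
     = (LINT \<xi>|M. of_real A * (of_real (w \<xi> l) * ee (\<xi> \<bullet> x0)) - (LINT t|lborel. H (\<xi>, t)))"
  proof (rule Bochner_Integration.integral_cong[OF refl])
    fix \<xi> :: 'a
    show "of_real (if R \<le> norm \<xi> then \<phi> (norm \<xi>) * f (norm \<xi>) else 0) * ee (\<xi> \<bullet> x0)
       = of_real A * (of_real (w \<xi> l) * ee (\<xi> \<bullet> x0)) - (LINT t|lborel. H (\<xi>, t))"
    proof (cases "R \<le> norm \<xi>")
      case True
      have "(LINT t|lborel. H (\<xi>, t)) = (LINT t|lborel. complex_of_real (\<phi> (norm \<xi>) * (indicator {norm \<xi><..} t * f1 t)) * ee (\<xi> \<bullet> x0))"
        using True by (intro Bochner_Integration.integral_cong) (auto simp: H_def w_def indicator_def)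
      also have "\<dots> = of_real (\<phi> (norm \<xi>) * (LINT t|lborel. indicator {norm \<xi><..} t * f1 t)) * ee (\<xi> \<bullet> x0)"
        by (simp del: of_real_mult)
      finally have H_eq: "(LINT t|lborel. H (\<xi>, t)) = of_real (\<phi> (norm \<xi>) * (LINT t|lborel. indicator {norm \<xi><..} t * f1 t)) * ee (\<xi> \<bullet> x0)" .
      have "of_real (p * ((if b then A else 0) - I)) * E = of_real A * (of_real (if b then p else 0) * E) - of_real (p * I) * E"
        for p I and E :: complex and b by (simp add: algebra_simps)
      then show ?thesis unfolding H_eq f[OF True] w_def using True by simp
    qed (simp add: w_def H_def)
  qed
  also have "\<dots> = (LINT \<xi>|M. of_real A * (of_real (w \<xi> l) * ee (\<xi> \<bullet> x0))) - (LINT \<xi>|M. (LINT t|lborel. H (\<xi>, t)))"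
    by (rule Bochner_Integration.integral_diff[OF i1 i2])
  also have "(LINT \<xi>|M. of_real A * (of_real (w \<xi> l) * ee (\<xi> \<bullet> x0))) = of_real A * trunc_sum M x0 \<phi> R l"
    unfolding trunc_sum_def w_def by simp
  also have "(LINT \<xi>|M. (LINT t|lborel. H (\<xi>, t))) = (LINT t|lborel. of_real (f1 t) * trunc_sum M x0 \<phi> R t)"
    unfolding swap[symmetric] inner1 ..
  finally show "(LINT \<xi>|M. of_real (if R \<le> norm \<xi> then \<phi> (norm \<xi>) * f (norm \<xi>) else 0) * ee (\<xi> \<bullet> x0))
      = of_real A * trunc_sum M x0 \<phi> R l - (LINT t|lborel. of_real (f1 t) * trunc_sum M x0 \<phi> R t)" .
qed

lemma LINT_FTC_at_top:
  fixes F f :: "real \<Rightarrow> real"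
  assumes F: "\<And>t. t \<ge> r \<Longrightarrow> (F has_real_derivative f t) (at t)"
    and f: "integrable lborel (\<lambda>t. indicator {r<..} t * f t)"
    and lim: "(F \<longlongrightarrow> 0) at_top"
  shows "(LINT t|lborel. indicator {r<..} t * f t) = - F r"
proof -
  have eq: "(LINT t|lborel. indicator {r<..<r + real n} t * (indicator {r<..} t * f t)) = F (r + real n) - F r" for n
  proof -
    have "(f has_integral F (r + real n) - F r) {r..r + real n}"
      by (rule fundamental_theorem_of_calculus)
         (auto intro!: has_vector_derivative_at_within F[unfolded has_real_derivative_iff_has_vector_derivative])
    then have "(f has_integral F (r + real n) - F r) {r<..<r + real n}"
      by (simp add: has_integral_Icc_iff_Ioo)
    moreover have "set_integrable lborel {r<..<r + real n} (\<lambda>t. indicator {r<..} t * f t)"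
      unfolding set_integrable_def using integrable_mult_indicator[OF _ f] by simp
    note set_borel_integral_eq_integral[OF this]
    moreover have "integral {r<..<r + real n} (\<lambda>t. indicator {r<..} t * f t) = integral {r<..<r + real n} f"
      by (intro Henstock_Kurzweil_Integration.integral_cong) auto
    ultimately show ?thesis
      by (simp add: set_lebesgue_integral_def integral_unique)
  qed
  have "(\<lambda>n. LINT t|lborel. indicator {r<..<r + real n} t * (indicator {r<..} t * f t)) \<longlonglongrightarrow> (LINT t|lborel. indicator {r<..} t * f t)"
  proof (rule integral_dominated_convergence[where w="\<lambda>t. norm (indicator {r<..} t * f t)"])
    show "(\<lambda>t. indicator {r<..} t * f t) \<in> borel_measurable lborel" using f by simp
    show "(\<lambda>t. indicator {r<..<r + real n} t * (indicator {r<..} t * f t)) \<in> borel_measurable lborel" for n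
      by (rule borel_measurable_times[OF borel_measurable_indicator borel_measurable_integrable[OF f]]) simp
    show "AE t in lborel. (\<lambda>n. indicator {r<..<r + real n} t * (indicator {r<..} t * f t)) \<longlonglongrightarrow> indicator {r<..} t * f t"
    proof (rule AE_I2)
      fix t :: real
      have "\<forall>\<^sub>F n in sequentially. t - r < real n" by real_asymp
      then have "\<forall>\<^sub>F n in sequentially. indicator {r<..<r + real n} t * (indicator {r<..} t * f t) = indicator {r<..} t * f t"
        by eventually_elim (auto simp: indicator_def)
      then show "(\<lambda>n. indicator {r<..<r + real n} t * (indicator {r<..} t * f t)) \<longlonglongrightarrow> indicator {r<..} t * f t"
        by (rule tendsto_eventually)
    qed
  qed (use f in \<open>auto simp: indicator_def\<close>)
  moreover have "(\<lambda>n. F (r + real n) - F r) \<longlonglongrightarrow> 0 - F r"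
  proof (intro tendsto_diff tendsto_const)
    have "filterlim (\<lambda>n. r + real n) at_top sequentially" by real_asymp
    then show "(\<lambda>n. F (r + real n)) \<longlonglongrightarrow> 0" by (rule filterlim_compose[OF lim])
  qed
  ultimately show ?thesis unfolding eq using LIMSEQ_unique by fastforce
qed

section \<open>Defects of truncated sums\<close>

lemma countable_int_lattice: "countable (int_lattice :: 'a::euclidean_space set)"
proof -
  have "countable (Pi\<^sub>E (Basis :: 'a set) (\<lambda>_. \<int> :: real set))"
    by (intro countable_PiE) (auto simp: Ints_def)
  then show ?thesis using bij_betw_imp_surj_on[OF bij_vec_of_int_lattice] by (metis countable_image)
qed

lemma sigma_finite_int_lattice: "sigma_finite_measure (count_space (int_lattice :: 'a::euclidean_space set))"
  by (rule sigma_finite_measure_count_space_countable[OF countable_int_lattice])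

definition trunc_defect :: "'a::euclidean_space \<Rightarrow> (real \<Rightarrow> real) \<Rightarrow> real \<Rightarrow> real \<Rightarrow> complex" where
  "trunc_defect x0 \<phi> R t = trunc_sum (count_space int_lattice) x0 \<phi> R t - trunc_sum lborel x0 \<phi> R t"

definition defect :: "'a::euclidean_space \<Rightarrow> ('a \<Rightarrow> complex) \<Rightarrow> complex" where
  "defect x0 F = (LINT m|count_space int_lattice. F m * ee (m \<bullet> x0)) - (LINT \<xi>|lborel. F \<xi> * ee (\<xi> \<bullet> x0))"

text \<open>Peetre's inequality: a power of 1 + t may be replaced by the same power of 1 + l at the
  cost of a power of 1 + |t - l|, which the decay of the cutoff pays for.\<close>

lemma peetre_inequality:
  fixes t l q :: real
  assumes "t \<ge> 0" "l \<ge> 0"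
  shows "1 + t \<le> (1 + l) * (1 + \<bar>t - l\<bar>)"
    and "(1 + t) powr q \<le> (1 + l) powr q * (1 + \<bar>t - l\<bar>) powr \<bar>q\<bar>"
proof -
  have nn: "0 \<le> l * \<bar>t - l\<bar>" "0 \<le> t * \<bar>t - l\<bar>" using assms by auto
  show a: "1 + t \<le> (1 + l) * (1 + \<bar>t - l\<bar>)" using nn by (simp add: algebra_simps)
  have b: "1 + l \<le> (1 + t) * (1 + \<bar>t - l\<bar>)" using nn by (simp add: algebra_simps)
  show "(1 + t) powr q \<le> (1 + l) powr q * (1 + \<bar>t - l\<bar>) powr \<bar>q\<bar>"
  proof (cases "q \<ge> 0")
    case True
    have "(1 + t) powr q \<le> ((1 + l) * (1 + \<bar>t - l\<bar>)) powr q" using a assms True by (intro powr_mono2) auto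
    then show ?thesis using True assms by (simp add: powr_mult)
  next
    case False
    have "((1 + t) * (1 + \<bar>t - l\<bar>)) powr q \<le> (1 + l) powr q" using b assms False by (intro powr_mono2') auto
    then have "(1 + t) powr q * (1 + \<bar>t - l\<bar>) powr q * (1 + \<bar>t - l\<bar>) powr (-q) \<le> (1 + l) powr q * (1 + \<bar>t - l\<bar>) powr (-q)"
      using assms by (intro mult_right_mono) (auto simp: powr_mult)
    moreover have "(1 + \<bar>t - l\<bar>) powr q * (1 + \<bar>t - l\<bar>) powr (-q) = 1" by (simp flip: powr_add)
    ultimately show ?thesis using False by (simp add: mult.assoc)
  qed
qed

text \<open>The function g times (indicator minus cutoff) has a jump of size \<open>g l\<close> at l
  and elsewhere a derivative of order t powr kappa that decays fast in |t - l|. Summation by parts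
  therefore sees the truncated defects of \<open>\<phi>\<close> only near l, and the power of l in
  the bound does not grow by integration over t.\<close>

lemma defect_outside_cutoff_bound:
  fixes x0 :: "'a::euclidean_space" and \<eta> \<eta>' :: "real \<Rightarrow> real \<Rightarrow> real"
  assumes C0: "C0 > 0"
    and \<eta>': "\<And>l r. l > 0 \<Longrightarrow> (\<eta> l has_real_derivative \<eta>' l r) (at r)" "\<And>l. \<eta>' l \<in> borel_measurable borel"
    and \<eta>1: "\<And>l r. l > 0 \<Longrightarrow> r \<ge> 0 \<Longrightarrow> \<bar>(if r < l then 1 else 0) - \<eta> l r\<bar> \<le> C0 * inverse ((1 + \<bar>r - l\<bar>) ^ L)"
    and \<eta>2: "\<And>l r. l > 0 \<Longrightarrow> r \<ge> 0 \<Longrightarrow> \<bar>\<eta>' l r\<bar> \<le> C0 * inverse ((1 + \<bar>r - l\<bar>) ^ L)"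
    and \<eta>3: "\<And>l r. l > 0 \<Longrightarrow> r \<ge> 0 \<Longrightarrow> \<bar>\<eta> l r\<bar> \<le> C0 * (1 + l) ^ L * inverse ((1 + r) ^ L)"
    and \<phi>: "\<phi> \<in> borel_measurable borel" "\<And>r. r \<ge> 0 \<Longrightarrow> \<bar>\<phi> r\<bar> \<le> B"
    and R: "R \<ge> 0" and Cg: "Cg \<ge> 0"
    and g: "\<And>t. t \<ge> R \<Longrightarrow> (g has_real_derivative g' t) (at t)" "g' \<in> borel_measurable borel" "g \<in> borel_measurable borel"
      "\<And>t. t \<ge> R \<Longrightarrow> \<bar>g t\<bar> \<le> Cg * (1 + t) powr \<kappa>" "\<And>t. t \<ge> R \<Longrightarrow> \<bar>g' t\<bar> \<le> Cg * (1 + t) powr \<kappa>"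
    and D: "\<And>t. t \<ge> R \<Longrightarrow> norm (trunc_defect x0 \<phi> R t) \<le> K * (1 + t) powr \<alpha>"
    and L: "\<kappa> + 2 * DIM('a) + 2 \<le> L" "\<bar>\<kappa> + \<alpha>\<bar> + 2 \<le> L"
  shows "\<exists>K'. \<forall>l>0. l \<ge> R \<longrightarrow>
     norm (defect x0 (\<lambda>\<xi>. of_real (if R \<le> norm \<xi> then \<phi> (norm \<xi>) * (g (norm \<xi>) * ((if norm \<xi> < l then 1 else 0) - \<eta> l (norm \<xi>))) else 0)))
       \<le> K' * (1 + l) powr (\<kappa> + \<alpha>)"
proof -
  define J where "J = (LINT t|lborel. 1 / (1 + t\<^sup>2 :: real))"
  have K: "K \<ge> 0"
  proof -
    have "0 \<le> K * (1 + R) powr \<alpha>" using D[of R] by (meson norm_ge_zero order_refl order_trans)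
    moreover have "(1 + R) powr \<alpha> > 0" using R by simp
    ultimately show ?thesis by (simp add: zero_le_mult_iff)
  qed
  show ?thesis
  proof (intro exI[of _ "Cg * K + 2 * Cg * C0 * K * J"] allI impI)
    fix l assume l: "l > 0" "l \<ge> R"
    note [measurable] = \<eta>'(2)[of l] g(2,3)
    have "continuous_on UNIV (\<eta> l)"
      using \<eta>'(1)[OF l(1)] by (intro continuous_at_imp_continuous_on ballI DERIV_isCont)
    then have [measurable]: "\<eta> l \<in> borel_measurable borel" by (rule borel_measurable_continuous_onI)
    define ch where "ch t = (if t < l then 1 else 0) - \<eta> l t" for t
    \<comment> \<open>The derivative of g * ch away from the jump at l.\<close>
    define f1 where "f1 t = (if R \<le> t then g' t * ch t - g t * \<eta>' l t else 0)" for t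
    have mf1 [measurable]: "f1 \<in> borel_measurable borel" unfolding f1_def[abs_def] ch_def by measurable
    have f1b: "\<bar>f1 t\<bar> \<le> 2 * Cg * C0 * ((1 + t) powr \<kappa> * inverse ((1 + \<bar>t - l\<bar>) ^ L))" if t: "t \<ge> R" for t
    proof -
      let ?i = "inverse ((1 + \<bar>t - l\<bar>) ^ L)"
      have t0: "t \<ge> 0" using t R by simp
      have "\<bar>f1 t\<bar> \<le> \<bar>g' t\<bar> * \<bar>ch t\<bar> + \<bar>g t\<bar> * \<bar>\<eta>' l t\<bar>"
        unfolding f1_def using t abs_triangle_ineq4[of "g' t * ch t" "g t * \<eta>' l t"] by (simp add: abs_mult)
      also have "\<dots> \<le> (Cg * (1 + t) powr \<kappa>) * (C0 * ?i) + (Cg * (1 + t) powr \<kappa>) * (C0 * ?i)"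
        using g(4,5)[OF t] \<eta>1[OF l(1) t0] \<eta>2[OF l(1) t0] Cg C0 unfolding ch_def
        by (intro add_mono mult_mono) auto
      finally show ?thesis by (simp add: algebra_simps)
    qed
    have inv_le: "inverse ((1 + \<bar>t - l\<bar>) ^ L) \<le> (1 + l) ^ L * inverse ((1 + t) ^ L)" if "t \<ge> 0" for t
    proof -
      have "(1 + t) ^ L \<le> ((1 + l) * (1 + \<bar>t - l\<bar>)) ^ L"
        using peetre_inequality(1)[OF that, of l] l that by (intro power_mono) auto
      then have "(1 + t) ^ L \<le> (1 + l) ^ L * (1 + \<bar>t - l\<bar>) ^ L" by (simp only: power_mult_distrib)
      moreover have "(1 + t) ^ L > 0" "(1 + \<bar>t - l\<bar>) ^ L > 0" using that by (auto intro!: zero_less_power add_pos_nonneg)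
      ultimately show ?thesis by (simp add: field_simps)
    qed
    have dec: "(1 + t) powr \<kappa> * inverse ((1 + t) ^ L) \<le> inverse ((1 + t) ^ (2 * DIM('a) + 2))" if "t \<ge> 0" for t
    proof -
      have "(1 + t) powr \<kappa> * inverse ((1 + t) ^ L) = (1 + t) powr (\<kappa> - L)"
        using that by (simp add: powr_diff powr_realpow divide_inverse)
      also have "\<dots> \<le> (1 + t) powr (- real (2 * DIM('a) + 2))"
        using that L(1) by (intro powr_mono) auto
      also have "\<dots> = inverse ((1 + t) ^ (2 * DIM('a) + 2))"
        using that by (subst powr_minus, subst powr_realpow) auto
      finally show ?thesis .
    qed
    \<comment> \<open>Complements f1b: this bound is not uniform in l but decays in t itself, as
      Fubini's theorem in \<open>abel_summation\<close> requires. The final estimate uses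
      f1b.\<close>
    have f1c: "\<bar>f1 t\<bar> \<le> (2 * Cg * C0 * (1 + l) ^ L) * inverse ((1 + t) ^ (2 * DIM('a) + 2))" if t: "t \<ge> R" for t
    proof -
      have t0: "t \<ge> 0" using t R by simp
      have "(1 + t) powr \<kappa> * inverse ((1 + \<bar>t - l\<bar>) ^ L) \<le> (1 + t) powr \<kappa> * ((1 + l) ^ L * inverse ((1 + t) ^ L))"
        by (intro mult_left_mono inv_le t0) auto
      also have "\<dots> = (1 + l) ^ L * ((1 + t) powr \<kappa> * inverse ((1 + t) ^ L))" by simp
      also have "\<dots> \<le> (1 + l) ^ L * inverse ((1 + t) ^ (2 * DIM('a) + 2))"
        using l by (intro mult_left_mono dec t0) auto
      finally have "2 * Cg * C0 * ((1 + t) powr \<kappa> * inverse ((1 + \<bar>t - l\<bar>) ^ L)) \<le> 2 * Cg * C0 * ((1 + l) ^ L * inverse ((1 + t) ^ (2 * DIM('a) + 2)))"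
        using Cg C0 by (intro mult_left_mono) auto
      then show ?thesis using f1b[OF t] by (simp add: mult.assoc)
    qed
    have inv_sq: "inverse ((1 + t) ^ (2 * DIM('a) + 2)) \<le> 1 / (1 + t\<^sup>2)" if "t \<ge> 0" for t :: real
    proof -
      have "1 + t\<^sup>2 \<le> (1 + t)\<^sup>2" using that by (simp add: power2_sum)
      also have "\<dots> \<le> (1 + t) ^ (2 * DIM('a) + 2)" using that by (intro power_increasing) auto
      finally have "inverse ((1 + t) ^ (2 * DIM('a) + 2)) \<le> inverse (1 + t\<^sup>2)"
        by (intro le_imp_inverse_le) (auto simp: add_pos_nonneg)
      then show ?thesis by (simp add: inverse_eq_divide)
    qed
    have if1: "integrable lborel (\<lambda>t. indicator {r<..} t * f1 t)" if r: "r \<ge> R" for r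
    proof (rule integrable_norm_le)
      show "integrable lborel (\<lambda>t. 2 * Cg * C0 * (1 + l) ^ L * (1 / (1 + t\<^sup>2)))"
        by (intro integrable_mult_right integrable_inverse_square_lborel)
      fix t :: real
      show "norm (indicator {r<..} t * f1 t) \<le> 2 * Cg * C0 * (1 + l) ^ L * (1 / (1 + t\<^sup>2))"
      proof (cases "t > r")
        case True
        then have t: "t \<ge> R" "t \<ge> 0" using r R by auto
        have "\<bar>f1 t\<bar> \<le> (2 * Cg * C0 * (1 + l) ^ L) * inverse ((1 + t) ^ (2 * DIM('a) + 2))" by (rule f1c[OF t(1)])
        also have "\<dots> \<le> (2 * Cg * C0 * (1 + l) ^ L) * (1 / (1 + t\<^sup>2))"
          using Cg C0 l t by (intro mult_left_mono inv_sq) auto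
        finally show ?thesis using True by simp
      qed (use Cg C0 l in \<open>auto simp: add_nonneg_nonneg\<close>)
    qed measurable
    \<comment> \<open>The product is g cut off at l minus g times the cutoff. The first part yields
      the step of height g l together with an integral of g' over (r, l); the second vanishes at
      infinity and is minus the integral of its derivative.\<close>
    have f_eq: "g r * ch r = (if r < l then g l else 0) - (LINT t|lborel. indicator {r<..} t * f1 t)" if r: "r \<ge> R" for r
    proof -
      have lim: "((\<lambda>t. g t * \<eta> l t) \<longlongrightarrow> 0) at_top"
      proof (rule Lim_null_comparison)
        show "\<forall>\<^sub>F t in at_top. norm (g t * \<eta> l t) \<le> Cg * C0 * (1 + l) ^ L * inverse ((1 + t) ^ (2 * DIM('a) + 2))"
          using eventually_ge_at_top[of R]
        proof eventually_elim
          fix t assume t: "t \<ge> R"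
          then have t0: "t \<ge> 0" using R by simp
          have "\<bar>g t\<bar> * \<bar>\<eta> l t\<bar> \<le> (Cg * (1 + t) powr \<kappa>) * (C0 * (1 + l) ^ L * inverse ((1 + t) ^ L))"
            using g(4)[OF t] \<eta>3[OF l(1) t0] Cg by (intro mult_mono) auto
          also have "\<dots> = Cg * C0 * (1 + l) ^ L * ((1 + t) powr \<kappa> * inverse ((1 + t) ^ L))" by simp
          also have "\<dots> \<le> Cg * C0 * (1 + l) ^ L * inverse ((1 + t) ^ (2 * DIM('a) + 2))"
            using Cg C0 l by (intro mult_left_mono dec t0) auto
          finally show "norm (g t * \<eta> l t) \<le> Cg * C0 * (1 + l) ^ L * inverse ((1 + t) ^ (2 * DIM('a) + 2))"
            by (simp add: abs_mult)
        qed
        have "((\<lambda>t::real. inverse ((1 + t) ^ (2 * DIM('a) + 2))) \<longlongrightarrow> 0) at_top"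
          by (intro tendsto_inverse_0_at_top filterlim_pow_at_top filterlim_tendsto_add_at_top[OF tendsto_const filterlim_ident]) auto
        then show "((\<lambda>t. Cg * C0 * (1 + l) ^ L * inverse ((1 + t) ^ (2 * DIM('a) + 2))) \<longlongrightarrow> 0) at_top"
          by (rule tendsto_mult_right_zero)
      qed
      have f1_alt: "f1 t = (if t < l then g' t else 0) - (g' t * \<eta> l t + g t * \<eta>' l t)" if "t \<ge> R" for t
        using that by (simp add: f1_def ch_def algebra_simps)
      define F where "F t = (if t < l then g t else g l) - g l - g t * \<eta> l t" for t
      have fin_ivl: "emeasure lborel {r<..<l} < \<infinity>"
        by (rule emeasure_bounded_finite[OF bounded_subset[OF bounded_closed_interval[of r l]]]) auto
      have int2: "integrable lborel (\<lambda>t. indicator {r<..<l} t * g' t)"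
      proof (rule integrable_norm_le[of lborel "\<lambda>t. indicator {r<..<l} t * (Cg * ((1 + l) powr \<bar>\<kappa>\<bar> * 1))"])
        show "integrable lborel (\<lambda>t. indicator {r<..<l} t * (Cg * ((1 + l) powr \<bar>\<kappa>\<bar> * 1)))"
          by (intro integrable_mult_left integrable_real_indicator) (use fin_ivl in auto)
        fix t :: real
        show "norm (indicator {r<..<l} t * g' t) \<le> indicator {r<..<l} t * (Cg * ((1 + l) powr \<bar>\<kappa>\<bar> * 1))"
        proof (cases "t \<in> {r<..<l}")
          case True
          then have t: "t \<ge> R" "t \<ge> 0" "t < l" using r R by auto
          have "\<bar>g' t\<bar> \<le> Cg * (1 + t) powr \<kappa>" by (rule g(5)[OF t(1)])
          also have "\<dots> \<le> Cg * (1 + t) powr \<bar>\<kappa>\<bar>" using t Cg by (intro mult_left_mono powr_mono) auto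
          also have "\<dots> \<le> Cg * (1 + l) powr \<bar>\<kappa>\<bar>" using t Cg by (intro mult_left_mono powr_mono2) auto
          finally show ?thesis using True by simp
        qed simp
      qed measurable
      have int3: "integrable lborel (\<lambda>t. indicator {r<..} t * (g' t * \<eta> l t + g t * \<eta>' l t))"
      proof -
        have "integrable lborel (\<lambda>t. indicator {r<..<l} t * g' t - indicator {r<..} t * f1 t)"
          using int2 if1[OF r] by (rule Bochner_Integration.integrable_diff)
        also have "(\<lambda>t. indicator {r<..<l} t * g' t - indicator {r<..} t * f1 t) = (\<lambda>t. indicator {r<..} t * (g' t * \<eta> l t + g t * \<eta>' l t))"
          using f1_alt r by (auto simp: fun_eq_iff indicator_def)
        finally show ?thesis .
      qed
      have I3: "(LINT t|lborel. indicator {r<..} t * (g' t * \<eta> l t + g t * \<eta>' l t)) = - (g r * \<eta> l r)"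
      proof (rule LINT_FTC_at_top[OF _ int3 lim])
        fix t assume "t \<ge> r"
        then have "t \<ge> R" using r by simp
        from DERIV_mult[OF g(1)[OF this] \<eta>'(1)[OF l(1), of t]]
        show "((\<lambda>t. g t * \<eta> l t) has_real_derivative g' t * \<eta> l t + g t * \<eta>' l t) (at t)" by (simp add: mult_ac add_ac)
      qed
      have I2: "(LINT t|lborel. indicator {r<..<l} t * g' t) = (if r < l then g l - g r else 0)"
      proof (cases "r < l")
        case True
        have "(g' has_integral g l - g r) {r..l}"
          using True r by (intro fundamental_theorem_of_calculus)
            (auto intro!: has_vector_derivative_at_within g(1)[unfolded has_real_derivative_iff_has_vector_derivative])
        then have "(g' has_integral g l - g r) {r<..<l}" by (simp add: has_integral_Icc_iff_Ioo)
        moreover have "set_integrable lborel {r<..<l} g'" unfolding set_integrable_def using int2 by simp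
        note set_borel_integral_eq_integral[OF this]
        ultimately show ?thesis using True by (simp add: set_lebesgue_integral_def integral_unique)
      qed simp
      have "(LINT t|lborel. indicator {r<..} t * f1 t) = (LINT t|lborel. indicator {r<..<l} t * g' t - indicator {r<..} t * (g' t * \<eta> l t + g t * \<eta>' l t))"
        using f1_alt r by (intro Bochner_Integration.integral_cong) (auto simp: indicator_def)
      also have "\<dots> = (if r < l then g l - g r else 0) + g r * \<eta> l r"
        using int2 int3 I2 I3 by (simp add: Bochner_Integration.integral_diff)
      finally show ?thesis by (auto simp: ch_def algebra_simps)
    qed
    \<comment> \<open>The same summation by parts is carried out for both measures, and the two
      results are subtracted so that only truncated defects remain.\<close>
    let ?F = "\<lambda>\<xi> :: 'a. complex_of_real (if R \<le> norm \<xi> then \<phi> (norm \<xi>) * (g (norm \<xi>) * ch (norm \<xi>)) else 0)"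
    note T1 = abel_summation[OF sigma_finite_int_lattice _ integrable_wt_int_lattice \<phi> mf1 f1c R f_eq, where ?x0.0=x0]
    note T2 = abel_summation[OF lborel.sigma_finite_measure_axioms _ integrable_wt_lborel \<phi> mf1 f1c R f_eq, where ?x0.0=x0]
    have m1: "(\<lambda>x. x) \<in> borel_measurable (count_space (int_lattice :: 'a set))" by simp
    have m2: "(\<lambda>x. x) \<in> borel_measurable (lborel :: 'a measure)" by simp
    have T1a: "(LINT m|count_space int_lattice. ?F m * ee (m \<bullet> x0)) = of_real (g l) * trunc_sum (count_space int_lattice) x0 \<phi> R l - (LINT t|lborel. of_real (f1 t) * trunc_sum (count_space int_lattice) x0 \<phi> R t)"
      by (rule T1(1)[OF m1])
    have T2a: "(LINT m|lborel. ?F m * ee (m \<bullet> x0)) = of_real (g l) * trunc_sum lborel x0 \<phi> R l - (LINT t|lborel. of_real (f1 t) * trunc_sum lborel x0 \<phi> R t)"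
      by (rule T2(1)[OF m2])
    have eq: "defect x0 ?F = of_real (g l) * trunc_defect x0 \<phi> R l - (LINT t|lborel. of_real (f1 t) * trunc_defect x0 \<phi> R t)"
      unfolding defect_def T1a T2a trunc_defect_def right_diff_distrib
      using Bochner_Integration.integral_diff[OF T1(2)[OF m1] T2(2)[OF m2]] by simp
    have bI: "norm (LINT t|lborel. of_real (f1 t) * trunc_defect x0 \<phi> R t) \<le> (LINT t|lborel. 2 * Cg * C0 * K * (1 + l) powr (\<kappa> + \<alpha>) * (1 / (1 + (- l + 1 * t)\<^sup>2)))"
    proof (rule norm_LINT_le)
      show "integrable lborel (\<lambda>t. 2 * Cg * C0 * K * (1 + l) powr (\<kappa> + \<alpha>) * (1 / (1 + (- l + 1 * t)\<^sup>2)))"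
        by (intro integrable_mult_right lborel_integrable_real_affine[where f="\<lambda>t. 1 / (1 + t\<^sup>2)"] integrable_inverse_square_lborel) simp
      fix t :: real
      show "norm (of_real (f1 t) * trunc_defect x0 \<phi> R t) \<le> 2 * Cg * C0 * K * (1 + l) powr (\<kappa> + \<alpha>) * (1 / (1 + (- l + 1 * t)\<^sup>2))"
      proof (cases "t \<ge> R")
        case True
        then have t: "t \<ge> 0" using R by simp
        let ?s = "\<bar>t - l\<bar>"
        have "norm (of_real (f1 t) * trunc_defect x0 \<phi> R t) \<le> (2 * Cg * C0 * ((1 + t) powr \<kappa> * inverse ((1 + ?s) ^ L))) * (K * (1 + t) powr \<alpha>)"
          unfolding norm_mult using f1b[OF True] D[OF True] Cg C0 by (intro mult_mono) auto
        also have "\<dots> = 2 * Cg * C0 * K * ((1 + t) powr (\<kappa> + \<alpha>) * inverse ((1 + ?s) ^ L))" by (simp add: powr_add)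
        also have "\<dots> \<le> 2 * Cg * C0 * K * (((1 + l) powr (\<kappa> + \<alpha>) * (1 + ?s) powr \<bar>\<kappa> + \<alpha>\<bar>) * inverse ((1 + ?s) ^ L))"
          using Cg C0 K peetre_inequality(2)[OF t, of l "\<kappa> + \<alpha>"] l by (intro mult_left_mono mult_right_mono) auto
        also have "\<dots> = 2 * Cg * C0 * K * (1 + l) powr (\<kappa> + \<alpha>) * ((1 + ?s) powr \<bar>\<kappa> + \<alpha>\<bar> * inverse ((1 + ?s) ^ L))" by simp
        also have "\<dots> \<le> 2 * Cg * C0 * K * (1 + l) powr (\<kappa> + \<alpha>) * (1 / (1 + (- l + 1 * t)\<^sup>2))"
        proof (intro mult_left_mono)
          have "(1 + ?s) powr \<bar>\<kappa> + \<alpha>\<bar> * inverse ((1 + ?s) ^ L) = (1 + ?s) powr (\<bar>\<kappa> + \<alpha>\<bar> - L)"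
            by (simp add: powr_diff powr_realpow divide_inverse)
          also have "\<dots> \<le> (1 + ?s) powr (- 2)" using L(2) by (intro powr_mono) auto
          also have "\<dots> = inverse ((1 + ?s)\<^sup>2)" by (simp add: powr_minus powr_numeral)
          also have "\<dots> \<le> inverse (1 + (- l + 1 * t)\<^sup>2)"
          proof (rule le_imp_inverse_le)
            have "1 + u\<^sup>2 \<le> (1 + u)\<^sup>2" if "u \<ge> 0" for u :: real using that by (simp add: power2_sum)
            from this[of ?s] show "1 + (- l + 1 * t)\<^sup>2 \<le> (1 + ?s)\<^sup>2" by simp
            show "0 < 1 + (- l + 1 * t)\<^sup>2" by (rule add_pos_nonneg) auto
          qed
          finally show "(1 + ?s) powr \<bar>\<kappa> + \<alpha>\<bar> * inverse ((1 + ?s) ^ L) \<le> 1 / (1 + (- l + 1 * t)\<^sup>2)" by (simp add: inverse_eq_divide)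
        qed (use Cg C0 K in auto)
        finally show ?thesis .
      next
        case False
        then show ?thesis using Cg C0 K by (simp add: f1_def add_nonneg_nonneg)
      qed
    qed
    also have "(LINT t|lborel. 2 * Cg * C0 * K * (1 + l) powr (\<kappa> + \<alpha>) * (1 / (1 + (- l + 1 * t)\<^sup>2))) = 2 * Cg * C0 * K * (1 + l) powr (\<kappa> + \<alpha>) * (LINT t|lborel. 1 / (1 + (- l + 1 * t)\<^sup>2))"
      by (rule integral_mult_right_zero)
    also have "(LINT t|lborel. 1 / (1 + (- l + 1 * t)\<^sup>2)) = J"
      unfolding J_def by (subst (2) lborel_integral_real_affine[where c=1 and t="-l"]) auto
    finally have b2: "norm (LINT t|lborel. of_real (f1 t) * trunc_defect x0 \<phi> R t) \<le> 2 * Cg * C0 * K * (1 + l) powr (\<kappa> + \<alpha>) * J" .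
    have b1: "norm (of_real (g l) * trunc_defect x0 \<phi> R l) \<le> (Cg * (1 + l) powr \<kappa>) * (K * (1 + l) powr \<alpha>)"
      unfolding norm_mult using g(4)[OF l(2)] D[OF l(2)] Cg by (intro mult_mono) auto
    have "norm (defect x0 ?F) \<le> (Cg * (1 + l) powr \<kappa>) * (K * (1 + l) powr \<alpha>) + 2 * Cg * C0 * K * (1 + l) powr (\<kappa> + \<alpha>) * J"
      unfolding eq by (rule order_trans[OF norm_triangle_ineq4 add_mono[OF b1 b2]])
    also have "\<dots> = (Cg * K + 2 * Cg * C0 * K * J) * (1 + l) powr (\<kappa> + \<alpha>)"
      by (simp add: powr_add algebra_simps)
    finally show "norm (defect x0 (\<lambda>\<xi>. of_real (if R \<le> norm \<xi> then \<phi> (norm \<xi>) * (g (norm \<xi>) * ((if norm \<xi> < l then 1 else 0) - \<eta> l (norm \<xi>))) else 0)))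
       \<le> (Cg * K + 2 * Cg * C0 * K * J) * (1 + l) powr (\<kappa> + \<alpha>)"
      unfolding ch_def .
  qed
qed

lemma borel_measurable_W:
  assumes "\<mu> > -1" "a > 0"
  shows "W \<mu> a \<in> borel_measurable borel"
  using continuous_on_W[OF assms continuous_on_id, of UNIV] by (intro borel_measurable_continuous_onI) simp

section \<open>The two directions\<close>

text \<open>The witnesses are \<open>g = r powr (\<mu> + 1) * w\<^sub>\<mu> / (w\<^sub>\<mu>\<^sup>2 + w\<^sub>\<nu>\<^sup>2)\<close> with \<open>w\<^sub>\<rho> = r powr (\<rho> + 1) * W \<rho> a r\<close>,
  and likewise for \<open>h\<close>.\<close>

lemma partition_exists:
  assumes \<mu>: "\<mu> > -1" "\<nu> > -1" "0 < \<mu> - \<nu>" "\<mu> - \<nu> < 2" and a: "a > 0"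
  obtains R g h g' h' C where "R \<ge> 1" "C \<ge> 0"
    "\<And>r. r \<ge> R \<Longrightarrow> g r * W \<mu> a r + h r * W \<nu> a r = 1"
    "\<And>r. r \<ge> R \<Longrightarrow> 0 \<le> g r * W \<mu> a r" "\<And>r. r \<ge> R \<Longrightarrow> 0 \<le> h r * W \<nu> a r"
    "\<And>r. r \<ge> R \<Longrightarrow> (g has_real_derivative g' r) (at r)"
    "\<And>r. r \<ge> R \<Longrightarrow> (h has_real_derivative h' r) (at r)"
    "g \<in> borel_measurable borel" "h \<in> borel_measurable borel" "g' \<in> borel_measurable borel" "h' \<in> borel_measurable borel"
    "\<And>r. r \<ge> R \<Longrightarrow> \<bar>g r\<bar> \<le> C * (1 + r) powr (\<mu> + 1)" "\<And>r. r \<ge> R \<Longrightarrow> \<bar>g' r\<bar> \<le> C * (1 + r) powr (\<mu> + 1)"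
    "\<And>r. r \<ge> R \<Longrightarrow> \<bar>h r\<bar> \<le> C * (1 + r) powr (\<mu> + 1)" "\<And>r. r \<ge> R \<Longrightarrow> \<bar>h' r\<bar> \<le> C * (1 + r) powr (\<mu> + 1)"
proof -
  obtain c R where cR: "c > 0" "R \<ge> 1"
    "\<And>r. r \<ge> R \<Longrightarrow> c \<le> r powr (\<mu> + 1) * \<bar>W \<mu> a r\<bar> + r powr (\<nu> + 1) * \<bar>W \<nu> a r\<bar>"
    using W_pair_lower[OF \<mu> a] by blast
  define w where "w \<rho> r = r powr (\<rho> + 1) * W \<rho> a r" for \<rho> r
  define w' where "w' \<rho> r = (\<rho> + 1) * r powr \<rho> * W \<rho> a r + r powr (\<rho> + 1) * (- (2 * pi\<^sup>2 * r / (\<rho> + 1)) * W (\<rho> + 1) a r)" for \<rho> r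
  define Q where "Q r = (w \<mu> r)\<^sup>2 + (w \<nu> r)\<^sup>2" for r
  define Q' where "Q' r = 2 * (w \<mu> r * w' \<mu> r) + 2 * (w \<nu> r * w' \<nu> r)" for r
  define G where "G \<rho> r = r powr (\<rho> + 1) * w \<rho> r / Q r" for \<rho> r
  define G' where "G' \<rho> r = (((\<rho> + 1) * r powr \<rho> * w \<rho> r + r powr (\<rho> + 1) * w' \<rho> r) * Q r - r powr (\<rho> + 1) * w \<rho> r * Q' r) / (Q r * Q r)" for \<rho> r
  have mW: "W \<rho> a \<in> borel_measurable borel" "W (\<rho> + 1) a \<in> borel_measurable borel" if "\<rho> \<in> {\<mu>, \<nu>}" for \<rho>
    using that \<mu> a by (auto intro!: borel_measurable_W)
  have mw: "w \<rho> \<in> borel_measurable borel" "w' \<rho> \<in> borel_measurable borel" if "\<rho> \<in> {\<mu>, \<nu>}" for \<rho>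
  proof -
    note [measurable] = mW[OF that]
    show "w \<rho> \<in> borel_measurable borel" "w' \<rho> \<in> borel_measurable borel"
      unfolding w_def[abs_def] w'_def[abs_def] by measurable
  qed
  have mQ: "Q \<in> borel_measurable borel" "Q' \<in> borel_measurable borel"
  proof -
    note [measurable] = mw[of \<mu>, simplified] mw[of \<nu>, simplified]
    show "Q \<in> borel_measurable borel" "Q' \<in> borel_measurable borel"
      unfolding Q_def[abs_def] Q'_def[abs_def] by measurable
  qed
  have mG: "G \<rho> \<in> borel_measurable borel" "G' \<rho> \<in> borel_measurable borel" if "\<rho> \<in> {\<mu>, \<nu>}" for \<rho>
  proof -
    note [measurable] = mw[OF that] mQ
    show "G \<rho> \<in> borel_measurable borel" "G' \<rho> \<in> borel_measurable borel"
      unfolding G_def[abs_def] G'_def[abs_def] by measurable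
  qed
  have dw: "(w \<rho> has_real_derivative w' \<rho> r) (at r)" if "\<rho> \<in> {\<mu>, \<nu>}" "r \<ge> R" for \<rho> r
  proof -
    have \<rho>: "\<rho> > -1" using that \<mu> by auto
    have r: "r > 0" using that cR by simp
    have "((\<lambda>r. r powr (\<rho> + 1)) has_real_derivative (\<rho> + 1) * r powr (\<rho> + 1 - 1)) (at r)"
      by (rule has_real_derivative_powr[OF r])
    from DERIV_mult[OF this W_deriv[OF \<rho> a, of r]] show ?thesis
      unfolding w_def[abs_def] w'_def by (simp add: mult_ac add_ac)
  qed
  \<comment> \<open>Normalized by their decay, both functions and their derivatives are bounded, so
    quotients of them with denominator bounded below keep this property.\<close>
  obtain B where B: "B > 0" "\<And>\<rho> r. \<rho> \<in> {\<mu>, \<nu>} \<Longrightarrow> r \<ge> R \<Longrightarrow> \<bar>w \<rho> r\<bar> \<le> B" "\<And>\<rho> r. \<rho> \<in> {\<mu>, \<nu>} \<Longrightarrow> r \<ge> R \<Longrightarrow> \<bar>w' \<rho> r\<bar> \<le> B"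
  proof -
    have ex: "\<exists>B>0. \<forall>r\<ge>R. \<bar>w \<rho> r\<bar> \<le> B \<and> \<bar>w' \<rho> r\<bar> \<le> B" if rho: "\<rho> > -1" for \<rho>
    proof -
      obtain C1 where C1: "C1 > 0" "\<And>r. r \<ge> 0 \<Longrightarrow> \<bar>W \<rho> a r\<bar> \<le> C1 * (1 + r) powr (- \<rho> - 1)"
        using W_bound[OF rho a] by blast
      obtain C2 where C2: "C2 > 0" "\<And>r. r \<ge> 0 \<Longrightarrow> \<bar>2 * pi\<^sup>2 * r / (\<rho> + 1) * W (\<rho> + 1) a r\<bar> \<le> C2 * (1 + r) powr (- \<rho> - 1)"
        using W_deriv_bound[OF rho a] by blast
      have key: "r powr (\<rho> + 1) * (D * (1 + r) powr (- \<rho> - 1)) \<le> D" if r: "r \<ge> R" and D: "D > 0" for r D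
      proof -
        have "r powr (\<rho> + 1) \<le> (1 + r) powr (\<rho> + 1)" using r cR \<open>\<rho> > -1\<close> by (intro powr_mono2) auto
        then have "r powr (\<rho> + 1) * (D * (1 + r) powr (- \<rho> - 1)) \<le> (1 + r) powr (\<rho> + 1) * (D * (1 + r) powr (- \<rho> - 1))"
          using D by (intro mult_right_mono) auto
        also have "\<dots> = D * ((1 + r) powr (\<rho> + 1) * (1 + r) powr (- \<rho> - 1))" by simp
        also have "(1 + r) powr (\<rho> + 1) * (1 + r) powr (- \<rho> - 1) = 1" using r cR by (simp flip: powr_add)
        finally show ?thesis by simp
      qed
      show ?thesis
      proof (intro exI[of _ "C1 + (\<rho> + 1) * C1 + C2"] conjI allI impI)
        have p: "0 < (\<rho> + 1) * C1" using that C1 by simp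
        then show "0 < C1 + (\<rho> + 1) * C1 + C2" using C1 C2 by simp
        fix r assume r: "r \<ge> R"
        then have r1: "r \<ge> 1" using cR by simp
        have "\<bar>w \<rho> r\<bar> \<le> r powr (\<rho> + 1) * (C1 * (1 + r) powr (- \<rho> - 1))"
          unfolding w_def abs_mult using C1(2)[of r] r1 by (intro mult_mono) auto
        also have "\<dots> \<le> C1" by (rule key[OF r C1(1)])
        finally have wb: "\<bar>w \<rho> r\<bar> \<le> C1" .
        then show "\<bar>w \<rho> r\<bar> \<le> C1 + (\<rho> + 1) * C1 + C2" using p C2 by simp
        have "\<bar>w' \<rho> r\<bar> \<le> \<bar>(\<rho> + 1) * r powr \<rho> * W \<rho> a r\<bar> + \<bar>r powr (\<rho> + 1) * (- (2 * pi\<^sup>2 * r / (\<rho> + 1)) * W (\<rho> + 1) a r)\<bar>"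
          unfolding w'_def by (rule abs_triangle_ineq)
        also have "\<bar>(\<rho> + 1) * r powr \<rho> * W \<rho> a r\<bar> \<le> (\<rho> + 1) * \<bar>w \<rho> r\<bar>"
        proof -
          have "r powr \<rho> \<le> r powr (\<rho> + 1)" using r1 by (intro powr_mono) auto
          then have "r powr \<rho> * \<bar>W \<rho> a r\<bar> \<le> r powr (\<rho> + 1) * \<bar>W \<rho> a r\<bar>" by (intro mult_right_mono) auto
          then show ?thesis unfolding w_def using that by (simp add: abs_mult mult.assoc mult_left_mono)
        qed
        also have "\<bar>r powr (\<rho> + 1) * (- (2 * pi\<^sup>2 * r / (\<rho> + 1)) * W (\<rho> + 1) a r)\<bar> \<le> r powr (\<rho> + 1) * (C2 * (1 + r) powr (- \<rho> - 1))"
        proof -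
          have "\<bar>r powr (\<rho> + 1) * (- (2 * pi\<^sup>2 * r / (\<rho> + 1)) * W (\<rho> + 1) a r)\<bar> = r powr (\<rho> + 1) * \<bar>2 * pi\<^sup>2 * r / (\<rho> + 1) * W (\<rho> + 1) a r\<bar>"
            by (simp add: abs_mult)
          also have "\<dots> \<le> r powr (\<rho> + 1) * (C2 * (1 + r) powr (- \<rho> - 1))"
            using C2(2)[of r] r1 by (intro mult_left_mono) auto
          finally show ?thesis .
        qed
        also have "r powr (\<rho> + 1) * (C2 * (1 + r) powr (- \<rho> - 1)) \<le> C2" by (rule key[OF r C2(1)])
        finally have "\<bar>w' \<rho> r\<bar> \<le> (\<rho> + 1) * \<bar>w \<rho> r\<bar> + C2" by simp
        also have "(\<rho> + 1) * \<bar>w \<rho> r\<bar> \<le> (\<rho> + 1) * C1" using wb that by (intro mult_left_mono) auto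
        finally show "\<bar>w' \<rho> r\<bar> \<le> C1 + (\<rho> + 1) * C1 + C2" using C1 by simp
      qed
    qed
    obtain B1 where B1: "B1 > 0" "\<forall>r\<ge>R. \<bar>w \<mu> r\<bar> \<le> B1 \<and> \<bar>w' \<mu> r\<bar> \<le> B1" using ex[OF \<mu>(1)] by blast
    obtain B2 where B2: "B2 > 0" "\<forall>r\<ge>R. \<bar>w \<nu> r\<bar> \<le> B2 \<and> \<bar>w' \<nu> r\<bar> \<le> B2" using ex[OF \<mu>(2)] by blast
    show ?thesis
    proof (rule that[of "B1 + B2"])
      show "\<bar>w \<rho> r\<bar> \<le> B1 + B2" "\<bar>w' \<rho> r\<bar> \<le> B1 + B2" if "\<rho> \<in> {\<mu>, \<nu>}" "r \<ge> R" for \<rho> r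
        using that B1 B2 by (auto intro: order_trans)
    qed (use B1 B2 in auto)
  qed
  \<comment> \<open>The lower bound c for the sum of the two moduli gives c^2 / 2 for the sum of the
    squares.\<close>
  define q where "q = c\<^sup>2 / 2"
  have q: "q > 0" using cR by (simp add: q_def)
  have Qlow: "Q r \<ge> q" if "r \<ge> R" for r
  proof -
    have "c \<le> \<bar>w \<mu> r\<bar> + \<bar>w \<nu> r\<bar>" using cR(3)[OF that] by (simp add: w_def abs_mult)
    then have "c\<^sup>2 \<le> (\<bar>w \<mu> r\<bar> + \<bar>w \<nu> r\<bar>)\<^sup>2" using cR(1) by (intro power_mono) auto
    also have "\<dots> \<le> 2 * (\<bar>w \<mu> r\<bar>\<^sup>2 + \<bar>w \<nu> r\<bar>\<^sup>2)"
      using zero_le_power2[of "\<bar>w \<mu> r\<bar> - \<bar>w \<nu> r\<bar>"] by (simp only: power2_sum power2_diff) (simp add: algebra_simps)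
    finally show ?thesis by (simp add: q_def Q_def)
  qed
  have dQ: "(Q has_real_derivative Q' r) (at r)" if "r \<ge> R" for r
    unfolding Q_def[abs_def] Q'_def
    using DERIV_add[OF DERIV_power[OF dw[of \<mu> r], of 2] DERIV_power[OF dw[of \<nu> r], of 2]] that by (simp add: mult_ac)
  have dG: "(G \<rho> has_real_derivative G' \<rho> r) (at r)" if "\<rho> \<in> {\<mu>, \<nu>}" "r \<ge> R" for \<rho> r
  proof -
    have r: "r > 0" using that cR by simp
    have "((\<lambda>r. r powr (\<rho> + 1)) has_real_derivative (\<rho> + 1) * r powr (\<rho> + 1 - 1)) (at r)"
      by (rule has_real_derivative_powr[OF r])
    from DERIV_mult[OF this dw[OF that]]
    have "((\<lambda>r. r powr (\<rho> + 1) * w \<rho> r) has_real_derivative (\<rho> + 1) * r powr \<rho> * w \<rho> r + r powr (\<rho> + 1) * w' \<rho> r) (at r)"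
      by (simp add: mult_ac add_ac)
    from DERIV_divide[OF this dQ[OF that(2)]] Qlow[OF that(2)] q show ?thesis
      unfolding G_def[abs_def] G'_def by auto
  qed
  have Qup: "Q r \<le> 2 * B\<^sup>2" "\<bar>Q' r\<bar> \<le> 4 * B\<^sup>2" if "r \<ge> R" for r
  proof -
    have s: "(w \<rho> r)\<^sup>2 \<le> B\<^sup>2" "\<bar>w \<rho> r * w' \<rho> r\<bar> \<le> B\<^sup>2" if "\<rho> \<in> {\<mu>, \<nu>}" for \<rho>
    proof -
      show "(w \<rho> r)\<^sup>2 \<le> B\<^sup>2" using B(2)[OF that \<open>r \<ge> R\<close>] B(1) by (simp add: abs_le_square_iff[symmetric])
      show "\<bar>w \<rho> r * w' \<rho> r\<bar> \<le> B\<^sup>2" unfolding abs_mult power2_eq_square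
        using B(2,3)[OF that \<open>r \<ge> R\<close>] B(1) by (intro mult_mono) auto
    qed
    show "Q r \<le> 2 * B\<^sup>2" unfolding Q_def using s(1)[of \<mu>] s(1)[of \<nu>] by simp
    show "\<bar>Q' r\<bar> \<le> 4 * B\<^sup>2" unfolding Q'_def using s(2)[of \<mu>] s(2)[of \<nu>] by auto
  qed
  define C where "C = B / q + ((\<mu> + 1) * B + B) / q + B * (4 * B\<^sup>2) / (q * q)"
  have "0 \<le> (\<mu> + 1) * B" using B \<mu> by (intro mult_nonneg_nonneg) auto
  then have cs: "0 \<le> B / q" "0 \<le> ((\<mu> + 1) * B + B) / q" "0 \<le> B * (4 * B\<^sup>2) / (q * q)"
    using B q by auto
  then have C: "C \<ge> 0" unfolding C_def by simp
  have Gb: "\<bar>G \<rho> r\<bar> \<le> C * (1 + r) powr (\<mu> + 1)" "\<bar>G' \<rho> r\<bar> \<le> C * (1 + r) powr (\<mu> + 1)" if \<rho>: "\<rho> \<in> {\<mu>, \<nu>}" and r: "r \<ge> R" for \<rho> r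
  proof -
    have r1: "r \<ge> 1" using r cR by simp
    have \<rho>1: "\<rho> > -1" "\<rho> \<le> \<mu>" using \<rho> \<mu> by auto
    let ?p = "(1 + r) powr (\<mu> + 1)"
    have pp: "?p \<ge> 0" by simp
    \<comment> \<open>Both witnesses are measured by the larger exponent mu + 1.\<close>
    have p1: "r powr (\<rho> + 1) \<le> ?p"
    proof -
      have "r powr (\<rho> + 1) \<le> (1 + r) powr (\<rho> + 1)" using r1 \<rho>1 by (intro powr_mono2) auto
      also have "\<dots> \<le> ?p" using r1 \<rho>1 by (intro powr_mono) auto
      finally show ?thesis .
    qed
    have p0: "r powr \<rho> \<le> ?p"
    proof -
      have "r powr \<rho> \<le> r powr (\<rho> + 1)" using r1 by (intro powr_mono) auto
      then show ?thesis using p1 by simp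
    qed
    have Qr: "Q r \<ge> q" "Q r > 0" using Qlow[OF r] q by auto
    have n: "\<bar>r powr (\<rho> + 1) * w \<rho> r\<bar> \<le> ?p * B"
      unfolding abs_mult using p1 B(2)[OF \<rho> r] B(1) by (intro mult_mono) auto
    have "\<bar>G \<rho> r\<bar> = \<bar>r powr (\<rho> + 1) * w \<rho> r\<bar> / Q r" unfolding G_def using Qr by simp
    also have "\<dots> \<le> ?p * B / q" using n Qr q B by (intro frac_le) auto
    finally have G1: "\<bar>G \<rho> r\<bar> \<le> (B / q) * ?p" by (simp add: mult_ac)

    have "(B / q) * ?p \<le> C * ?p" unfolding C_def using cs by (intro mult_right_mono) auto
    then show "\<bar>G \<rho> r\<bar> \<le> C * ?p" using G1 by linarith
    let ?N = "(\<rho> + 1) * r powr \<rho> * w \<rho> r + r powr (\<rho> + 1) * w' \<rho> r"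
    have "\<bar>?N\<bar> \<le> \<bar>(\<rho> + 1) * r powr \<rho> * w \<rho> r\<bar> + \<bar>r powr (\<rho> + 1) * w' \<rho> r\<bar>" by (rule abs_triangle_ineq)
    also have "\<bar>(\<rho> + 1) * r powr \<rho> * w \<rho> r\<bar> \<le> (\<mu> + 1) * ?p * B"
      unfolding abs_mult using \<rho>1 p0 B(2)[OF \<rho> r] B(1) by (intro mult_mono) auto
    also have "\<bar>r powr (\<rho> + 1) * w' \<rho> r\<bar> \<le> ?p * B"
      unfolding abs_mult using p1 B(3)[OF \<rho> r] B(1) by (intro mult_mono) auto
    finally have N: "\<bar>?N\<bar> \<le> ((\<mu> + 1) * B + B) * ?p" by (simp add: algebra_simps)
    have "G' \<rho> r = ?N / Q r - (r powr (\<rho> + 1) * w \<rho> r) * Q' r / (Q r * Q r)"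
      unfolding G'_def using Qr by (simp add: diff_divide_distrib)
    then have "\<bar>G' \<rho> r\<bar> \<le> \<bar>?N\<bar> / Q r + \<bar>r powr (\<rho> + 1) * w \<rho> r\<bar> * \<bar>Q' r\<bar> / (Q r * Q r)"
      using abs_triangle_ineq4[of "?N / Q r" "(r powr (\<rho> + 1) * w \<rho> r) * Q' r / (Q r * Q r)"] Qr by (simp add: abs_mult)
    also have "\<dots> \<le> (((\<mu> + 1) * B + B) * ?p) / q + (?p * B) * (4 * B\<^sup>2) / (q * q)"
      using N n Qup(2)[OF r] Qr q B \<mu> by (intro add_mono frac_le mult_mono) auto
    also have "\<dots> = (((\<mu> + 1) * B + B) / q + B * (4 * B\<^sup>2) / (q * q)) * ?p" by (simp add: algebra_simps)
    also have "\<dots> \<le> C * ?p" unfolding C_def using cs by (intro mult_right_mono) auto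
    finally show "\<bar>G' \<rho> r\<bar> \<le> C * ?p" .
  qed
  have GW: "G \<rho> r * W \<rho> a r = (w \<rho> r)\<^sup>2 / Q r" for \<rho> r
    by (simp add: G_def w_def power2_eq_square)
  show thesis
  proof (rule that[of R C "G \<mu>" "G \<nu>" "G' \<mu>" "G' \<nu>"])
    fix r assume r: "r \<ge> R"
    have Qr: "Q r > 0" using Qlow[OF r] q by simp
    show "G \<mu> r * W \<mu> a r + G \<nu> r * W \<nu> a r = 1"
    proof -
      have "Q r / Q r = 1" using Qr by simp
      then show ?thesis by (simp only: GW add_divide_distrib[symmetric] Q_def[symmetric])
    qed
    show "0 \<le> G \<mu> r * W \<mu> a r" "0 \<le> G \<nu> r * W \<nu> a r" unfolding GW using Qr by auto
  qed (use cR C mG dG Gb in auto)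
qed

section \<open>Both sides of the equivalence as truncated defects\<close>

definition U_profile :: "nat \<Rightarrow> real \<Rightarrow> real \<Rightarrow> real \<Rightarrow> real" where
  "U_profile n \<beta> a r = slice_const (n - 1) \<beta> * W (\<beta> + (real n - 1) / 2) a r"

lemma lattice_pts_int_lattice: "lattice_pts = (int_lattice :: (real^'n) set)"
  by (auto simp: lattice_pts_def int_lattice_def Basis_vec_def inner_axis)

lemma U_fun_outside_torus:
  assumes "a < 1/2" "(x :: real^'n) \<notin> torus"
  shows "U_fun \<beta> a x = 0"
proof -
  have "\<not> norm x < a"
  proof
    assume "norm x < a"
    then have lt: "\<bar>x $ i\<bar> < 1/2" for i using component_le_norm_cart[of x i] assms(1) by linarith
    have "- 1 / 2 < x $ i \<and> x $ i \<le> 1 / 2" for i using lt[of i] by (auto simp: abs_less_iff)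
    then show False using assms(2) by (auto simp: torus_def)
  qed
  then show ?thesis by (simp add: U_fun_def)
qed

text \<open>A nonzero lattice vector moves some coordinate of a torus point to modulus at least 1/2
  > a, so the translates of the support do not reach the torus.\<close>

lemma u_fun_torus:
  assumes "a < 1/2" "(x :: real^'n) \<in> torus"
  shows "u_fun \<beta> a x = U_fun \<beta> a x"
proof -
  have "u_fun \<beta> a x = (\<Sum>\<^sub>\<infinity>m\<in>{0}. U_fun \<beta> a (x + m))"
    unfolding u_fun_def
  proof (rule infsum_cong_neutral)
    fix m :: "real^'n" assume m: "m \<in> lattice_pts - {0}"
    then obtain i where i: "m $ i \<noteq> 0" by (auto simp: vec_eq_iff)
    have "m $ i \<in> \<int>" using m by (simp add: lattice_pts_def)
    then obtain k :: int where k: "m $ i = of_int k" by (auto elim: Ints_cases)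
    then have "\<bar>m $ i\<bar> \<ge> 1" using i by (metis of_int_eq_0_iff of_int_abs of_int_1_le_iff zero_less_abs_iff int_one_le_iff_zero_less)
    moreover have "\<bar>x $ i\<bar> \<le> 1/2" using assms(2) unfolding torus_def by (smt (verit) mem_Collect_eq divide_minus_left)
    ultimately have "\<bar>(x + m) $ i\<bar> \<ge> 1/2" unfolding vector_add_component by linarith
    then have "\<not> norm (x + m) < a" using component_le_norm_cart[of "x + m" i] assms(1) by linarith
    then show "U_fun \<beta> a (x + m) = 0" by (simp add: U_fun_def)
  qed (auto simp: lattice_pts_def)
  then show ?thesis by simp
qed

lemma fourier_transform_U:
  assumes "\<beta> > -1" "a > 0"
  shows "fourier_transform (\<lambda>x. complex_of_real (U_fun \<beta> a x)) (\<xi> :: real^'n) = of_real (U_profile CARD('n) \<beta> a (norm \<xi>))"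
proof -
  have "fourier_transform (\<lambda>x. complex_of_real (U_fun \<beta> a x)) \<xi> = (LINT x|lborel. of_real (U_fun \<beta> a x) * cis (- 2 * pi * (\<xi> \<bullet> x)))"
    unfolding fourier_transform_def cis_conv_exp by (rule integral_completion) measurable
  then show ?thesis unfolding fourier_U_fun[OF assms] U_profile_def .
qed

text \<open>On the torus u coincides with U, and U vanishes outside it, so the coefficient is the
  transform of U at a lattice point.\<close>

lemma fourier_coeff_u:
  assumes "\<beta> > -1" "a > 0" "a < 1/2"
  shows "fourier_coeff (\<lambda>x. complex_of_real (u_fun \<beta> a x)) (m :: real^'n) = of_real (U_profile CARD('n) \<beta> a (norm m))"
proof -
  have "fourier_coeff (\<lambda>x. complex_of_real (u_fun \<beta> a x)) m = fourier_transform (\<lambda>x. complex_of_real (U_fun \<beta> a x)) m"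
    unfolding fourier_coeff_def fourier_transform_def set_lebesgue_integral_def
    by (intro Bochner_Integration.integral_cong) (use assms(3) in \<open>auto simp: indicator_def u_fun_torus U_fun_outside_torus\<close>)
  then show ?thesis using fourier_transform_U[OF assms(1,2)] by simp
qed

lemma trunc_sum_int_lattice:
  "trunc_sum (count_space int_lattice) (x0 :: real^'n) \<phi> 0 t = (\<Sum>m\<in>{m \<in> lattice_pts. norm m < t}. of_real (\<phi> (norm m)) * ee (m \<bullet> x0))"
proof -
  let ?f = "\<lambda>m. complex_of_real (if 0 \<le> norm m \<and> norm m < t then \<phi> (norm m) else 0) * ee (m \<bullet> x0)"
  have fin: "finite {m \<in> int_lattice. norm (m :: real^'n) < t}"
    using finite_lattice_pts_ball[of t, where 'n='n] by (simp add: lattice_pts_int_lattice)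
  have fin2: "finite {m \<in> int_lattice. ?f m \<noteq> 0}" by (rule finite_subset[OF _ fin]) (auto split: if_splits)
  have "trunc_sum (count_space int_lattice) x0 \<phi> 0 t = (\<Sum>m | m \<in> int_lattice \<and> ?f m \<noteq> 0. ?f m)"
    unfolding trunc_sum_def by (rule lebesgue_integral_count_space_finite_support[OF fin2])
  also have "\<dots> = (\<Sum>m\<in>{m \<in> int_lattice. norm m < t}. ?f m)"
    by (rule sum.mono_neutral_left[OF fin]) (auto split: if_splits)
  also have "\<dots> = (\<Sum>m\<in>{m \<in> int_lattice. norm m < t}. of_real (\<phi> (norm m)) * ee (m \<bullet> x0))"
    by (intro sum.cong) auto
  finally show ?thesis by (simp add: lattice_pts_int_lattice)
qed

lemma trunc_sum_lebesgue:
  assumes [measurable]: "\<phi> \<in> borel_measurable borel"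
  shows "trunc_sum lborel (x0 :: 'a::euclidean_space) \<phi> 0 t = (LINT \<xi>:{\<xi>. norm \<xi> < t}|lebesgue. of_real (\<phi> (norm \<xi>)) * ee (\<xi> \<bullet> x0))"
proof -
  have "(LINT \<xi>:{\<xi>. norm \<xi> < t}|lebesgue. complex_of_real (\<phi> (norm \<xi>)) * ee (\<xi> \<bullet> x0))
    = (LINT \<xi>|lebesgue. of_real (if 0 \<le> norm \<xi> \<and> norm \<xi> < t then \<phi> (norm \<xi>) else 0) * ee (\<xi> \<bullet> x0))"
    unfolding set_lebesgue_integral_def by (intro Bochner_Integration.integral_cong) (auto simp: indicator_def)
  also have "\<dots> = trunc_sum lborel x0 \<phi> 0 t"
    unfolding trunc_sum_def by (rule integral_completion) measurable
  finally show ?thesis ..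
qed

lemma borel_measurable_U_profile:
  assumes "\<beta> > -1" "a > 0" "n \<ge> 1"
  shows "U_profile n \<beta> a \<in> borel_measurable borel"
proof -
  have "W (\<beta> + (real n - 1) / 2) a \<in> borel_measurable borel"
  proof (rule borel_measurable_W)
    have "real n \<ge> 1" using assms(3) by simp
    then show "- 1 < \<beta> + (real n - 1) / 2" using assms(1) by (simp add: field_simps)
  qed fact
  then show ?thesis unfolding U_profile_def[abs_def] by measurable
qed

lemma difference_trunc_defect:
  assumes "\<beta> > -1" "a > 0" "a < 1/2"
  shows "fourier_partial_sum r (\<lambda>x. complex_of_real (u_fun \<beta> a x)) (x0 :: real^'n)
       - fourier_partial_integral r (\<lambda>x. complex_of_real (U_fun \<beta> a x)) x0 = trunc_defect x0 (U_profile CARD('n) \<beta> a) 0 r"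
proof -
  have "fourier_partial_sum r (\<lambda>x. complex_of_real (u_fun \<beta> a x)) x0 = trunc_sum (count_space int_lattice) x0 (U_profile CARD('n) \<beta> a) 0 r"
    unfolding fourier_partial_sum_def trunc_sum_int_lattice fourier_coeff_u[OF assms] ee_def by simp
  moreover have "fourier_partial_integral r (\<lambda>x. complex_of_real (U_fun \<beta> a x)) x0 = trunc_sum lborel x0 (U_profile CARD('n) \<beta> a) 0 r"
    unfolding fourier_partial_integral_def fourier_transform_U[OF assms(1,2)] ee_def
    by (subst trunc_sum_lebesgue[OF borel_measurable_U_profile]) (use assms in \<open>auto simp: ee_def Suc_leI\<close>)
  ultimately show ?thesis by (simp add: trunc_defect_def)
qed

lemma Delta0_trunc_defect:
  assumes "t \<ge> 0"
  shows "Delta0 (t\<^sup>2) (x0 :: real^'n) = trunc_defect x0 (\<lambda>_. 1) 0 t"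
proof -
  have "(norm \<xi>)\<^sup>2 < t\<^sup>2 \<longleftrightarrow> norm \<xi> < t" for \<xi> :: "real^'n"
    using assms abs_less_iff power2_less_imp_less[of "norm \<xi>" t] power_strict_mono[of "norm \<xi>" t 2] by auto
  then show ?thesis
    unfolding Delta0_def trunc_defect_def trunc_sum_int_lattice trunc_sum_lebesgue[OF borel_measurable_const] by (simp add: ee_def)
qed

text \<open>A domination by \<open>wt\<close> yields integrability for both measures, hence
  additivity of \<open>defect\<close> on this class.\<close>

definition decaying :: "('a::euclidean_space \<Rightarrow> complex) \<Rightarrow> bool" where
  "decaying F \<longleftrightarrow> F \<in> borel_measurable borel \<and> (\<exists>D\<ge>0. \<forall>\<xi>. norm (F \<xi>) \<le> D * wt \<xi>)"

lemma decaying_integrable: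
  assumes "decaying F"
  shows "integrable (count_space int_lattice) (\<lambda>\<xi>. F \<xi> * ee (\<xi> \<bullet> x0))" "integrable lborel (\<lambda>\<xi>. F \<xi> * ee (\<xi> \<bullet> x0))"
proof -
  obtain D where D: "\<And>\<xi>. norm (F \<xi>) \<le> D * wt \<xi>" and [measurable]: "F \<in> borel_measurable borel"
    using assms by (auto simp: decaying_def)
  show "integrable (count_space int_lattice) (\<lambda>\<xi>. F \<xi> * ee (\<xi> \<bullet> x0))"
    by (rule integrable_norm_le[OF integrable_mult_right[OF integrable_wt_int_lattice]]) (use D in \<open>auto simp: norm_mult\<close>)
  show "integrable lborel (\<lambda>\<xi>. F \<xi> * ee (\<xi> \<bullet> x0))"
    by (rule integrable_norm_le[OF integrable_mult_right[OF integrable_wt_lborel]]) (use D in \<open>auto simp: norm_mult\<close>)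
qed

lemma defect_add: "decaying F \<Longrightarrow> decaying H \<Longrightarrow> defect x0 (\<lambda>\<xi>. F \<xi> + H \<xi>) = defect x0 F + defect x0 H"
  unfolding defect_def by (simp add: distrib_right decaying_integrable Bochner_Integration.integral_add)

lemma defect_diff: "decaying F \<Longrightarrow> decaying H \<Longrightarrow> defect x0 (\<lambda>\<xi>. F \<xi> - H \<xi>) = defect x0 F - defect x0 H"
  unfolding defect_def by (simp add: left_diff_distrib decaying_integrable Bochner_Integration.integral_diff)

lemma defect_bound:
  fixes F :: "'a::euclidean_space \<Rightarrow> complex"
  assumes "\<And>\<xi>. norm (F \<xi>) \<le> D * wt \<xi>"
  shows "norm (defect x0 F) \<le> D * ((LINT \<xi>|count_space int_lattice. wt (\<xi> :: 'a)) + (LINT \<xi>|lborel. wt (\<xi> :: 'a)))"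
proof -
  have "norm (LINT m|count_space int_lattice. F m * ee (m \<bullet> x0)) \<le> (LINT \<xi>|count_space int_lattice. D * wt (\<xi> :: 'a))"
    by (rule norm_LINT_le) (use assms integrable_wt_int_lattice in \<open>auto simp: norm_mult\<close>)
  moreover have "norm (LINT m|lborel. F m * ee (m \<bullet> x0)) \<le> (LINT \<xi>|lborel. D * wt (\<xi> :: 'a))"
    by (rule norm_LINT_le) (use assms integrable_wt_lborel in \<open>auto simp: norm_mult\<close>)
  ultimately have "norm (defect x0 F) \<le> (LINT \<xi>|count_space int_lattice. D * wt (\<xi> :: 'a)) + (LINT \<xi>|lborel. D * wt (\<xi> :: 'a))"
    unfolding defect_def by (intro order_trans[OF norm_triangle_ineq4] add_mono)
  then show ?thesis by (simp add: distrib_left)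
qed

lemma trunc_defect_defect: "trunc_defect x0 \<phi> 0 t = defect x0 (\<lambda>\<xi>. of_real (if norm \<xi> < t then \<phi> (norm \<xi>) else 0))"
  by (simp add: trunc_defect_def defect_def trunc_sum_def)

text \<open>A crude bound for radii in a bounded range, where the asymptotic hypotheses give no
  information.\<close>

lemma trunc_defect_bound:
  fixes x0 :: "'a::euclidean_space"
  assumes "\<And>r. r \<ge> 0 \<Longrightarrow> \<bar>\<phi> r\<bar> \<le> B" "t \<ge> 0" "t \<le> T"
  shows "norm (trunc_defect x0 \<phi> 0 t) \<le> B * (1 + T) ^ (2 * DIM('a)) * ((LINT \<xi>|count_space int_lattice. wt (\<xi> :: 'a)) + (LINT \<xi>|lborel. wt (\<xi> :: 'a)))"
proof -
  have B: "B \<ge> 0" using assms(1)[of 0] by (meson abs_ge_zero order_refl order_trans)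
  have "norm (trunc_defect x0 \<phi> 0 t) \<le> B * (1 + t) ^ (2 * DIM('a)) * (LINT \<xi>|count_space int_lattice. wt (\<xi> :: 'a)) + B * (1 + t) ^ (2 * DIM('a)) * (LINT \<xi>|lborel. wt (\<xi> :: 'a))"
    unfolding trunc_defect_def
    by (intro order_trans[OF norm_triangle_ineq4] add_mono trunc_sum_bound assms integrable_wt_int_lattice integrable_wt_lborel)
  also have "\<dots> = B * (1 + t) ^ (2 * DIM('a)) * ((LINT \<xi>|count_space int_lattice. wt (\<xi> :: 'a)) + (LINT \<xi>|lborel. wt (\<xi> :: 'a)))"
    by (simp add: distrib_left)
  also have "\<dots> \<le> B * (1 + T) ^ (2 * DIM('a)) * ((LINT \<xi>|count_space int_lattice. wt (\<xi> :: 'a)) + (LINT \<xi>|lborel. wt (\<xi> :: 'a)))"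
    using assms B by (intro mult_right_mono mult_left_mono power_mono add_nonneg_nonneg Bochner_Integration.integral_nonneg) auto
  finally show ?thesis .
qed

lemma torus_Basis:
  assumes "(x0 :: real^'n) \<in> torus" "b \<in> Basis"
  shows "\<bar>x0 \<bullet> b\<bar> \<le> 1/2"
proof -
  obtain i where "b = axis i 1" using assms(2) by (auto simp: Basis_vec_def)
  then have "x0 \<bullet> b = x0 $ i" by (simp add: inner_axis)
  moreover have "- 1 / 2 < x0 $ i" "x0 $ i \<le> 1 / 2" using assms(1) by (auto simp: torus_def)
  ultimately show ?thesis by (simp add: abs_le_iff)
qed

text \<open>The profile and its derivative get one common exponent, the form in which
  \<open>defect_outside_cutoff_bound\<close> expects its multiplier.\<close>

lemma U_profile_decay:
  assumes "\<beta> > -1" "a > 0" "n \<ge> 1"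
  obtains C D where "C > 0" "D \<in> borel_measurable borel"
    "\<And>r. r \<ge> 0 \<Longrightarrow> \<bar>U_profile n \<beta> a r\<bar> \<le> C * (1 + r) powr (- \<beta> - (real n + 1) / 2)"
    "\<And>r. (U_profile n \<beta> a has_real_derivative D r) (at r)"
    "\<And>r. r \<ge> 0 \<Longrightarrow> \<bar>D r\<bar> \<le> C * (1 + r) powr (- \<beta> - (real n + 1) / 2)"
    "\<And>r. r \<ge> 0 \<Longrightarrow> \<bar>U_profile n \<beta> a r\<bar> \<le> C"
proof -
  define \<mu> where "\<mu> = \<beta> + (real n - 1) / 2"
  define s where "s = slice_const (n - 1) \<beta>"
  have s: "s > 0" unfolding s_def by (rule slice_const_pos[OF assms(1)])
  have "real n \<ge> 1" using assms(3) by simp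
  then have \<mu>: "\<mu> > -1" using assms(1) unfolding \<mu>_def by (simp add: field_simps)
  have e: "- \<mu> - 1 = - \<beta> - (real n + 1) / 2" unfolding \<mu>_def by (simp add: field_simps)
  have G: "U_profile n \<beta> a = (\<lambda>r. s * W \<mu> a r)" by (simp add: fun_eq_iff U_profile_def s_def \<mu>_def)
  obtain C1 where C1: "C1 > 0" "\<And>r. r \<ge> 0 \<Longrightarrow> \<bar>W \<mu> a r\<bar> \<le> C1 * (1 + r) powr (- \<mu> - 1)"
    using W_bound[OF \<mu> assms(2)] by blast
  obtain C2 where C2: "C2 > 0" "\<And>r. r \<ge> 0 \<Longrightarrow> \<bar>2 * pi\<^sup>2 * r / (\<mu> + 1) * W (\<mu> + 1) a r\<bar> \<le> C2 * (1 + r) powr (- \<mu> - 1)"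
    using W_deriv_bound[OF \<mu> assms(2)] by blast
  define D where "D r = s * (- (2 * pi\<^sup>2 * r / (\<mu> + 1)) * W (\<mu> + 1) a r)" for r
  have le: "s * C1 \<le> s * (C1 + C2)" "s * C2 \<le> s * (C1 + C2)" using s C1 C2 by (auto intro: mult_left_mono)
  have bG: "\<bar>U_profile n \<beta> a r\<bar> \<le> s * (C1 + C2) * (1 + r) powr (- \<mu> - 1)" if "r \<ge> 0" for r
  proof -
    have "\<bar>U_profile n \<beta> a r\<bar> = s * \<bar>W \<mu> a r\<bar>" unfolding G using s by (simp add: abs_mult)
    also have "\<dots> \<le> s * (C1 * (1 + r) powr (- \<mu> - 1))" using s C1(2)[OF that] by (intro mult_left_mono) auto
    also have "\<dots> = s * C1 * (1 + r) powr (- \<mu> - 1)" by simp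
    also have "\<dots> \<le> s * (C1 + C2) * (1 + r) powr (- \<mu> - 1)" using le by (intro mult_right_mono) auto
    finally show ?thesis .
  qed
  show thesis
  proof (rule that[of "s * (C1 + C2)" D])
    show "s * (C1 + C2) > 0" using s C1 C2 by simp
    have [measurable]: "W (\<mu> + 1) a \<in> borel_measurable borel" using \<mu> assms(2) by (intro borel_measurable_W) auto
    show "D \<in> borel_measurable borel" unfolding D_def[abs_def] by measurable
    show "(U_profile n \<beta> a has_real_derivative D r) (at r)" for r
      unfolding G D_def by (rule DERIV_cmult[OF W_deriv[OF \<mu> assms(2)]])
    fix r :: real assume r: "r \<ge> 0"
    show "\<bar>U_profile n \<beta> a r\<bar> \<le> s * (C1 + C2) * (1 + r) powr (- \<beta> - (real n + 1) / 2)" using bG[OF r] unfolding e .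
    have "\<bar>D r\<bar> = s * \<bar>2 * pi\<^sup>2 * r / (\<mu> + 1) * W (\<mu> + 1) a r\<bar>" unfolding D_def using s by (simp add: abs_mult)
    also have "\<dots> \<le> s * (C2 * (1 + r) powr (- \<mu> - 1))" using s C2(2)[OF r] by (intro mult_left_mono) auto
    also have "\<dots> = s * C2 * (1 + r) powr (- \<mu> - 1)" by simp
    also have "\<dots> \<le> s * (C1 + C2) * (1 + r) powr (- \<mu> - 1)" using le by (intro mult_right_mono) auto
    finally show "\<bar>D r\<bar> \<le> s * (C1 + C2) * (1 + r) powr (- \<beta> - (real n + 1) / 2)" unfolding e .
    have "(1 + r) powr (- \<mu> - 1) \<le> (1 + r) powr 0" using r \<mu> by (intro powr_mono) auto
    then have "s * (C1 + C2) * (1 + r) powr (- \<mu> - 1) \<le> s * (C1 + C2) * 1" using s C1 C2 r by (intro mult_left_mono) auto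
    then show "\<bar>U_profile n \<beta> a r\<bar> \<le> s * (C1 + C2)" using bG[OF r] by simp
  qed
qed

lemma U_profile_bounded:
  assumes "\<beta> > -1" "a > 0" "n \<ge> 1"
  obtains C where "C > 0" "\<And>r. r \<ge> 0 \<Longrightarrow> \<bar>U_profile n \<beta> a r\<bar> \<le> C"
proof (rule U_profile_decay[OF assms])
  fix C assume "C > 0" "\<And>r. r \<ge> 0 \<Longrightarrow> \<bar>U_profile n \<beta> a r\<bar> \<le> C"
  then show thesis by (rule that)
qed

lemma decaying_cut:
  fixes \<phi> :: "real \<Rightarrow> real"
  assumes [measurable]: "\<phi> \<in> borel_measurable borel" and B: "\<And>r. r \<ge> 0 \<Longrightarrow> \<bar>\<phi> r\<bar> \<le> B" and "t \<ge> 0"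
  shows "norm (complex_of_real (if norm \<xi> < t then \<phi> (norm \<xi>) else 0)) \<le> (B * (1 + t) ^ (2 * DIM('a))) * wt (\<xi> :: 'a)"
    and "decaying (\<lambda>\<xi> :: 'a::euclidean_space. of_real (if norm \<xi> < t then \<phi> (norm \<xi>) else 0))"
proof -
  have B0: "B \<ge> 0" using B[of 0] by (meson abs_ge_zero order_refl order_trans)
  show b: "norm (complex_of_real (if norm \<xi> < t then \<phi> (norm \<xi>) else 0)) \<le> (B * (1 + t) ^ (2 * DIM('a))) * wt \<xi>" for \<xi> :: 'a
  proof (cases "norm \<xi> < t")
    case True
    then have "1 \<le> (1 + t) ^ (2 * DIM('a)) * wt \<xi>"
      using wt_bound[of \<xi> t] assms by (simp add: field_simps)
    then have "B * 1 \<le> B * ((1 + t) ^ (2 * DIM('a)) * wt \<xi>)" using B0 by (intro mult_left_mono) auto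
    then show ?thesis using True B[of "norm \<xi>"] by (simp add: mult.assoc)
  qed (use B0 assms in auto)
  show "decaying (\<lambda>\<xi> :: 'a. of_real (if norm \<xi> < t then \<phi> (norm \<xi>) else 0))"
    unfolding decaying_def
  proof (intro conjI exI allI)
    show "(\<lambda>\<xi> :: 'a. complex_of_real (if norm \<xi> < t then \<phi> (norm \<xi>) else 0)) \<in> borel_measurable borel" by measurable
    show "0 \<le> B * (1 + t) ^ (2 * DIM('a))" using B0 assms by simp
  qed (rule b)
qed

lemma decaying_smooth_cut:
  fixes \<phi> \<eta> :: "real \<Rightarrow> real"
  assumes [measurable]: "\<phi> \<in> borel_measurable borel" "\<eta> \<in> borel_measurable borel"
    and B: "\<And>r. r \<ge> 0 \<Longrightarrow> \<bar>\<phi> r\<bar> \<le> B"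
    and \<eta>: "\<And>r. r \<ge> 0 \<Longrightarrow> \<bar>\<eta> r\<bar> \<le> E * inverse ((1 + r) ^ L)" and "E \<ge> 0" and L: "2 * DIM('a) \<le> L"
  shows "norm (complex_of_real (\<phi> (norm \<xi>) * \<eta> (norm \<xi>))) \<le> (B * E) * wt (\<xi> :: 'a)"
    and "decaying (\<lambda>\<xi> :: 'a::euclidean_space. of_real (\<phi> (norm \<xi>) * \<eta> (norm \<xi>)))"
proof -
  have B0: "B \<ge> 0" using B[of 0] by (meson abs_ge_zero order_refl order_trans)
  show b: "norm (complex_of_real (\<phi> (norm \<xi>) * \<eta> (norm \<xi>))) \<le> (B * E) * wt \<xi>" for \<xi> :: 'a
  proof -
    have "norm (complex_of_real (\<phi> (norm \<xi>) * \<eta> (norm \<xi>))) = \<bar>\<phi> (norm \<xi>)\<bar> * \<bar>\<eta> (norm \<xi>)\<bar>" by (simp add: norm_mult)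
    also have "\<dots> \<le> B * (E * inverse ((1 + norm \<xi>) ^ L))" using B0 by (intro mult_mono B \<eta>) auto
    also have "\<dots> \<le> B * (E * wt \<xi>)"
      unfolding wt_def using B0 assms(5) L
      by (intro mult_left_mono le_imp_inverse_le power_increasing zero_less_power add_pos_nonneg) auto
    finally show ?thesis by (simp add: mult.assoc)
  qed
  show "decaying (\<lambda>\<xi> :: 'a. of_real (\<phi> (norm \<xi>) * \<eta> (norm \<xi>)))"
    unfolding decaying_def
  proof (intro conjI exI allI)
    show "(\<lambda>\<xi> :: 'a. complex_of_real (\<phi> (norm \<xi>) * \<eta> (norm \<xi>))) \<in> borel_measurable borel" by measurable
    show "0 \<le> B * E" using B0 assms by simp
  qed (rule b)
qed

lemma decaying_diff: "decaying F \<Longrightarrow> decaying H \<Longrightarrow> decaying (\<lambda>\<xi>. F \<xi> - H \<xi>)"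
  unfolding decaying_def
proof (elim conjE exE, intro conjI)
  fix D E assume "0 \<le> D" "0 \<le> E" "\<forall>\<xi>. norm (F \<xi>) \<le> D * wt \<xi>" "\<forall>\<xi>. norm (H \<xi>) \<le> E * wt \<xi>"
  then show "\<exists>D\<ge>0. \<forall>\<xi>. norm (F \<xi> - H \<xi>) \<le> D * wt \<xi>"
    by (intro exI[of _ "D + E"]) (auto simp: distrib_right intro!: order_trans[OF norm_triangle_ineq4] add_mono)
qed simp

lemma decaying_mult:
  assumes "decaying F" "m \<in> borel_measurable borel" "\<And>\<xi>. \<bar>m \<xi>\<bar> \<le> 1"
  shows "decaying (\<lambda>\<xi>. of_real (m \<xi>) * F \<xi>)"
proof -
  obtain D where D: "D \<ge> 0" "\<And>\<xi>. norm (F \<xi>) \<le> D * wt \<xi>" using assms(1) by (auto simp: decaying_def)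
  have "norm (of_real (m \<xi>) * F \<xi>) \<le> D * wt \<xi>" for \<xi>
  proof -
    have "norm (of_real (m \<xi>) * F \<xi>) \<le> 1 * norm (F \<xi>)"
      unfolding norm_mult norm_of_real using assms(3) by (intro mult_right_mono) auto
    then show ?thesis using D(2)[of \<xi>] by simp
  qed
  then show ?thesis using assms(1,2) D(1) unfolding decaying_def by auto
qed

lemma decaying_add: "decaying F \<Longrightarrow> decaying H \<Longrightarrow> decaying (\<lambda>\<xi>. F \<xi> + H \<xi>)"
  using decaying_diff[of F "\<lambda>\<xi>. - H \<xi>"] by (simp add: decaying_def)

lemma defect_cmult: "defect x0 (\<lambda>\<xi>. c * F \<xi>) = c * defect x0 F"
  by (simp add: defect_def mult.assoc right_diff_distrib)

lemma defect_band_limited_zero: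
  assumes "band_limited M c v R \<Psi>" "0 \<le> R" "R < 1/2" "(x0 :: real^'n) \<in> torus" "\<And>\<xi>. norm (\<Psi> \<xi>) \<le> C * wt \<xi>" "C \<ge> 0"
  shows "defect x0 \<Psi> = 0"
  using poisson[OF assms(1-3) torus_Basis[OF assms(4)] assms(5,6)] by (simp add: defect_def)

text \<open>The transform times the cutoff has band radius a + 2 b < 1/2 and hence defect zero. The
  truncated defect of the transform is therefore that of its product with indicator minus cutoff, to
  which the summation by parts with weight 1 applies.\<close>

lemma lattice_bound_imp_difference_bound:
  fixes x0 :: "real^'n"
  assumes \<beta>: "\<beta> > -1" and a: "0 < a" "a < 1/2" and x0: "x0 \<in> torus"
    and D: "\<And>t. t \<ge> 0 \<Longrightarrow> norm (trunc_defect x0 (\<lambda>_. 1) 0 t) \<le> K * (1 + t) powr \<alpha>"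
  obtains K' where "\<And>l. l > 0 \<Longrightarrow> norm (trunc_defect x0 (U_profile CARD('n) \<beta> a) 0 l) \<le> K' * (1 + l) powr (\<alpha> - \<beta> - (real CARD('n) + 1) / 2)"
proof -
  define G where "G = U_profile CARD('n) \<beta> a"
  define \<kappa> where "\<kappa> = - \<beta> - (real CARD('n) + 1) / 2"
  have n1: "CARD('n) \<ge> 1" by (simp add: Suc_leI)
  obtain C G' where G: "C > 0" "G' \<in> borel_measurable borel"
    "\<And>r. r \<ge> 0 \<Longrightarrow> \<bar>G r\<bar> \<le> C * (1 + r) powr \<kappa>" "\<And>r. (G has_real_derivative G' r) (at r)"
    "\<And>r. r \<ge> 0 \<Longrightarrow> \<bar>G' r\<bar> \<le> C * (1 + r) powr \<kappa>" "\<And>r. r \<ge> 0 \<Longrightarrow> \<bar>G r\<bar> \<le> C"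
    by (rule U_profile_decay[OF \<beta> a(1) n1, folded G_def \<kappa>_def, OF that])
  have mG: "G \<in> borel_measurable borel" unfolding G_def by (rule borel_measurable_U_profile[OF \<beta> a(1) n1])
  \<comment> \<open>The choice gives a + 2 b = 1/4 + a/2, halfway between a and 1/2.\<close>
  define b where "b = (1/2 - a) / 4"
  have b: "b > 0" "a + 2 * b < 1/2" using a by (auto simp: b_def field_simps)
  \<comment> \<open>Three demands on the decay order: a majorant for Fubini's theorem, compensation
    of the loss in Peetre's inequality, and domination of the cutoff by \<open>wt\<close>.\<close>
  obtain L :: nat where L: "max (\<kappa> + 2 * DIM(real^'n) + 2) (max (\<bar>\<kappa> + \<alpha>\<bar> + 2) (2 * DIM(real^'n))) \<le> real L"
    using real_arch_simple by blast
  obtain \<eta> \<eta>' C0 where C0: "C0 > 0"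
    and band_limited: "\<And>l. l > 0 \<Longrightarrow> \<exists>c v. band_limited (lborel \<Otimes>\<^sub>M (lborel \<Otimes>\<^sub>M lborel) :: ((real^'n) \<times> (real^'n) \<times> (real^'n)) measure) c v (2 * b) (\<lambda>\<xi> :: real^'n. of_real (\<eta> l (norm \<xi>)))"
    and \<eta>d: "\<And>l r. l > 0 \<Longrightarrow> (\<eta> l has_real_derivative \<eta>' l r) (at r)" and \<eta>m: "\<And>l. \<eta>' l \<in> borel_measurable borel"
    and \<eta>1: "\<And>l r. l > 0 \<Longrightarrow> r \<ge> 0 \<Longrightarrow> \<bar>(if r < l then 1 else 0) - \<eta> l r\<bar> \<le> C0 * inverse ((1 + \<bar>r - l\<bar>) ^ L)"
    and \<eta>2: "\<And>l r. l > 0 \<Longrightarrow> r \<ge> 0 \<Longrightarrow> \<bar>\<eta>' l r\<bar> \<le> C0 * inverse ((1 + \<bar>r - l\<bar>) ^ L)"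
    and \<eta>3: "\<And>l r. l > 0 \<Longrightarrow> r \<ge> 0 \<Longrightarrow> \<bar>\<eta> l r\<bar> \<le> C0 * (1 + l) ^ L * inverse ((1 + r) ^ L)"
    by (rule cutoff_exists[OF b(1), of L, where 'n='n, OF that])
  have Lr: "\<kappa> + real (2 * DIM(real^'n)) + 2 \<le> real L" "\<bar>\<kappa> + \<alpha>\<bar> + 2 \<le> real L" using L by auto
  have one: "\<And>r::real. r \<ge> 0 \<Longrightarrow> \<bar>1::real\<bar> \<le> 1" by simp
  have "\<exists>K'. \<forall>l>0. l \<ge> 0 \<longrightarrow>
     norm (defect x0 (\<lambda>\<xi>. of_real (if 0 \<le> norm \<xi> then 1 * (G (norm \<xi>) * ((if norm \<xi> < l then 1 else 0) - \<eta> l (norm \<xi>))) else 0)))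
       \<le> K' * (1 + l) powr (\<kappa> + \<alpha>)"
    by (rule defect_outside_cutoff_bound[OF C0 \<eta>d \<eta>m \<eta>1 \<eta>2 \<eta>3 borel_measurable_const one order_refl less_imp_le[OF G(1)] G(4) G(2) mG G(3) G(5) D Lr]; assumption)
  then obtain K' where K': "\<forall>l>0. l \<ge> 0 \<longrightarrow>
     norm (defect x0 (\<lambda>\<xi>. of_real (if 0 \<le> norm \<xi> then 1 * (G (norm \<xi>) * ((if norm \<xi> < l then 1 else 0) - \<eta> l (norm \<xi>))) else 0)))
       \<le> K' * (1 + l) powr (\<kappa> + \<alpha>)" by (elim exE)
  show thesis
  proof (rule that[of K'])
    fix l :: real assume l: "l > 0"
    have "continuous_on UNIV (\<eta> l)"
      using \<eta>d[OF l] by (intro continuous_at_imp_continuous_on ballI DERIV_isCont)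
    then have m\<eta>: "\<eta> l \<in> borel_measurable borel" by (rule borel_measurable_continuous_onI)
    have E: "C0 * (1 + l) ^ L \<ge> 0" "2 * DIM(real^'n) \<le> L" using C0 l L by auto
    have g1: "decaying (\<lambda>\<xi> :: real^'n. of_real (if norm \<xi> < l then G (norm \<xi>) else 0))"
      by (rule decaying_cut(2)[OF mG G(6) less_imp_le[OF l]]; assumption)
    have g2: "norm (complex_of_real (G (norm \<xi>) * \<eta> l (norm \<xi>))) \<le> (C * (C0 * (1 + l) ^ L)) * wt \<xi>" for \<xi> :: "real^'n"
      by (rule decaying_smooth_cut(1)[OF mG m\<eta> G(6) \<eta>3[OF l] E]; assumption)
    have g3: "decaying (\<lambda>\<xi> :: real^'n. of_real (G (norm \<xi>) * \<eta> l (norm \<xi>)))"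
      by (rule decaying_smooth_cut(2)[OF mG m\<eta> G(6) \<eta>3[OF l] E]; assumption)
    obtain c v where cv: "band_limited (lborel \<Otimes>\<^sub>M (lborel \<Otimes>\<^sub>M lborel) :: ((real^'n) \<times> (real^'n) \<times> (real^'n)) measure) c v (2 * b) (\<lambda>\<xi> :: real^'n. of_real (\<eta> l (norm \<xi>)))"
      using band_limited[OF l] by blast
    from band_limited_mult[OF band_limited_U_fun[OF \<beta> a(1)] cv]
    have bd: "band_limited (lborel \<Otimes>\<^sub>M (lborel \<Otimes>\<^sub>M (lborel \<Otimes>\<^sub>M lborel))) (\<lambda>z. of_real (U_fun \<beta> a (fst z)) * c (snd z)) (\<lambda>z. (if norm (fst z) < a then fst z else 0) + v (snd z)) (a + 2 * b)
       (\<lambda>\<xi> :: real^'n. of_real (G (norm \<xi>) * \<eta> l (norm \<xi>)))"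
      unfolding G_def U_profile_def by simp
    have z: "defect x0 (\<lambda>\<xi>. of_real (G (norm \<xi>) * \<eta> l (norm \<xi>))) = 0"
      by (rule defect_band_limited_zero[OF bd _ b(2) x0 g2]) (use a b G(1) E in auto)
    have "trunc_defect x0 G 0 l = defect x0 (\<lambda>\<xi>. of_real (if norm \<xi> < l then G (norm \<xi>) else 0)) - defect x0 (\<lambda>\<xi>. of_real (G (norm \<xi>) * \<eta> l (norm \<xi>)))"
      unfolding z trunc_defect_defect by simp
    also have "\<dots> = defect x0 (\<lambda>\<xi>. of_real (if norm \<xi> < l then G (norm \<xi>) else 0) - of_real (G (norm \<xi>) * \<eta> l (norm \<xi>)))"
      by (rule defect_diff[symmetric, OF g1 g3])
    also have "(\<lambda>\<xi> :: real^'n. complex_of_real (if norm \<xi> < l then G (norm \<xi>) else 0) - of_real (G (norm \<xi>) * \<eta> l (norm \<xi>)))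
      = (\<lambda>\<xi>. of_real (if 0 \<le> norm \<xi> then 1 * (G (norm \<xi>) * ((if norm \<xi> < l then 1 else 0) - \<eta> l (norm \<xi>))) else 0))"
      by (auto simp: fun_eq_iff right_diff_distrib)
    finally have "norm (trunc_defect x0 G 0 l) \<le> K' * (1 + l) powr (\<kappa> + \<alpha>)" using K' l by simp
    moreover have "\<kappa> + \<alpha> = \<alpha> - \<beta> - (real CARD('n) + 1) / 2" by (simp add: \<kappa>_def)
    ultimately show "norm (trunc_defect x0 (U_profile CARD('n) \<beta> a) 0 l) \<le> K' * (1 + l) powr (\<alpha> - \<beta> - (real CARD('n) + 1) / 2)"
      unfolding G_def by simp
  qed
qed

text \<open>The constant 1 is recovered from the two transforms by means of the partition, whose
  multipliers have order kappa = (d - 1) / 2 + e. Bounded differences for two exponents beta thus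
  give the lattice defect the rate l powr kappa.\<close>

lemma difference_bound_imp_lattice_bound:
  fixes x0 :: "real^'n"
  assumes e: "0 < e" "e \<le> 1" and a: "0 < a" "a < 1/2" and x0: "x0 \<in> torus"
    and D1: "\<And>t. t \<ge> 0 \<Longrightarrow> norm (trunc_defect x0 (U_profile CARD('n) (-1 + e) a) 0 t) \<le> K"
    and D2: "\<And>t. t \<ge> 0 \<Longrightarrow> norm (trunc_defect x0 (U_profile CARD('n) (-1 + e / 2) a) 0 t) \<le> K"
  obtains K' R where "\<And>l. l > 0 \<Longrightarrow> l \<ge> R \<Longrightarrow> norm (trunc_defect x0 (\<lambda>_. 1) 0 l) \<le> K' * (1 + l) powr ((real CARD('n) - 1) / 2 + e)"
proof -
  \<comment> \<open>The larger exponent fixes the final rate; halving e for the second makes the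
    difference of the two equal to e / 2, inside the range (0, 2) that
    \<open>partition_exists\<close> requires.\<close>
  define \<beta>1 where "\<beta>1 = -1 + e"
  define \<beta>2 where "\<beta>2 = -1 + e / 2"
  define \<mu>1 where "\<mu>1 = \<beta>1 + (real CARD('n) - 1) / 2"
  define \<mu>2 where "\<mu>2 = \<beta>2 + (real CARD('n) - 1) / 2"
  have n1: "CARD('n) \<ge> 1" by (simp add: Suc_leI)
  then have n2: "real CARD('n) \<ge> 1" by simp
  have \<beta>: "\<beta>1 > -1" "\<beta>2 > -1" using e by (auto simp: \<beta>1_def \<beta>2_def)
  have "0 \<le> (real CARD('n) - 1) / 2" using n2 by (simp only: diff_ge_0_iff_ge zero_le_divide_iff) simp
  then have "-1 + 0 < \<mu>1" "-1 + 0 < \<mu>2" unfolding \<mu>1_def \<mu>2_def using \<beta> by (intro add_less_le_mono; simp)+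
  moreover have "0 < \<mu>1 - \<mu>2" "\<mu>1 - \<mu>2 < 2"
    using e by (auto simp: \<mu>1_def \<mu>2_def \<beta>1_def \<beta>2_def)
  ultimately have \<mu>: "\<mu>1 > -1" "\<mu>2 > -1" "0 < \<mu>1 - \<mu>2" "\<mu>1 - \<mu>2 < 2" by simp_all
  define s1 where "s1 = slice_const (CARD('n) - 1) \<beta>1"
  define s2 where "s2 = slice_const (CARD('n) - 1) \<beta>2"
  have s: "s1 > 0" "s2 > 0" unfolding s1_def s2_def by (auto intro!: slice_const_pos \<beta>)
  define G1 where "G1 = U_profile CARD('n) \<beta>1 a"
  define G2 where "G2 = U_profile CARD('n) \<beta>2 a"
  have Gs: "G1 r = s1 * W \<mu>1 a r" "G2 r = s2 * W \<mu>2 a r" for r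
    by (simp_all add: G1_def G2_def U_profile_def s1_def s2_def \<mu>1_def \<mu>2_def)
  have mG: "G1 \<in> borel_measurable borel" "G2 \<in> borel_measurable borel"
    unfolding G1_def G2_def by (auto intro!: borel_measurable_U_profile \<beta> a n1)
  obtain B1 where B1: "B1 > 0" "\<And>r. r \<ge> 0 \<Longrightarrow> \<bar>G1 r\<bar> \<le> B1" by (rule U_profile_bounded[OF \<beta>(1) a(1) n1, folded G1_def, OF that])
  obtain B2 where B2: "B2 > 0" "\<And>r. r \<ge> 0 \<Longrightarrow> \<bar>G2 r\<bar> \<le> B2" by (rule U_profile_bounded[OF \<beta>(2) a(1) n1, folded G2_def, OF that])
  obtain R g h g' h' C where R: "R \<ge> 1" and C: "C \<ge> 0"
    and one: "\<And>r. r \<ge> R \<Longrightarrow> g r * W \<mu>1 a r + h r * W \<mu>2 a r = 1"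
    and pos: "\<And>r. r \<ge> R \<Longrightarrow> 0 \<le> g r * W \<mu>1 a r" "\<And>r. r \<ge> R \<Longrightarrow> 0 \<le> h r * W \<mu>2 a r"
    and dg: "\<And>r. r \<ge> R \<Longrightarrow> (g has_real_derivative g' r) (at r)"
    and dh: "\<And>r. r \<ge> R \<Longrightarrow> (h has_real_derivative h' r) (at r)"
    and mgh: "g \<in> borel_measurable borel" "h \<in> borel_measurable borel" "g' \<in> borel_measurable borel" "h' \<in> borel_measurable borel"
    and bg: "\<And>r. r \<ge> R \<Longrightarrow> \<bar>g r\<bar> \<le> C * (1 + r) powr (\<mu>1 + 1)" "\<And>r. r \<ge> R \<Longrightarrow> \<bar>g' r\<bar> \<le> C * (1 + r) powr (\<mu>1 + 1)"
    and bh: "\<And>r. r \<ge> R \<Longrightarrow> \<bar>h r\<bar> \<le> C * (1 + r) powr (\<mu>1 + 1)" "\<And>r. r \<ge> R \<Longrightarrow> \<bar>h' r\<bar> \<le> C * (1 + r) powr (\<mu>1 + 1)"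
    by (rule partition_exists[OF \<mu> a(1), OF that])
  define \<kappa> where "\<kappa> = \<mu>1 + 1"
  have R0: "R \<ge> 0" using R by simp
  define b where "b = (1/2 - a) / 4"
  have b: "b > 0" "2 * b < 1/2" using a by (auto simp: b_def field_simps)
  obtain L :: nat where L: "max (\<kappa> + 2 * DIM(real^'n) + 2) (max (\<bar>\<kappa> + 0\<bar> + 2) (2 * DIM(real^'n))) \<le> real L"
    using real_arch_simple by blast
  obtain \<eta> \<eta>' C0 where C0: "C0 > 0"
    and band_limited: "\<And>l. l > 0 \<Longrightarrow> \<exists>c v. band_limited (lborel \<Otimes>\<^sub>M (lborel \<Otimes>\<^sub>M lborel) :: ((real^'n) \<times> (real^'n) \<times> (real^'n)) measure) c v (2 * b) (\<lambda>\<xi> :: real^'n. of_real (\<eta> l (norm \<xi>)))"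
    and \<eta>d: "\<And>l r. l > 0 \<Longrightarrow> (\<eta> l has_real_derivative \<eta>' l r) (at r)" and \<eta>m: "\<And>l. \<eta>' l \<in> borel_measurable borel"
    and \<eta>1: "\<And>l r. l > 0 \<Longrightarrow> r \<ge> 0 \<Longrightarrow> \<bar>(if r < l then 1 else 0) - \<eta> l r\<bar> \<le> C0 * inverse ((1 + \<bar>r - l\<bar>) ^ L)"
    and \<eta>2: "\<And>l r. l > 0 \<Longrightarrow> r \<ge> 0 \<Longrightarrow> \<bar>\<eta>' l r\<bar> \<le> C0 * inverse ((1 + \<bar>r - l\<bar>) ^ L)"
    and \<eta>3: "\<And>l r. l > 0 \<Longrightarrow> r \<ge> 0 \<Longrightarrow> \<bar>\<eta> l r\<bar> \<le> C0 * (1 + l) ^ L * inverse ((1 + r) ^ L)"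
    by (rule cutoff_exists[OF b(1), of L, where 'n='n, OF that])
  \<comment> \<open>The partition exists only for radii at least R, so the inner radius is moved
    from 0 to R. This subtracts a fixed term and at most doubles the bound K.\<close>
  have DtR: "trunc_defect x0 \<phi> R t = trunc_defect x0 \<phi> 0 t - trunc_defect x0 \<phi> 0 R"
    if m\<phi>: "\<phi> \<in> borel_measurable borel" and b\<phi>: "\<And>r. r \<ge> 0 \<Longrightarrow> \<bar>\<phi> r\<bar> \<le> B" and t: "t \<ge> R" for \<phi> B t
  proof -
    have "trunc_defect x0 \<phi> 0 t - trunc_defect x0 \<phi> 0 R = defect x0 (\<lambda>\<xi>. of_real (if norm \<xi> < t then \<phi> (norm \<xi>) else 0) - of_real (if norm \<xi> < R then \<phi> (norm \<xi>) else 0))"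
      unfolding trunc_defect_defect using t R0 by (intro defect_diff[symmetric] decaying_cut(2)[OF m\<phi> b\<phi>]) auto
    also have "(\<lambda>\<xi> :: real^'n. complex_of_real (if norm \<xi> < t then \<phi> (norm \<xi>) else 0) - of_real (if norm \<xi> < R then \<phi> (norm \<xi>) else 0))
      = (\<lambda>\<xi>. of_real (if R \<le> norm \<xi> \<and> norm \<xi> < t then \<phi> (norm \<xi>) else 0))"
      using t by (auto simp: fun_eq_iff)
    also have "defect x0 \<dots> = trunc_defect x0 \<phi> R t" by (simp add: defect_def trunc_defect_def trunc_sum_def)
    finally show ?thesis ..
  qed
  have K: "K \<ge> 0" using D1[of 0] by (meson norm_ge_zero order_refl order_trans)
  have DtR1: "trunc_defect x0 G1 R t = trunc_defect x0 G1 0 t - trunc_defect x0 G1 0 R" if "t \<ge> R" for t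
    by (rule DtR[OF mG(1) B1(2) that])
  have DtR2: "trunc_defect x0 G2 R t = trunc_defect x0 G2 0 t - trunc_defect x0 G2 0 R" if "t \<ge> R" for t
    by (rule DtR[OF mG(2) B2(2) that])
  have DR1: "norm (trunc_defect x0 G1 R t) \<le> (2 * K) * (1 + t) powr 0" if t: "t \<ge> R" for t
    unfolding DtR1[OF t]
    using norm_triangle_ineq4[of "trunc_defect x0 G1 0 t" "trunc_defect x0 G1 0 R"] D1[of t] D1[of R] t R unfolding G1_def \<beta>1_def by simp
  have DR2: "norm (trunc_defect x0 G2 R t) \<le> (2 * K) * (1 + t) powr 0" if t: "t \<ge> R" for t
    unfolding DtR2[OF t]
    using norm_triangle_ineq4[of "trunc_defect x0 G2 0 t" "trunc_defect x0 G2 0 R"] D2[of t] D2[of R] t R unfolding G2_def \<beta>2_def by simp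
  have Lr: "\<kappa> + real (2 * DIM(real^'n)) + 2 \<le> real L" "\<bar>\<kappa> + 0\<bar> + 2 \<le> real L" "2 * DIM(real^'n) \<le> L" using L by auto
  have "\<exists>K1. \<forall>l>0. l \<ge> R \<longrightarrow>
     norm (defect x0 (\<lambda>\<xi>. of_real (if R \<le> norm \<xi> then G1 (norm \<xi>) * (g (norm \<xi>) * ((if norm \<xi> < l then 1 else 0) - \<eta> l (norm \<xi>))) else 0)))
       \<le> K1 * (1 + l) powr (\<kappa> + 0)"
    by (rule defect_outside_cutoff_bound[OF C0 \<eta>d \<eta>m \<eta>1 \<eta>2 \<eta>3 mG(1) B1(2) R0 C dg mgh(3,1) bg[folded \<kappa>_def] DR1 Lr(1,2)]; assumption)
  then obtain K1 where K1: "\<forall>l>0. l \<ge> R \<longrightarrow>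
     norm (defect x0 (\<lambda>\<xi>. of_real (if R \<le> norm \<xi> then G1 (norm \<xi>) * (g (norm \<xi>) * ((if norm \<xi> < l then 1 else 0) - \<eta> l (norm \<xi>))) else 0)))
       \<le> K1 * (1 + l) powr (\<kappa> + 0)" by (elim exE)

  have "\<exists>K2. \<forall>l>0. l \<ge> R \<longrightarrow>
     norm (defect x0 (\<lambda>\<xi>. of_real (if R \<le> norm \<xi> then G2 (norm \<xi>) * (h (norm \<xi>) * ((if norm \<xi> < l then 1 else 0) - \<eta> l (norm \<xi>))) else 0)))
       \<le> K2 * (1 + l) powr (\<kappa> + 0)"
    by (rule defect_outside_cutoff_bound[OF C0 \<eta>d \<eta>m \<eta>1 \<eta>2 \<eta>3 mG(2) B2(2) R0 C dh mgh(4,2) bh[folded \<kappa>_def] DR2 Lr(1,2)]; assumption)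
  then obtain K2 where K2: "\<forall>l>0. l \<ge> R \<longrightarrow>
     norm (defect x0 (\<lambda>\<xi>. of_real (if R \<le> norm \<xi> then G2 (norm \<xi>) * (h (norm \<xi>) * ((if norm \<xi> < l then 1 else 0) - \<eta> l (norm \<xi>))) else 0)))
       \<le> K2 * (1 + l) powr (\<kappa> + 0)" by (elim exE)
  define wsum where "wsum = (LINT \<xi>|count_space int_lattice. wt (\<xi> :: real^'n)) + (LINT \<xi>|lborel. wt (\<xi> :: real^'n))"
  have wsum: "wsum \<ge> 0" unfolding wsum_def by (intro add_nonneg_nonneg Bochner_Integration.integral_nonneg) auto
  define K' where "K' = C0 * (1 + R) ^ (2 * DIM(real^'n)) * wsum + (K1 / s1 + K2 / s2)"
  show thesis
  proof (rule that[of R K'])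
    fix l :: real assume l: "l > 0" "l \<ge> R"
    have "continuous_on UNIV (\<eta> l)"
      using \<eta>d[OF l(1)] by (intro continuous_at_imp_continuous_on ballI DERIV_isCont)
    then have m\<eta>: "\<eta> l \<in> borel_measurable borel" by (rule borel_measurable_continuous_onI)
    have m1: "(\<lambda>_::real. 1::real) \<in> borel_measurable borel" by simp
    have b1: "\<And>r::real. r \<ge> 0 \<Longrightarrow> \<bar>1::real\<bar> \<le> 1" by simp
    have E: "C0 * (1 + l) ^ L \<ge> 0" "2 * DIM(real^'n) \<le> L" using C0 l L by auto
    have g1: "decaying (\<lambda>\<xi> :: real^'n. of_real (if norm \<xi> < l then 1 else 0))"
      by (rule decaying_cut(2)[OF m1 b1 less_imp_le[OF l(1)]]; assumption)
    have g2: "norm (complex_of_real (\<eta> l (norm \<xi>))) \<le> (1 * (C0 * (1 + l) ^ L)) * wt \<xi>" for \<xi> :: "real^'n"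
      by (rule decaying_smooth_cut(1)[OF m1 m\<eta> b1 \<eta>3[OF l(1)] E, unfolded mult_1_left[of "\<eta> l _"]]; assumption)
    have g3: "decaying (\<lambda>\<xi> :: real^'n. of_real (\<eta> l (norm \<xi>)))"
      by (rule decaying_smooth_cut(2)[OF m1 m\<eta> b1 \<eta>3[OF l(1)] E, unfolded mult_1_left[of "\<eta> l _"]]; assumption)
    \<comment> \<open>Subtracting the cutoff leaves the defect unchanged, since 2 b < 1/2, but F is
      now concentrated near the sphere of radius l.\<close>
    define F where "F \<xi> = complex_of_real (if norm \<xi> < l then 1 else 0) - of_real (\<eta> l (norm \<xi>))" for \<xi> :: "real^'n"
    have gF: "decaying F" unfolding F_def[abs_def] by (rule decaying_diff[OF g1 g3])
    have Fb: "norm (F \<xi>) \<le> C0" for \<xi>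
    proof -
      have "norm (F \<xi>) = \<bar>(if norm \<xi> < l then 1 else 0) - \<eta> l (norm \<xi>)\<bar>"
        unfolding F_def by (simp only: of_real_diff[symmetric] norm_of_real)
      also have "\<dots> \<le> C0 * inverse ((1 + \<bar>norm \<xi> - l\<bar>) ^ L)" by (rule \<eta>1[OF l(1)]) simp
      also have "\<dots> \<le> C0 * 1" using C0 by (intro mult_left_mono) (auto simp: inverse_le_1_iff)
      finally show ?thesis by simp
    qed
    obtain c v where cv: "band_limited (lborel \<Otimes>\<^sub>M (lborel \<Otimes>\<^sub>M lborel) :: ((real^'n) \<times> (real^'n) \<times> (real^'n)) measure) c v (2 * b) (\<lambda>\<xi> :: real^'n. of_real (\<eta> l (norm \<xi>)))"
      using band_limited[OF l(1)] by blast
    have z: "defect x0 (\<lambda>\<xi>. of_real (\<eta> l (norm \<xi>))) = 0"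
      by (rule defect_band_limited_zero[OF cv _ b(2) x0 g2]) (use b E in auto)
    have LF: "trunc_defect x0 (\<lambda>_. 1) 0 l = defect x0 F"
      unfolding F_def[abs_def] defect_diff[OF g1 g3] z trunc_defect_defect by simp
    \<comment> \<open>F is split into the fixed ball of radius R, which contributes a bounded
      amount, and the two parts of the partition outside it.\<close>
    define m0 where "m0 \<xi> = (if norm \<xi> < R then 1 else 0 :: real)" for \<xi> :: "real^'n"
    define p1 where "p1 \<xi> = (if R \<le> norm \<xi> then g (norm \<xi>) * W \<mu>1 a (norm \<xi>) else 0)" for \<xi> :: "real^'n"
    define p2 where "p2 \<xi> = (if R \<le> norm \<xi> then h (norm \<xi>) * W \<mu>2 a (norm \<xi>) else 0)" for \<xi> :: "real^'n"
    have sum1: "m0 \<xi> + (p1 \<xi> + p2 \<xi>) = 1" for \<xi> using one by (auto simp: m0_def p1_def p2_def)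
    \<comment> \<open>Outside the ball the two parts are nonnegative with sum 1, so neither exceeds
      1. Multiplication by them keeps F in the class where defects add up.\<close>
    have p01: "\<bar>m0 \<xi>\<bar> \<le> 1" "\<bar>p1 \<xi>\<bar> \<le> 1" "\<bar>p2 \<xi>\<bar> \<le> 1" for \<xi>
      using one[of "norm \<xi>"] pos[of "norm \<xi>"] by (auto simp: m0_def p1_def p2_def)
    note [measurable] = mgh borel_measurable_W[OF \<mu>(1) a(1)] borel_measurable_W[OF \<mu>(2) a(1)]
    have mp: "m0 \<in> borel_measurable borel" "p1 \<in> borel_measurable borel" "p2 \<in> borel_measurable borel"
      unfolding m0_def[abs_def] p1_def[abs_def] p2_def[abs_def] by measurable
    note gm = decaying_mult[OF gF mp(1) p01(1)] decaying_mult[OF gF mp(2) p01(2)] decaying_mult[OF gF mp(3) p01(3)]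
    have "F = (\<lambda>\<xi>. of_real (m0 \<xi>) * F \<xi> + (of_real (p1 \<xi>) * F \<xi> + of_real (p2 \<xi>) * F \<xi>))"
    proof
      fix \<xi>
      have "of_real (m0 \<xi>) * F \<xi> + (of_real (p1 \<xi>) * F \<xi> + of_real (p2 \<xi>) * F \<xi>) = of_real (m0 \<xi> + (p1 \<xi> + p2 \<xi>)) * F \<xi>"
        by (simp add: algebra_simps)
      then show "F \<xi> = of_real (m0 \<xi>) * F \<xi> + (of_real (p1 \<xi>) * F \<xi> + of_real (p2 \<xi>) * F \<xi>)" by (simp add: sum1)
    qed
    then have "defect x0 F = defect x0 (\<lambda>\<xi>. of_real (m0 \<xi>) * F \<xi> + (of_real (p1 \<xi>) * F \<xi> + of_real (p2 \<xi>) * F \<xi>))"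
      by (rule arg_cong)
    also have "\<dots> = defect x0 (\<lambda>\<xi>. of_real (m0 \<xi>) * F \<xi>) + (defect x0 (\<lambda>\<xi>. of_real (p1 \<xi>) * F \<xi>) + defect x0 (\<lambda>\<xi>. of_real (p2 \<xi>) * F \<xi>))"
      by (simp only: defect_add[OF gm(1) decaying_add[OF gm(2,3)]] defect_add[OF gm(2,3)])
    finally have LF2: "defect x0 F = defect x0 (\<lambda>\<xi>. of_real (m0 \<xi>) * F \<xi>) + (defect x0 (\<lambda>\<xi>. of_real (p1 \<xi>) * F \<xi>) + defect x0 (\<lambda>\<xi>. of_real (p2 \<xi>) * F \<xi>))" .
    have n0: "norm (defect x0 (\<lambda>\<xi>. of_real (m0 \<xi>) * F \<xi>)) \<le> C0 * (1 + R) ^ (2 * DIM(real^'n)) * wsum"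
      unfolding wsum_def
    proof (rule defect_bound)
      fix \<xi> :: "real^'n"
      show "norm (of_real (m0 \<xi>) * F \<xi>) \<le> C0 * (1 + R) ^ (2 * DIM(real^'n)) * wt \<xi>"
      proof (cases "norm \<xi> < R")
        case True
        then have "1 \<le> (1 + R) ^ (2 * DIM(real^'n)) * wt \<xi>"
          using wt_bound[OF True] R0 by (simp add: field_simps)
        then have "C0 * 1 \<le> C0 * ((1 + R) ^ (2 * DIM(real^'n)) * wt \<xi>)" using C0 by (intro mult_left_mono) auto
        then show ?thesis using Fb[of \<xi>] True by (simp add: m0_def mult.assoc)
      next
        case False
        then show ?thesis using C0 R0 by (simp add: m0_def)
      qed
    qed
    have np1: "norm (defect x0 (\<lambda>\<xi>. of_real (p1 \<xi>) * F \<xi>)) \<le> K1 / s1 * (1 + l) powr \<kappa>"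
    proof -
      have eq: "(\<lambda>\<xi> :: real^'n. complex_of_real (if R \<le> norm \<xi> then G1 (norm \<xi>) * (g (norm \<xi>) * ((if norm \<xi> < l then 1 else 0) - \<eta> l (norm \<xi>))) else 0))
         = (\<lambda>\<xi>. of_real s1 * (of_real (p1 \<xi>) * F \<xi>))"
        by (auto simp: fun_eq_iff F_def p1_def Gs algebra_simps)
      have "norm (defect x0 (\<lambda>\<xi> :: real^'n. complex_of_real (if R \<le> norm \<xi> then G1 (norm \<xi>) * (g (norm \<xi>) * ((if norm \<xi> < l then 1 else 0) - \<eta> l (norm \<xi>))) else 0))) \<le> K1 * (1 + l) powr (\<kappa> + 0)"
        using K1 l by blast
      then have "norm (of_real s1 * defect x0 (\<lambda>\<xi>. of_real (p1 \<xi>) * F \<xi>)) \<le> K1 * (1 + l) powr \<kappa>"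
        unfolding eq defect_cmult by simp
      then show ?thesis using s by (simp add: norm_mult field_simps)
    qed
    have np2: "norm (defect x0 (\<lambda>\<xi>. of_real (p2 \<xi>) * F \<xi>)) \<le> K2 / s2 * (1 + l) powr \<kappa>"
    proof -
      have eq: "(\<lambda>\<xi> :: real^'n. complex_of_real (if R \<le> norm \<xi> then G2 (norm \<xi>) * (h (norm \<xi>) * ((if norm \<xi> < l then 1 else 0) - \<eta> l (norm \<xi>))) else 0))
         = (\<lambda>\<xi>. of_real s2 * (of_real (p2 \<xi>) * F \<xi>))"
        by (auto simp: fun_eq_iff F_def p2_def Gs algebra_simps)
      have "norm (defect x0 (\<lambda>\<xi> :: real^'n. complex_of_real (if R \<le> norm \<xi> then G2 (norm \<xi>) * (h (norm \<xi>) * ((if norm \<xi> < l then 1 else 0) - \<eta> l (norm \<xi>))) else 0))) \<le> K2 * (1 + l) powr (\<kappa> + 0)"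
        using K2 l by blast
      then have "norm (of_real s2 * defect x0 (\<lambda>\<xi>. of_real (p2 \<xi>) * F \<xi>)) \<le> K2 * (1 + l) powr \<kappa>"
        unfolding eq defect_cmult by simp
      then show ?thesis using s by (simp add: norm_mult field_simps)
    qed
    \<comment> \<open>As kappa > 0, the bounded contribution of the inner ball is absorbed into the
      power of 1 + l.\<close>
    have "(1 + l) powr \<kappa> \<ge> (1 + l) powr 0" using l \<mu>(1) unfolding \<kappa>_def by (intro powr_mono) auto
    then have ge1: "(1 + l) powr \<kappa> \<ge> 1" using l by simp
    have "norm (defect x0 F) \<le> C0 * (1 + R) ^ (2 * DIM(real^'n)) * wsum + (K1 / s1 * (1 + l) powr \<kappa> + K2 / s2 * (1 + l) powr \<kappa>)"
      unfolding LF2 by (rule order_trans[OF norm_triangle_ineq add_mono[OF n0 order_trans[OF norm_triangle_ineq add_mono[OF np1 np2]]]])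
    also have "C0 * (1 + R) ^ (2 * DIM(real^'n)) * wsum \<le> C0 * (1 + R) ^ (2 * DIM(real^'n)) * wsum * (1 + l) powr \<kappa>"
      using mult_left_mono[OF ge1, of "C0 * (1 + R) ^ (2 * DIM(real^'n)) * wsum"] C0 R0 wsum by simp
    finally have "norm (defect x0 F) \<le> K' * (1 + l) powr \<kappa>" unfolding K'_def by (simp add: distrib_right)
    moreover have "\<kappa> = (real CARD('n) - 1) / 2 + e" by (simp add: \<kappa>_def \<mu>1_def \<beta>1_def)
    ultimately show "norm (trunc_defect x0 (\<lambda>_. 1) 0 l) \<le> K' * (1 + l) powr ((real CARD('n) - 1) / 2 + e)"
      unfolding LF by simp
  qed
qed

theorem theorem7p1:
  fixes a :: real and x0 :: "real ^ 'n"
  assumes "CARD('n) = 2 \<or> CARD('n) = 3"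
    and "0 < a" and "a < 1 / 2"
    and "x0 \<in> torus"
  shows "(\<forall>\<beta> :: real. \<beta> > -1 \<longrightarrow>
            (\<lambda>r. fourier_partial_sum r (\<lambda>x. complex_of_real (u_fun \<beta> a x)) x0
                 - fourier_partial_integral r (\<lambda>x. complex_of_real (U_fun \<beta> a x)) x0)
              \<in> o[at_top](\<lambda>_. 1))
         \<longleftrightarrow>
         (\<forall>\<epsilon> :: real. \<epsilon> > 0 \<longrightarrow>
            (\<lambda>s. Delta0 s x0)
              \<in> O[at_top](\<lambda>s. complex_of_real (s powr ((real CARD('n) - 1) / 4 + \<epsilon>))))"
    (is "?difference \<longleftrightarrow> ?lattice")
proof
  define d where "d = real CARD('n)"
  have d: "d \<ge> 1" unfolding d_def by (simp add: Suc_leI)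
  have small_iff: "(\<lambda>r. fourier_partial_sum r (\<lambda>x. complex_of_real (u_fun \<beta> a x)) x0
                 - fourier_partial_integral r (\<lambda>x. complex_of_real (U_fun \<beta> a x)) x0) \<in> o[at_top](\<lambda>_. 1)
      \<longleftrightarrow> (trunc_defect x0 (U_profile CARD('n) \<beta> a) 0 \<longlongrightarrow> 0) at_top" if "\<beta> > -1" for \<beta>
    unfolding difference_trunc_defect[OF that assms(2,3)]
    using smalloI_tendsto[of "trunc_defect x0 (U_profile CARD('n) \<beta> a) 0" "\<lambda>_. 1" at_top]
      smalloD_tendsto[of "trunc_defect x0 (U_profile CARD('n) \<beta> a) 0" at_top "\<lambda>_. 1"] by auto
  define wsum where "wsum = (LINT \<xi>|count_space int_lattice. wt (\<xi> :: real^'n)) + (LINT \<xi>|lborel. wt (\<xi> :: real^'n))"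
  {
    assume L: ?lattice
    show ?difference
    proof (intro allI impI)
      fix \<beta> :: real assume \<beta>: "\<beta> > -1"
      \<comment> \<open>With this e, alpha - beta - (d + 1) / 2 equals -(beta + 1) / 2: half of the
        gap beta + 1 is spent on the lattice bound, and the other half leaves a negative power of
        l.\<close>
      define e where "e = (\<beta> + 1) / 4"
      have e: "e > 0" using \<beta> by (simp add: e_def)
      define \<alpha> where "\<alpha> = (d - 1) / 2 + 2 * e"
      have \<alpha>: "\<alpha> > 0" using d e by (auto simp: \<alpha>_def intro: add_nonneg_pos)
      have "(\<lambda>s. Delta0 s x0) \<in> O[at_top](\<lambda>s. complex_of_real (s powr ((d - 1) / 4 + e)))"
        using L e unfolding d_def by blast
      then obtain c where c: "c > 0" "\<forall>\<^sub>F s in at_top. norm (Delta0 s x0) \<le> c * norm (complex_of_real (s powr ((d - 1) / 4 + e)))"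
        by (rule landau_o.bigE)
      then obtain S where S: "\<And>s. s \<ge> S \<Longrightarrow> norm (Delta0 s x0) \<le> c * s powr ((d - 1) / 4 + e)"
        unfolding eventually_at_top_linorder by auto
      \<comment> \<open>T >= 1 gives t^2 >= t >= S for t >= T, so the bound at s = t^2 is
        available.\<close>
      define T where "T = max 1 S"
      have T: "T \<ge> 1" "T \<ge> S" unfolding T_def by auto
      define K where "K = c + 1 * (1 + T) ^ (2 * DIM(real^'n)) * wsum"
      have ws: "0 \<le> 1 * (1 + T) ^ (2 * DIM(real^'n)) * wsum"
        using T unfolding wsum_def by (intro mult_nonneg_nonneg add_nonneg_nonneg Bochner_Integration.integral_nonneg) auto
      \<comment> \<open>The asymptotic bound is extended to all t >= 0: the constant c serves for t
        >= T, and the crude polynomial bound below T.\<close>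
      have DK: "norm (trunc_defect x0 (\<lambda>_. 1) 0 t) \<le> K * (1 + t) powr \<alpha>" if t: "t \<ge> 0" for t
      proof (cases "t \<ge> T")
        case True
        have "t * 1 \<le> t * t" using True T by (intro mult_left_mono) auto
        then have "t\<^sup>2 \<ge> S" using True T unfolding power2_eq_square by linarith
        have "norm (trunc_defect x0 (\<lambda>_. 1) 0 t) \<le> c * (t\<^sup>2) powr ((d - 1) / 4 + e)"
          using S[OF \<open>t\<^sup>2 \<ge> S\<close>] unfolding Delta0_trunc_defect[OF t] .
        also have "(t\<^sup>2) powr ((d - 1) / 4 + e) = t powr \<alpha>"
        proof -
          have "t\<^sup>2 = t powr 2" using True T by (simp add: powr_numeral)
          moreover have "2 * ((d - 1) / 4 + e) = \<alpha>" by (simp add: \<alpha>_def)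
          ultimately show ?thesis by (simp only: powr_powr)
        qed
        also have "c * t powr \<alpha> \<le> K * (1 + t) powr \<alpha>"
          using c ws t \<alpha> unfolding K_def by (intro mult_mono powr_mono2) auto
        finally show ?thesis .
      next
        case False
        have "norm (trunc_defect x0 (\<lambda>_. 1) 0 t) \<le> 1 * (1 + T) ^ (2 * DIM(real^'n)) * wsum"
          unfolding wsum_def using False t by (intro trunc_defect_bound) auto
        also have "\<dots> \<le> K * 1" using c by (simp add: K_def)
        also have "\<dots> \<le> K * (1 + t) powr \<alpha>"
          using c ws t \<alpha> unfolding K_def by (intro mult_left_mono ge_one_powr_ge_zero) auto
        finally show ?thesis .
      qed
      obtain K' where K': "\<And>l. l > 0 \<Longrightarrow> norm (trunc_defect x0 (U_profile CARD('n) \<beta> a) 0 l) \<le> K' * (1 + l) powr (\<alpha> - \<beta> - (real CARD('n) + 1) / 2)"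
        by (rule lattice_bound_imp_difference_bound[OF \<beta> assms(2-4) DK that])
      have ex: "\<alpha> - \<beta> - (real CARD('n) + 1) / 2 = - (\<beta> + 1) / 2"
        unfolding \<alpha>_def d_def[symmetric] e_def by (simp add: field_simps)
      have "(trunc_defect x0 (U_profile CARD('n) \<beta> a) 0 \<longlongrightarrow> 0) at_top"
      proof (rule Lim_null_comparison)
        show "\<forall>\<^sub>F l in at_top. norm (trunc_defect x0 (U_profile CARD('n) \<beta> a) 0 l) \<le> K' * (1 + l) powr (- (\<beta> + 1) / 2)"
          using eventually_gt_at_top[of 0] by eventually_elim (use K' ex in auto)
        have "((\<lambda>l. (1 + l) powr (- (\<beta> + 1) / 2)) \<longlongrightarrow> 0) at_top"
          using \<beta> by (intro tendsto_neg_powr filterlim_tendsto_add_at_top[OF tendsto_const filterlim_ident]) auto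
        then show "((\<lambda>l. K' * (1 + l) powr (- (\<beta> + 1) / 2)) \<longlongrightarrow> 0) at_top"
          by (rule tendsto_mult_right_zero)
      qed
      then show "(\<lambda>r. fourier_partial_sum r (\<lambda>x. complex_of_real (u_fun \<beta> a x)) x0
                 - fourier_partial_integral r (\<lambda>x. complex_of_real (U_fun \<beta> a x)) x0) \<in> o[at_top](\<lambda>_. 1)"
        using small_iff[OF \<beta>] by blast
    qed
  }
  {
    assume D: ?difference
    \<comment> \<open>Of the o(1) hypothesis only this survives: eventually below 1, and bounded on
      the remaining finite range by the crude estimate.\<close>
    have bounded: "\<exists>K. \<forall>t\<ge>0. norm (trunc_defect x0 (U_profile CARD('n) \<beta> a) 0 t) \<le> K" if \<beta>: "\<beta> > -1" for \<beta>
    proof -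
      have "(trunc_defect x0 (U_profile CARD('n) \<beta> a) 0 \<longlongrightarrow> 0) at_top" using D \<beta> small_iff[OF \<beta>] by blast
      then have "\<forall>\<^sub>F t in at_top. dist (trunc_defect x0 (U_profile CARD('n) \<beta> a) 0 t) 0 < 1" by (rule tendstoD) simp
      then obtain T where T: "\<And>t. t \<ge> T \<Longrightarrow> norm (trunc_defect x0 (U_profile CARD('n) \<beta> a) 0 t) < 1"
        unfolding eventually_at_top_linorder by auto
      obtain B where B: "B > 0" "\<And>r. r \<ge> 0 \<Longrightarrow> \<bar>U_profile CARD('n) \<beta> a r\<bar> \<le> B"
        by (rule U_profile_bounded[OF \<beta> assms(2), of "CARD('n)", OF _ that]) (simp add: Suc_leI)
      define K where "K = max 1 (B * (1 + max T 0) ^ (2 * DIM(real^'n)) * wsum)"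
      have "norm (trunc_defect x0 (U_profile CARD('n) \<beta> a) 0 t) \<le> K" if t: "t \<ge> 0" for t
      proof (cases "t \<ge> T")
        case True
        then show ?thesis using T[of t] by (simp add: K_def less_imp_le max.coboundedI1)
      next
        case False
        have "norm (trunc_defect x0 (U_profile CARD('n) \<beta> a) 0 t) \<le> B * (1 + max T 0) ^ (2 * DIM(real^'n)) * wsum"
          unfolding wsum_def using False t by (intro trunc_defect_bound B) auto
        then show ?thesis by (simp add: K_def)
      qed
      then show ?thesis by blast
    qed
    show ?lattice
    proof (intro allI impI)
      fix \<epsilon> :: real assume \<epsilon>: "\<epsilon> > 0"
      \<comment> \<open>A smaller epsilon gives a stronger conclusion, so it may be cut down to the
        range e <= 1 in which the quantitative converse is stated.\<close>
      define e where "e = min \<epsilon> 1"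
      have e: "0 < e" "e \<le> 1" "e \<le> \<epsilon>" using \<epsilon> by (auto simp: e_def)
      obtain Ka where Ka: "\<forall>t\<ge>0. norm (trunc_defect x0 (U_profile CARD('n) (-1 + e) a) 0 t) \<le> Ka" using bounded[of "-1 + e"] e by auto
      obtain Kb where Kb: "\<forall>t\<ge>0. norm (trunc_defect x0 (U_profile CARD('n) (-1 + e / 2) a) 0 t) \<le> Kb" using bounded[of "-1 + e / 2"] e by auto
      have b1: "norm (trunc_defect x0 (U_profile CARD('n) (-1 + e) a) 0 t) \<le> max Ka Kb" if "t \<ge> 0" for t using Ka that by (simp add: max.coboundedI1)
      have b2: "norm (trunc_defect x0 (U_profile CARD('n) (-1 + e / 2) a) 0 t) \<le> max Ka Kb" if "t \<ge> 0" for t using Kb that by (simp add: max.coboundedI2)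
      obtain K' R where K': "\<And>l. l > 0 \<Longrightarrow> l \<ge> R \<Longrightarrow> norm (trunc_defect x0 (\<lambda>_. 1) 0 l) \<le> K' * (1 + l) powr ((real CARD('n) - 1) / 2 + e)"
        by (rule difference_bound_imp_lattice_bound[OF e(1,2) assms(2-4) b1 b2 that])
      define q where "q = (d - 1) / 2 + e"
      have q: "q > 0" using d e by (auto simp: q_def intro: add_nonneg_pos)
      show "(\<lambda>s. Delta0 s x0) \<in> O[at_top](\<lambda>s. complex_of_real (s powr ((real CARD('n) - 1) / 4 + \<epsilon>)))"
      proof (rule bigoI)
        show "\<forall>\<^sub>F s in at_top. norm (Delta0 s x0) \<le> \<bar>K'\<bar> * 2 powr q * norm (complex_of_real (s powr ((real CARD('n) - 1) / 4 + \<epsilon>)))"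
          using eventually_ge_at_top[of "max 1 (R\<^sup>2)"]
        proof eventually_elim
          fix s :: real assume s: "s \<ge> max 1 (R\<^sup>2)"
          define l where "l = sqrt s"
          have l: "l \<ge> 1" "l\<^sup>2 = s" using s by (auto simp: l_def)
          have "R \<le> \<bar>R\<bar>" by simp
          also have "\<dots> \<le> l" using s unfolding l_def by (intro real_le_rsqrt) auto
          finally have lR: "l \<ge> R" .
          have "norm (Delta0 s x0) = norm (trunc_defect x0 (\<lambda>_. 1) 0 l)" using Delta0_trunc_defect[of l x0] l by simp
          also have "\<dots> \<le> K' * (1 + l) powr q" using K'[of l] l lR unfolding q_def d_def by simp
          also have "\<dots> \<le> \<bar>K'\<bar> * (1 + l) powr q" by (intro mult_right_mono) auto
          also have "\<dots> \<le> \<bar>K'\<bar> * (2 * l) powr q" using l q by (intro mult_left_mono powr_mono2) auto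
          also have "(2 * l) powr q = 2 powr q * s powr (q / 2)"
          proof -
            have "l = s powr (1 / 2)" using s by (simp add: l_def powr_half_sqrt)
            then have "l powr q = s powr (q / 2)" by (simp add: powr_powr)
            then show ?thesis using l by (simp add: powr_mult)
          qed
          \<comment> \<open>Here q / 2 = (d - 1) / 4 + e / 2 with e / 2 <= epsilon, and s >= 1 makes
            the power increase with its exponent.\<close>
          also have "\<bar>K'\<bar> * (2 powr q * s powr (q / 2)) \<le> \<bar>K'\<bar> * (2 powr q * s powr ((d - 1) / 4 + \<epsilon>))"
            using s e unfolding q_def by (intro mult_left_mono powr_mono) (auto simp: field_simps)
          finally show "norm (Delta0 s x0) \<le> \<bar>K'\<bar> * 2 powr q * norm (complex_of_real (s powr ((real CARD('n) - 1) / 4 + \<epsilon>)))"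
            unfolding d_def by (simp add: mult.assoc)
        qed
      qed
    qed
  }
qed

end
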